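(* Let either $s = 2$ and $k \ge 5$, or $s \ge 3$ and $k \ge s+2$ (with $s,k$ integers). Let $$l(k) = \max\left\{ l \in \mathbb N : \binom{l}{s-1}(l+2) \le \binom{k}{s}\right\}.$$ Then $\dfrac{1}{\binom{l(k)}{s-1}} \in (S_k)'$.
   Context: For integers $s \ge 2$, $n \ge 1$ and $p\in[0,1]$, the random $s$-uniform hypergraph $G^s(n,p)$ is the random $s$-uniform hypergraph on vertex set $\{1,\dots,n\}$ in which each of the $\binom{n}{s}$ possible $s$-element edges is present independently with probability $p$ (for $s=2$ this is the Erdős–Rényi graph $G(n,p)$). First-order properties of $s$-uniform hypergraphs are those expressible by first-order formulae built from the $s$-ary predicate symbol $N$ (meaning "these $s$ vertices form an edge"), equality, logical connectives, variables and quantifiers $\forall,\exists$ over vertices; the quantifier depth of a formula is the maximum number of nested quantifiers. For a first-order property $L$, its spectrum $S(L)$ is the set of all $\alpha \in (0, s-1)$ for which it is not the case that $\lim_{n\to\infty}\Pr[G^s(n,n^{-\alpha}) \models L]$ exists and equals $0$ or $1$. $S_k$ is the union of $S(L)$ over all first-order properties $L$ expressible by a formula of quantifier depth at most $k$. $(S_k)'$ denotes the set of limit points of $S_k$. $\mathbb N=\{1,2,\dots\}$. *)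

theory Defs
  imports "HOL-Probability.Product_PMF"
begin

datatype fm =
    Equal nat nat
  | N "nat list"
  | Neg fm
  | Conj fm fm
  | Disj fm fm
  | Impl fm fm
  | Exists nat fm
  | Forall nat fm

fun well_formed :: "nat \<Rightarrow> fm \<Rightarrow> bool" where
  "well_formed s (Equal x y) = True"
| "well_formed s (N xs) = (length xs = s)"
| "well_formed s (Neg \<phi>) = well_formed s \<phi>"
| "well_formed s (Conj \<phi> \<psi>) = (well_formed s \<phi> \<and> well_formed s \<psi>)"
| "well_formed s (Disj \<phi> \<psi>) = (well_formed s \<phi> \<and> well_formed s \<psi>)"
| "well_formed s (Impl \<phi> \<psi>) = (well_formed s \<phi> \<and> well_formed s \<psi>)"
| "well_formed s (Exists x \<phi>) = well_formed s \<phi>"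
| "well_formed s (Forall x \<phi>) = well_formed s \<phi>"

fun free_vars :: "fm \<Rightarrow> nat set" where
  "free_vars (Equal x y) = {x, y}"
| "free_vars (N xs) = set xs"
| "free_vars (Neg \<phi>) = free_vars \<phi>"
| "free_vars (Conj \<phi> \<psi>) = free_vars \<phi> \<union> free_vars \<psi>"
| "free_vars (Disj \<phi> \<psi>) = free_vars \<phi> \<union> free_vars \<psi>"
| "free_vars (Impl \<phi> \<psi>) = free_vars \<phi> \<union> free_vars \<psi>"
| "free_vars (Exists x \<phi>) = free_vars \<phi> - {x}"
| "free_vars (Forall x \<phi>) = free_vars \<phi> - {x}"

fun quantifier_depth :: "fm \<Rightarrow> nat" where
  "quantifier_depth (Equal x y) = 0"
| "quantifier_depth (N xs) = 0"
| "quantifier_depth (Neg \<phi>) = quantifier_depth \<phi>"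
| "quantifier_depth (Conj \<phi> \<psi>) = max (quantifier_depth \<phi>) (quantifier_depth \<psi>)"
| "quantifier_depth (Disj \<phi> \<psi>) = max (quantifier_depth \<phi>) (quantifier_depth \<psi>)"
| "quantifier_depth (Impl \<phi> \<psi>) = max (quantifier_depth \<phi>) (quantifier_depth \<psi>)"
| "quantifier_depth (Exists x \<phi>) = Suc (quantifier_depth \<phi>)"
| "quantifier_depth (Forall x \<phi>) = Suc (quantifier_depth \<phi>)"

(* E is meant to be a set of s-element sets, so N xs with length xs = s fails
   whenever two of its arguments denote the same vertex. *)
fun sat :: "'a set \<Rightarrow> 'a set set \<Rightarrow> (nat \<Rightarrow> 'a) \<Rightarrow> fm \<Rightarrow> bool" where
  "sat V E v (Equal x y) = (v x = v y)"
| "sat V E v (N xs) = (v ` set xs \<in> E)"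
| "sat V E v (Neg \<phi>) = (\<not> sat V E v \<phi>)"
| "sat V E v (Conj \<phi> \<psi>) = (sat V E v \<phi> \<and> sat V E v \<psi>)"
| "sat V E v (Disj \<phi> \<psi>) = (sat V E v \<phi> \<or> sat V E v \<psi>)"
| "sat V E v (Impl \<phi> \<psi>) = (sat V E v \<phi> \<longrightarrow> sat V E v \<psi>)"
| "sat V E v (Exists x \<phi>) = (\<exists>a\<in>V. sat V E (v(x := a)) \<phi>)"
| "sat V E v (Forall x \<phi>) = (\<forall>a\<in>V. sat V E (v(x := a)) \<phi>)"

(* A property of hypergraphs on {1..n} is a predicate of n and the edge set. *)
type_synonym hg_property = "nat \<Rightarrow> nat set set \<Rightarrow> bool"

(* Only used for sentences, where the valuation is irrelevant. *)
definition property_of :: "fm \<Rightarrow> hg_property" where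
  "property_of \<phi> n E = sat {1..n} E (\<lambda>_. 1) \<phi>"

definition potential_edges :: "nat \<Rightarrow> nat \<Rightarrow> nat set set" where
  "potential_edges s n = {e. e \<subseteq> {1..n} \<and> card e = s}"

definition expressible :: "nat \<Rightarrow> nat \<Rightarrow> hg_property \<Rightarrow> bool" where
  "expressible s k L \<longleftrightarrow>
     (\<exists>\<phi>. well_formed s \<phi> \<and> free_vars \<phi> = {} \<and> quantifier_depth \<phi> \<le> k \<and>
       (\<forall>n\<ge>1. \<forall>E\<subseteq>potential_edges s n. L n E = property_of \<phi> n E))"

definition random_hypergraph :: "nat \<Rightarrow> nat \<Rightarrow> real \<Rightarrow> nat set set pmf" where
  "random_hypergraph s n p =
     map_pmf (\<lambda>f. {e \<in> potential_edges s n. f e})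
       (Pi_pmf (potential_edges s n) False (\<lambda>_. bernoulli_pmf p))"

definition prob_property :: "nat \<Rightarrow> nat \<Rightarrow> real \<Rightarrow> hg_property \<Rightarrow> real" where
  "prob_property s n p L = measure_pmf.prob (random_hypergraph s n p) {E. L n E}"

definition spectrum :: "nat \<Rightarrow> hg_property \<Rightarrow> real set" where
  "spectrum s L = {\<alpha>. 0 < \<alpha> \<and> \<alpha> < real s - 1 \<and>
     \<not> ((\<lambda>n. prob_property s n (real n powr (- \<alpha>)) L) \<longlonglongrightarrow> 0 \<or>
        (\<lambda>n. prob_property s n (real n powr (- \<alpha>)) L) \<longlonglongrightarrow> 1)}"

definition spectrum_depth :: "nat \<Rightarrow> nat \<Rightarrow> real set" where
  "spectrum_depth s k = (\<Union>L\<in>{L. expressible s k L}. spectrum s L)"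

definition l_max :: "nat \<Rightarrow> nat \<Rightarrow> nat" where
  "l_max s k = Max {l. 1 \<le> l \<and> (l choose (s - 1)) * (l + 2) \<le> k choose s}"

end

theory Submission
  imports Defs "HOL-Real_Asymp.Real_Asymp"
begin

text \<open>
  Write \<open>l = l(k)\<close>, \<open>d = (l choose s - 1)\<close>, \<open>r = k - l - 2\<close>. Near \<open>\<alpha> = 1/d\<close> a vertex attached to an
  \<open>l\<close>-set \<open>A\<close> by all \<open>d\<close> possible edges costs a factor \<open>n p\<^sup>d = n\<^bsup>-r/q\<^esup>\<close>, where
  \<open>\<alpha> = (1 + r/q)/d\<close>. Call the set of all such vertices the neighbourhood of \<open>A\<close>. A configuration on
  \<open>k\<close> vertices with \<open>d (l + 2)\<close> edges (this is where \<open>d (l + 2) \<le> (k choose s)\<close> enters) that contains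
  \<open>A\<close> and \<open>k - l\<close> of its neighbours has, up to the factor \<open>n p\<^sup>d\<close> per step, weight \<open>n\<^sup>r\<close>, the
  same as \<open>r\<close> free vertices. So the largest neighbourhood size \<open>m\<close> occurring above such a
  configuration, and the largest number of vertices to which some \<open>r\<close>-set \<open>T\<close> can always be linked by
  intermediate vertices, move in step as \<open>q\<close> varies.

  The sentence says: there is such a configuration over \<open>A\<close> for which no \<open>r\<close>-set \<open>T\<close> is linked to
  all neighbours of \<open>A\<close> (and to a few fixed subsets of \<open>A\<close>). It needs \<open>l + r + 2 = k\<close> nested
  quantifiers. If the neighbourhood has fewer than \<open>m\<close> elements, \<open>T\<close> exists almost surely, by a
  second moment bound in many disjoint, hence independent, groups of vertices. Neighbourhoods of
  size \<open>m\<close> appear with probability bounded away from \<open>0\<close> (second moment) and from \<open>1\<close> (first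
  moment), and above such a neighbourhood \<open>T\<close> is missing with probability bounded away from \<open>0\<close>.
  Hence \<open>(1 + r/q)/d\<close> lies in the spectrum for all large \<open>q\<close>.
\<close>

section \<open>Probabilities in the random hypergraph\<close>

text \<open>A sentence of depth \<open>k\<close> cannot count up to \<open>m\<close>, and
  \<open>m\<close> grows with \<open>q\<close>; comparing the neighbourhood of A with linkability
  replaces counting. That both thresholds are hit at the same \<open>q\<close> is exact arithmetic.
  A configuration with \<open>m\<close> neighbours has \<open>l + m\<close> vertices and
  \<open>d (l + 2) + d (m - r - 2) = d (m + l - r)\<close> edges; at p = n^(-(1 + r/q)/d) its
  expected number has order one exactly if q = m + l - r. The expected number of
  \<open>r\<close>-sets T linked to N given sets has order n^r (n p^d)^N = n^(r - r N/q), which is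
  one exactly if N = q. The neighbours supply only \<open>m\<close> sets to link, so
  \<open>l - r\<close> fixed subsets of A (the family \<open>\<X>\<close>) make up the difference.
  With one neighbour fewer there are q - 1 sets, and the expected number of T grows like n^(r/q).

  Order one for the whole configuration helps only if no subconfiguration is rarer. This balance
  leaves a slack of about 1/d in the exponent against losses of order r/q, which is why
  \<open>q\<close> must be large.

  In the opposite direction one vertex may link several sets to T at once; such sharing must be
  shown to be negligible.\<close>

abbreviation hprob :: "nat \<Rightarrow> nat \<Rightarrow> real \<Rightarrow> (nat set set \<Rightarrow> bool) \<Rightarrow> real" where
  "hprob s n p X \<equiv> measure_pmf.prob (random_hypergraph s n p) {E. X E}"

lemma finite_potential_edges [simp]: "finite (potential_edges s n)"
  by (rule finite_subset[of _ "Pow {1..n}"]) (auto simp: potential_edges_def)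

lemma set_pmf_random_hypergraph: "set_pmf (random_hypergraph s n p) \<subseteq> Pow (potential_edges s n)"
  by (auto simp: random_hypergraph_def)

lemma finite_set_pmf_random_hypergraph: "finite (set_pmf (random_hypergraph s n p))"
  by (rule finite_subset[OF set_pmf_random_hypergraph]) simp

lemma hprob_mono:
  assumes "\<And>E. E \<subseteq> potential_edges s n \<Longrightarrow> X E \<Longrightarrow> Y E"
  shows "hprob s n p X \<le> hprob s n p Y"
proof -
  let ?M = "random_hypergraph s n p"
  have "measure_pmf.prob ?M {E. X E} = measure_pmf.prob ?M ({E. X E} \<inter> set_pmf ?M)"
    by (simp add: measure_Int_set_pmf)
  also have "\<dots> \<le> measure_pmf.prob ?M {E. Y E}"
    using assms set_pmf_random_hypergraph[of s n p]
    by (intro measure_pmf.finite_measure_mono) auto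
  finally show ?thesis .
qed

lemma hprob_not: "hprob s n p (\<lambda>E. \<not> X E) = 1 - hprob s n p X"
proof -
  have "{E. \<not> X E} = space (measure_pmf (random_hypergraph s n p)) - {E. X E}" by auto
  then show ?thesis using measure_pmf.prob_compl[of "{E. X E}" "random_hypergraph s n p"] by simp
qed

lemma hprob_superset:
  assumes "0 \<le> p" "p \<le> 1" "F \<subseteq> potential_edges s n"
  shows "hprob s n p (\<lambda>E. F \<subseteq> E) = p ^ card F"
proof -
  let ?D = "potential_edges s n"
  let ?M = "Pi_pmf ?D False (\<lambda>_. bernoulli_pmf p)"
  have "hprob s n p (\<lambda>E. F \<subseteq> E)
      = measure_pmf.prob ?M ((\<lambda>f. {e \<in> ?D. f e}) -` {E. F \<subseteq> E})"
    by (simp add: random_hypergraph_def)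
  also have "(\<lambda>f. {e \<in> ?D. f e}) -` {E. F \<subseteq> E} = Pi ?D (\<lambda>e. if e \<in> F then {True} else UNIV)"
    using assms(3) by (fastforce simp: Pi_iff split: if_splits)
  also have "measure_pmf.prob ?M \<dots>
      = (\<Prod>e\<in>?D. measure_pmf.prob (bernoulli_pmf p) (if e \<in> F then {True} else UNIV))"
    by (rule measure_Pi_pmf_Pi) simp
  also have "\<dots> = (\<Prod>e\<in>?D. if e \<in> F then p else 1)"
    using assms by (intro prod.cong) (auto simp: measure_pmf_single)
  also have "\<dots> = p ^ card F"
    using assms(3) by (subst prod.If_cases) (auto simp: Int_absorb1 finite_subset)
  finally show ?thesis .
qed

lemma hprob_indep:
  assumes X: "\<And>E. X E \<longleftrightarrow> X (E \<inter> D1)" and Y: "\<And>E. Y E \<longleftrightarrow> Y (E \<inter> D2)"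
    and disj: "D1 \<inter> D2 = {}"
  shows "hprob s n p (\<lambda>E. X E \<and> Y E) = hprob s n p X * hprob s n p Y"
proof -
  let ?D = "potential_edges s n"
  let ?A = "?D \<inter> D1" and ?B = "?D - D1"
  let ?P = "\<lambda>A. Pi_pmf A False (\<lambda>_::nat set. bernoulli_pmf p)"
  let ?g = "\<lambda>(f, g) e. if e \<in> ?A then f e else g e :: bool"
  let ?S = "\<lambda>f. {e \<in> ?D. f e}"
  have D: "?D = ?A \<union> ?B" by auto
  have "?P ?D = ?P (?A \<union> ?B)" using D by metis
  also have "\<dots> = map_pmf ?g (pair_pmf (?P ?A) (?P ?B))"
    by (rule Pi_pmf_union) auto
  finally have rh: "random_hypergraph s n p
      = map_pmf (\<lambda>x. ?S (?g x)) (pair_pmf (?P ?A) (?P ?B))"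
    by (simp add: random_hypergraph_def map_pmf_comp)
  \<comment> \<open>Stated for all X and Y so that it also applies with the constant event
    \<open>True\<close>, which identifies the two factors as the marginal probabilities.\<close>
  have XY: "hprob s n p (\<lambda>E. X E \<and> Y E)
      = measure_pmf.prob (?P ?A) {f. X {e \<in> ?A. f e}} * measure_pmf.prob (?P ?B) {g. Y {e \<in> ?B. g e}}"
    if X: "\<And>E. X E \<longleftrightarrow> X (E \<inter> D1)" and Y: "\<And>E. Y E \<longleftrightarrow> Y (E \<inter> D2)"
    for X Y :: "nat set set \<Rightarrow> bool"
  proof -
    let ?F = "{f. X {e \<in> ?A. f e}}" and ?G = "{g. Y {e \<in> ?B. g e}}"
    let ?M = "pair_pmf (?P ?A) (?P ?B)"
    have "(\<lambda>x. ?S (?g x)) -` {E. X E \<and> Y E} = ?F \<times> ?G"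
    proof (rule set_eqI, clarify)
      fix f g
      have "{e \<in> ?D. ?g (f, g) e} \<inter> D1 = {e \<in> ?A. f e} \<inter> D1" by auto
      moreover have "{e \<in> ?D. ?g (f, g) e} \<inter> D2 = {e \<in> ?B. g e} \<inter> D2" using disj by auto
      ultimately show "(f, g) \<in> (\<lambda>x. ?S (?g x)) -` {E. X E \<and> Y E} \<longleftrightarrow> (f, g) \<in> ?F \<times> ?G"
        using X[of "{e \<in> ?D. ?g (f, g) e}"] Y[of "{e \<in> ?D. ?g (f, g) e}"]
          X[of "{e \<in> ?A. f e}"] Y[of "{e \<in> ?B. g e}"] by simp
    qed
    then have "hprob s n p (\<lambda>E. X E \<and> Y E) = measure_pmf.prob ?M (?F \<times> ?G)"
      unfolding rh measure_map_pmf by simp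
    also have "\<dots> = measure_pmf.prob ?M ((?F \<times> ?G) \<inter> set_pmf ?M)"
      by (rule measure_Int_set_pmf[symmetric])
    also have "(?F \<times> ?G) \<inter> set_pmf ?M = (?F \<inter> set_pmf (?P ?A)) \<times> (?G \<inter> set_pmf (?P ?B))"
      by auto
    also have "measure_pmf.prob ?M \<dots> = measure_pmf.prob (?P ?A) ?F * measure_pmf.prob (?P ?B) ?G"
      by (subst measure_pmf_prob_product) (auto simp: measure_Int_set_pmf)
    finally show ?thesis .
  qed
  have "hprob s n p X = measure_pmf.prob (?P ?A) {f. X {e \<in> ?A. f e}}"
    using XY[of X "\<lambda>_. True"] X by simp
  moreover have "hprob s n p Y = measure_pmf.prob (?P ?B) {g. Y {e \<in> ?B. g e}}"
    using XY[of "\<lambda>_. True" Y] Y by simp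
  ultimately show ?thesis using XY[of X Y] X Y by simp
qed

lemma hprob_all_indep_le:
  assumes "finite I" and X: "\<And>i E. i \<in> I \<Longrightarrow> X i E \<longleftrightarrow> X i (E \<inter> D i)"
    and "disjoint_family_on D I" and "\<And>i. i \<in> I \<Longrightarrow> hprob s n p (X i) \<le> c" and "0 \<le> c"
  shows "hprob s n p (\<lambda>E. \<forall>i\<in>I. X i E) \<le> c ^ card I"
  using assms
proof (induction I rule: finite_induct)
  case empty
  then show ?case by simp
next
  case (insert i I)
  have "hprob s n p (\<lambda>E. \<forall>j\<in>insert i I. X j E) = hprob s n p (\<lambda>E. X i E \<and> (\<forall>j\<in>I. X j E))"
    by simp
  also have "\<dots> = hprob s n p (X i) * hprob s n p (\<lambda>E. \<forall>j\<in>I. X j E)"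
  proof (rule hprob_indep)
    show "X i E \<longleftrightarrow> X i (E \<inter> D i)" for E by (rule insert.prems(1)) simp
    show "(\<forall>j\<in>I. X j E) \<longleftrightarrow> (\<forall>j\<in>I. X j (E \<inter> (\<Union>j\<in>I. D j)))" for E
    proof (rule ball_cong[OF refl])
      fix j assume j: "j \<in> I"
      then have *: "E \<inter> (\<Union>j\<in>I. D j) \<inter> D j = E \<inter> D j" by auto
      have "X j E \<longleftrightarrow> X j (E \<inter> D j)"
        by (rule insert.prems(1)) (simp add: j)
      also have "\<dots> \<longleftrightarrow> X j (E \<inter> (\<Union>j\<in>I. D j) \<inter> D j)"
        by (simp only: *)
      also have "\<dots> \<longleftrightarrow> X j (E \<inter> (\<Union>j\<in>I. D j))"
        by (rule insert.prems(1)[symmetric]) (simp add: j)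
      finally show "X j E \<longleftrightarrow> X j (E \<inter> (\<Union>j\<in>I. D j))" .
    qed
    show "D i \<inter> (\<Union>j\<in>I. D j) = {}"
      using insert.prems(2) insert.hyps(2) by (auto simp: disjoint_family_on_def)
  qed
  also have "\<dots> \<le> c * c ^ card I"
  proof (intro mult_mono)
    show "hprob s n p (\<lambda>E. \<forall>j\<in>I. X j E) \<le> c ^ card I"
    proof (rule insert.IH)
      show "X j E \<longleftrightarrow> X j (E \<inter> D j)" if "j \<in> I" for j E
        by (rule insert.prems(1)) (simp add: that)
      show "disjoint_family_on D I" using insert.prems(2) by (auto simp: disjoint_family_on_def)
    qed (use insert.prems(3,4) in auto)
  qed (use insert.prems(3,4) in auto)
  finally show ?case using insert.hyps by simp
qed

section \<open>The second moment method for partite copies\<close>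

text \<open>With N the number of events that occur, 2 t N - t^2 N^2 is at most 1 and vanishes for N
  = 0, hence lies below the indicator of N > 0. Taking expectations with t = A/B gives A^2/B. In
  this form a lower bound for E N and an upper bound for E N^2 suffice.\<close>

lemma second_moment_pmf:
  fixes M :: "'a pmf"
  assumes fin: "finite (set_pmf M)" and P: "finite P" and "0 \<le> A" "0 < B"
    and A: "A \<le> (\<Sum>\<phi>\<in>P. measure_pmf.prob M {E. X \<phi> E})"
    and B: "(\<Sum>\<phi>\<in>P. \<Sum>\<psi>\<in>P. measure_pmf.prob M {E. X \<phi> E \<and> X \<psi> E}) \<le> B"
  shows "A\<^sup>2 / B \<le> measure_pmf.prob M {E. \<exists>\<phi>\<in>P. X \<phi> E}"
proof -
  let ?i = "\<lambda>X E. indicator {E. X E} E :: real"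
  let ?N = "\<lambda>E. \<Sum>\<phi>\<in>P. ?i (X \<phi>) E"
  define t where "t = A / B"
  have t: "0 \<le> t" using assms by (simp add: t_def)
  have int: "integrable (measure_pmf M) f" for f :: "'a \<Rightarrow> real"
    using fin by (rule integrable_measure_pmf_finite)
  have pt: "2 * t * ?N E - t\<^sup>2 * (?N E)\<^sup>2 \<le> ?i (\<lambda>E. \<exists>\<phi>\<in>P. X \<phi> E) E" for E
  proof (cases "\<exists>\<phi>\<in>P. X \<phi> E")
    case True
    have "0 \<le> (1 - t * ?N E)\<^sup>2" by simp
    with True show ?thesis by (simp add: power2_eq_square algebra_simps)
  next
    case False
    then have "?N E = 0" by simp
    then show ?thesis by simp
  qed
  have sq: "(?N E)\<^sup>2 = (\<Sum>\<phi>\<in>P. \<Sum>\<psi>\<in>P. ?i (\<lambda>E. X \<phi> E \<and> X \<psi> E) E)" for E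
    by (simp add: power2_eq_square sum_product indicator_def mult.commute flip: of_bool_conj)
  have "2 * t * A - t\<^sup>2 * B \<le> 2 * t * (\<Sum>\<phi>\<in>P. measure_pmf.prob M {E. X \<phi> E})
      - t\<^sup>2 * (\<Sum>\<phi>\<in>P. \<Sum>\<psi>\<in>P. measure_pmf.prob M {E. X \<phi> E \<and> X \<psi> E})"
    using A B t by (intro diff_mono mult_left_mono) auto
  also have "\<dots> = measure_pmf.expectation M (\<lambda>E. 2 * t * ?N E - t\<^sup>2 * (?N E)\<^sup>2)"
    by (simp add: sq int)
  also have "\<dots> \<le> measure_pmf.expectation M (?i (\<lambda>E. \<exists>\<phi>\<in>P. X \<phi> E))"
    by (intro integral_mono int pt)
  also have "\<dots> = measure_pmf.prob M {E. \<exists>\<phi>\<in>P. X \<phi> E}" by simp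
  also have "2 * t * A - t\<^sup>2 * B = A\<^sup>2 / B"
    using assms(4) by (simp add: t_def power2_eq_square field_simps)
  finally show ?thesis .
qed

text \<open>The class of a vertex reveals its index, so an edge of a copy remembers its edge in the
  pattern. This is the reason for partite copies: two of them never overlap in a permuted
  way.\<close>

lemma partite_image_eqD:
  assumes V: "disjoint_family_on V J" and \<phi>: "\<phi> \<in> PiE J V" and \<psi>: "\<psi> \<in> PiE J V"
    and h: "h \<subseteq> J" and h': "h' \<subseteq> J" and eq: "\<phi> ` h = \<psi> ` h'"
  shows "h = h' \<and> (\<forall>j\<in>h. \<phi> j = \<psi> j)"
proof -
  have *: "i \<in> h' \<and> \<phi> i = \<psi> i"
    if "\<phi> \<in> PiE J V" "\<psi> \<in> PiE J V" "h \<subseteq> J" "h' \<subseteq> J" "\<phi> ` h = \<psi> ` h'" "i \<in> h"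
    for \<phi> \<psi> h h' i
  proof -
    from that obtain j where j: "j \<in> h'" "\<phi> i = \<psi> j" by blast
    have "\<phi> i \<in> V i" "\<psi> j \<in> V j" using that j by (meson PiE_mem subsetD)+
    moreover have "i \<in> J" "j \<in> J" using that j by auto
    ultimately have "i = j" using V j by (auto simp: disjoint_family_on_def)
    with j show ?thesis by auto
  qed
  from *[OF \<phi> \<psi> h h' eq] *[OF \<psi> \<phi> h' h eq[symmetric]] show ?thesis by blast
qed

lemma partite_inj_on:
  assumes V: "disjoint_family_on V J" and \<phi>: "\<phi> \<in> PiE J V"
  shows "inj_on \<phi> J"
proof (rule inj_onI)
  fix i j assume "i \<in> J" "j \<in> J" "\<phi> i = \<phi> j"
  then show "i = j" using partite_image_eqD[OF V \<phi> \<phi>, of "{i}" "{j}"] by auto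
qed

lemma partite_copy_subset:
  assumes V: "\<And>j. j \<in> J \<Longrightarrow> V j \<subseteq> {1..n}" and disj: "disjoint_family_on V J"
    and \<phi>: "\<phi> \<in> PiE J V" and H: "\<And>h. h \<in> H \<Longrightarrow> h \<subseteq> J \<and> card h = s"
  shows "(\<lambda>h. \<phi> ` h) ` H \<subseteq> potential_edges s n"
proof
  fix e assume "e \<in> (\<lambda>h. \<phi> ` h) ` H"
  then obtain h where h: "h \<in> H" "e = \<phi> ` h" by auto
  have "card e = s" using H[OF h(1)] h partite_inj_on[OF disj \<phi>]
    by (auto simp: card_image inj_on_subset)
  moreover have "e \<subseteq> {1..n}" unfolding h
  proof (rule image_subsetI)
    fix j assume "j \<in> h"
    then have "j \<in> J" using H h by auto
    then show "\<phi> j \<in> {1..n}" using V[of j] \<phi> by auto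
  qed
  ultimately show "e \<in> potential_edges s n" by (simp add: potential_edges_def)
qed

lemma partite_copy_prob:
  assumes V: "\<And>j. j \<in> J \<Longrightarrow> V j \<subseteq> {1..n}" and disj: "disjoint_family_on V J"
    and \<phi>: "\<phi> \<in> PiE J V" and H: "\<And>h. h \<in> H \<Longrightarrow> h \<subseteq> J \<and> card h = s"
    and p: "0 \<le> p" "p \<le> 1"
  shows "hprob s n p (\<lambda>E. \<forall>h\<in>H. \<phi> ` h \<in> E) = p ^ card H"
proof -
  have "inj_on (\<lambda>h. \<phi> ` h) H"
    using partite_image_eqD[OF disj \<phi> \<phi>] H by (meson inj_onI)
  then show ?thesis
    using hprob_superset[OF p partite_copy_subset[of J V n \<phi> H s, OF V disj \<phi> H]]
    by (simp add: card_image image_subset_iff)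
qed

text \<open>Two copies share exactly the pattern edges inside the set S of indices on which they
  agree. By the hypothesis on \<open>\<kappa>\<close> such a pair has probability at most p^(2 |H|)
  / \<open>\<kappa>\<close> times the product of the class sizes over S; the sum over
  \<open>\<psi>\<close> then factorizes over the indices, each contributing at most twice its class
  size. \<open>G\<close> is a further event of conditional probability at least \<open>g\<close>
  given the copy; the pair bound discards it.\<close>

lemma partite_second_moment:
  fixes V :: "'j \<Rightarrow> nat set"
  assumes J: "finite J" and V: "\<And>j. j \<in> J \<Longrightarrow> V j \<subseteq> {1..n}" and disj: "disjoint_family_on V J"
    and H: "\<And>h. h \<in> H \<Longrightarrow> h \<subseteq> J \<and> card h = s"
    and p: "0 < p" "p \<le> 1" and "0 < \<kappa>" "0 \<le> g"
    and \<kappa>: "\<And>S. S \<subseteq> J \<Longrightarrow> \<kappa> \<le> (\<Prod>j\<in>S. real (card (V j))) * p ^ card {h \<in> H. h \<subseteq> S}"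
    and G: "\<And>\<phi>. \<phi> \<in> PiE J V \<Longrightarrow> g * p ^ card H \<le> hprob s n p (\<lambda>E. (\<forall>h\<in>H. \<phi> ` h \<in> E) \<and> G \<phi> E)"
  shows "g\<^sup>2 * \<kappa> / 2 ^ card J \<le> hprob s n p (\<lambda>E. \<exists>\<phi>\<in>PiE J V. (\<forall>h\<in>H. \<phi> ` h \<in> E) \<and> G \<phi> E)"
proof -
  let ?P = "PiE J V"
  let ?X = "\<lambda>\<phi> E. (\<forall>h\<in>H. \<phi> ` h \<in> E) \<and> G \<phi> E"
  let ?F = "\<lambda>\<phi>. (\<lambda>h. \<phi> ` h) ` H"
  define c where "c = real (card ?P)"
  have finV: "finite (V j)" if "j \<in> J" for j using V[OF that] finite_subset by blast
  have finP: "finite ?P" using J finV by (intro finite_PiE) auto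
  have finH: "finite H" by (rule finite_subset[of _ "Pow J"]) (use H J in auto)
  have cV: "0 < real (card (V j))" if "j \<in> J" for j
  proof (rule ccontr)
    assume "\<not> ?thesis"
    then have "(\<Prod>j\<in>{j}. real (card (V j))) = 0" by simp
    with \<kappa>[of "{j}"] that \<open>0 < \<kappa>\<close> show False by simp
  qed
  have c: "c = (\<Prod>j\<in>J. real (card (V j)))" using J by (simp add: c_def card_PiE)
  have c0: "0 < c" unfolding c using cV by (intro prod_pos) auto
  have inj: "inj_on (\<lambda>h. \<phi> ` h) H" if "\<phi> \<in> ?P" for \<phi>
    using partite_image_eqD[OF disj that that] H by (meson inj_onI)
  have FD: "?F \<phi> \<subseteq> potential_edges s n" if "\<phi> \<in> ?P" for \<phi>
    using partite_copy_subset[of J V n, OF V disj that H] .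
  have pair: "hprob s n p (\<lambda>E. ?X \<phi> E \<and> ?X \<psi> E)
      \<le> p ^ (2 * card H) / \<kappa> * (\<Prod>j\<in>J. if \<phi> j = \<psi> j then real (card (V j)) else 1)"
    if \<phi>: "\<phi> \<in> ?P" and \<psi>: "\<psi> \<in> ?P" for \<phi> \<psi>
  proof -
    define S where "S = {j \<in> J. \<phi> j = \<psi> j}"
    let ?HS = "{h \<in> H. h \<subseteq> S}"
    have "?F \<phi> \<inter> ?F \<psi> = (\<lambda>h. \<phi> ` h) ` ?HS"
    proof (intro set_eqI iffI)
      fix e assume "e \<in> ?F \<phi> \<inter> ?F \<psi>"
      then obtain h h' where h: "h \<in> H" "h' \<in> H" "e = \<phi> ` h" "\<phi> ` h = \<psi> ` h'" by auto
      then have "h = h' \<and> (\<forall>j\<in>h. \<phi> j = \<psi> j)"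
        using partite_image_eqD[OF disj \<phi> \<psi> _ _ h(4)] H by blast
      then have "h \<subseteq> S" using h H by (fastforce simp: S_def)
      with h show "e \<in> (\<lambda>h. \<phi> ` h) ` ?HS" by blast
    next
      fix e assume "e \<in> (\<lambda>h. \<phi> ` h) ` ?HS"
      then obtain h where h: "h \<in> H" "h \<subseteq> S" "e = \<phi> ` h" by auto
      then have "e = \<psi> ` h" by (auto simp: S_def intro!: image_cong)
      with h show "e \<in> ?F \<phi> \<inter> ?F \<psi>" by blast
    qed
    then have "card (?F \<phi> \<inter> ?F \<psi>) = card ?HS"
      using inj[OF \<phi>] by (simp add: card_image inj_on_subset)
    moreover have "card (?F \<phi>) + card (?F \<psi>) = card (?F \<phi> \<union> ?F \<psi>) + card (?F \<phi> \<inter> ?F \<psi>)"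
      by (rule card_Un_Int) (use finH in auto)
    ultimately have cu: "2 * card H = card (?F \<phi> \<union> ?F \<psi>) + card ?HS"
      using inj[OF \<phi>] inj[OF \<psi>] by (simp add: card_image)
    have "hprob s n p (\<lambda>E. ?X \<phi> E \<and> ?X \<psi> E) \<le> hprob s n p (\<lambda>E. ?F \<phi> \<union> ?F \<psi> \<subseteq> E)"
      by (rule hprob_mono) auto
    also have "\<dots> = p ^ card (?F \<phi> \<union> ?F \<psi>)"
      using p FD[OF \<phi>] FD[OF \<psi>] by (intro hprob_superset) auto
    also have "\<dots> \<le> p ^ card (?F \<phi> \<union> ?F \<psi>) * (((\<Prod>j\<in>S. real (card (V j))) * p ^ card ?HS) / \<kappa>)"
      using \<kappa>[of S] \<open>0 < \<kappa>\<close> p by (subst mult_le_cancel_left1) (auto simp: S_def)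
    also have "\<dots> = p ^ (2 * card H) / \<kappa> * (\<Prod>j\<in>S. real (card (V j)))"
      unfolding cu power_add by simp
    also have "(\<Prod>j\<in>S. real (card (V j))) = (\<Prod>j\<in>J. if \<phi> j = \<psi> j then real (card (V j)) else 1)"
      using J by (simp add: S_def prod.If_cases Collect_conj_eq Int_commute)
    finally show ?thesis .
  qed
  have "(\<Sum>\<phi>\<in>?P. \<Sum>\<psi>\<in>?P. hprob s n p (\<lambda>E. ?X \<phi> E \<and> ?X \<psi> E))
      \<le> (\<Sum>\<phi>\<in>?P. p ^ (2 * card H) / \<kappa> * (2 ^ card J * c))"
  proof (rule sum_mono)
    fix \<phi> assume \<phi>: "\<phi> \<in> ?P"
    have "(\<Sum>\<psi>\<in>?P. hprob s n p (\<lambda>E. ?X \<phi> E \<and> ?X \<psi> E))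
       \<le> (\<Sum>\<psi>\<in>?P. p ^ (2 * card H) / \<kappa> * (\<Prod>j\<in>J. if \<phi> j = \<psi> j then real (card (V j)) else 1))"
      by (intro sum_mono pair \<phi>)
    also have "\<dots> = p ^ (2 * card H) / \<kappa> *
        (\<Prod>j\<in>J. \<Sum>v\<in>V j. if \<phi> j = v then real (card (V j)) else 1)"
      by (subst prod_sum_PiE) (use J finV in \<open>auto simp: sum_distrib_left\<close>)
    also have "\<dots> \<le> p ^ (2 * card H) / \<kappa> * (\<Prod>j\<in>J. 2 * real (card (V j)))"
    proof (intro mult_left_mono prod_mono conjI)
      fix j assume j: "j \<in> J"
      have "(\<Sum>v\<in>V j. if \<phi> j = v then real (card (V j)) else 1)
          \<le> (\<Sum>v\<in>V j. (if \<phi> j = v then real (card (V j)) else 0) + 1)"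
        by (intro sum_mono) auto
      also have "\<dots> = 2 * real (card (V j))"
        using finV[OF j] \<phi> j by (auto simp: sum.distrib)
      finally show "(\<Sum>v\<in>V j. if \<phi> j = v then real (card (V j)) else 1) \<le> 2 * real (card (V j))" .
    qed (use p \<open>0 < \<kappa>\<close> in \<open>auto intro!: sum_nonneg\<close>)
    also have "\<dots> = p ^ (2 * card H) / \<kappa> * (2 ^ card J * c)"
      by (simp add: c prod.distrib)
    finally show "(\<Sum>\<psi>\<in>?P. hprob s n p (\<lambda>E. ?X \<phi> E \<and> ?X \<psi> E)) \<le> \<dots>" .
  qed
  also have "\<dots> = c\<^sup>2 * p ^ (2 * card H) * 2 ^ card J / \<kappa>"
    by (simp add: c_def power2_eq_square)
  finally have B: "(\<Sum>\<phi>\<in>?P. \<Sum>\<psi>\<in>?P. hprob s n p (\<lambda>E. ?X \<phi> E \<and> ?X \<psi> E))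
      \<le> c\<^sup>2 * p ^ (2 * card H) * 2 ^ card J / \<kappa>" .
  have "(\<Sum>\<phi>\<in>?P. g * p ^ card H) \<le> (\<Sum>\<phi>\<in>?P. hprob s n p (?X \<phi>))"
    by (intro sum_mono G)
  then have A: "c * g * p ^ card H \<le> (\<Sum>\<phi>\<in>?P. hprob s n p (?X \<phi>))"
    by (simp add: c_def)
  have "(c * g * p ^ card H)\<^sup>2 / (c\<^sup>2 * p ^ (2 * card H) * 2 ^ card J / \<kappa>)
      \<le> hprob s n p (\<lambda>E. \<exists>\<phi>\<in>?P. ?X \<phi> E)"
    by (rule second_moment_pmf[OF finite_set_pmf_random_hypergraph finP _ _ A B])
      (use c0 p \<open>0 < \<kappa>\<close> \<open>0 \<le> g\<close> in auto)
  also have "(c * g * p ^ card H)\<^sup>2 / (c\<^sup>2 * p ^ (2 * card H) * 2 ^ card J / \<kappa>) = g\<^sup>2 * \<kappa> / 2 ^ card J"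
    using c0 p by (simp add: power_mult_distrib power_mult[symmetric] mult.commute[of 2])
  finally show ?thesis .
qed

lemma disjoint_classes_exist:
  assumes "finite J" "finite U" "u * card J \<le> card U"
  shows "\<exists>V. (\<forall>j\<in>J. V j \<subseteq> U \<and> card (V j) = u) \<and> disjoint_family_on V J"
  using assms
proof (induction J arbitrary: U rule: finite_induct)
  case empty
  then show ?case by (auto simp: disjoint_family_on_def)
next
  case (insert j J)
  then have "u \<le> card U" by simp
  then obtain W where W: "W \<subseteq> U" "card W = u" "finite W"
    by (metis obtain_subset_with_card_n)
  have "u * card J \<le> card (U - W)"
    using insert.prems insert.hyps W by (simp add: card_Diff_subset)
  then obtain V where V: "\<forall>j\<in>J. V j \<subseteq> U - W \<and> card (V j) = u" "disjoint_family_on V J"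
    using insert.IH[of "U - W"] insert.prems by auto
  have "(\<forall>i\<in>insert j J. (V(j := W)) i \<subseteq> U \<and> card ((V(j := W)) i) = u) \<and>
      disjoint_family_on (V(j := W)) (insert j J)"
    using V W insert.hyps unfolding disjoint_family_on_def by (auto 4 3)
  then show ?case by blast
qed

section \<open>Linking a set of free vertices to given roots\<close>

definition star :: "nat \<Rightarrow> 'a \<Rightarrow> 'a set \<Rightarrow> 'a set set" where
  "star s z W = insert z ` {X. X \<subseteq> W \<and> card X = s - 1}"

lemma mem_star_subset: "h \<in> star s z W \<Longrightarrow> h \<subseteq> insert z W"
  unfolding star_def by blast

lemma inj_on_insert_fresh: "(\<And>X. X \<in> A \<Longrightarrow> z \<notin> X) \<Longrightarrow> inj_on (insert z) A"
  by (rule inj_onI) (metis insert_ident)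

lemma finite_star: "finite W \<Longrightarrow> finite (star s z W)"
  by (simp add: star_def)

lemma card_star_le: "finite W \<Longrightarrow> card (star s z W) \<le> card W choose (s - 1)"
  unfolding star_def
  by (rule order_trans[OF card_image_le]) (auto simp: n_subsets)

lemma card_star: "finite W \<Longrightarrow> z \<notin> W \<Longrightarrow> card (star s z W) = card W choose (s - 1)"
  unfolding star_def by (subst card_image[OF inj_on_insert_fresh]) (auto simp: n_subsets)

lemma star_image:
  assumes "inj_on \<phi> W"
  shows "star s (\<phi> z) (\<phi> ` W) = (\<lambda>h. \<phi> ` h) ` star s z W"
proof -
  have "{X. X \<subseteq> \<phi> ` W \<and> card X = s - 1} = (\<lambda>h. \<phi> ` h) ` {X. X \<subseteq> W \<and> card X = s - 1}"
  proof (intro set_eqI iffI)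
    fix X assume "X \<in> {X. X \<subseteq> \<phi> ` W \<and> card X = s - 1}"
    then obtain Y where "Y \<subseteq> W" "X = \<phi> ` Y" "card X = s - 1" by (auto simp: subset_image_iff)
    then show "X \<in> (\<lambda>h. \<phi> ` h) ` {X. X \<subseteq> W \<and> card X = s - 1}"
      using assms by (auto simp: card_image inj_on_subset)
  qed (use assms in \<open>auto simp: card_image inj_on_subset\<close>)
  then show ?thesis by (simp add: star_def image_image)
qed

lemma card_mem_star:
  assumes "h \<in> star s z W" "z \<notin> W" "finite W" "1 \<le> s"
  shows "card h = s"
proof -
  from assms obtain X where X: "X \<subseteq> W" "card X = s - 1" "h = insert z X"
    by (auto simp: star_def)
  then have "z \<notin> X" "finite X" using assms finite_subset by auto
  then show ?thesis using X assms by simp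
qed

text \<open>By Pascal's rule the difference is \<open>(l - 1) choose (s - 2)\<close>, which is
  positive. In use: a star that lacks a vertex of its base set has lost an edge.\<close>

lemma binomial_pred_le:
  fixes s l :: nat
  assumes "2 \<le> s" "s - 1 \<le> l"
  shows "(l - 1) choose (s - 1) \<le> (l choose (s - 1)) - 1"
proof -
  obtain j where j: "s - 1 = Suc j" using assms by (cases "s - 1") auto
  obtain m where m: "l = Suc m" using assms by (cases l) auto
  have "0 < m choose j" using assms j m by (simp add: zero_less_binomial_iff)
  moreover have "l choose (s - 1) = (m choose j) + (m choose Suc j)" unfolding j m by simp
  ultimately show ?thesis unfolding j m diff_Suc_1 by linarith
qed

text \<open>The vertices z for different B may coincide. This keeps the condition first-order with a
  single quantifier for z, but upper bounds have to deal with shared z.\<close>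

definition linkable :: "nat \<Rightarrow> nat \<Rightarrow> nat set \<Rightarrow> nat set set \<Rightarrow> nat set set \<Rightarrow> bool" where
  "linkable s r U \<B> E \<longleftrightarrow>
     (\<exists>T\<subseteq>U. card T = r \<and> (\<forall>B\<in>\<B>. \<exists>z\<in>U - T. star s z (T \<union> B) \<subseteq> E))"

lemma linkable_mono:
  assumes "linkable s r U \<B>' E" "U \<subseteq> U'" "\<B> \<subseteq> \<B>'"
  shows "linkable s r U' \<B> E"
proof -
  from assms(1) obtain T where T: "T \<subseteq> U" "card T = r"
    and z: "\<And>B. B \<in> \<B>' \<Longrightarrow> \<exists>z\<in>U - T. star s z (T \<union> B) \<subseteq> E"
    unfolding linkable_def by blast
  have "\<exists>z\<in>U' - T. star s z (T \<union> B) \<subseteq> E" if "B \<in> \<B>" for B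
    using z[of B] that assms by blast
  with T assms(2) show ?thesis unfolding linkable_def by blast
qed

text \<open>Every edge of a star used here contains its centre, which lies in U. Edges among the
  roots are thus irrelevant, which yields independence from the configuration on the roots and
  between disjoint sets U.\<close>

lemma linkable_local:
  assumes "\<And>B. B \<in> \<B> \<Longrightarrow> B \<subseteq> R"
  shows "linkable s r U \<B> E \<longleftrightarrow> linkable s r U \<B> (E \<inter> {e. e \<subseteq> U \<union> R \<and> e \<inter> U \<noteq> {}})"
proof -
  have "star s z (T \<union> B) \<subseteq> E \<longleftrightarrow> star s z (T \<union> B) \<subseteq> E \<inter> {e. e \<subseteq> U \<union> R \<and> e \<inter> U \<noteq> {}}"
    if "T \<subseteq> U" "B \<in> \<B>" "z \<in> U - T" for T B z
  proof -
    have "star s z (T \<union> B) \<subseteq> {e. e \<subseteq> U \<union> R \<and> e \<inter> U \<noteq> {}}"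
      using that assms[of B] unfolding star_def by blast
    then show ?thesis by blast
  qed
  then have "(\<forall>B\<in>\<B>. \<exists>z\<in>U - T. star s z (T \<union> B) \<subseteq> E) \<longleftrightarrow>
      (\<forall>B\<in>\<B>. \<exists>z\<in>U - T. star s z (T \<union> B) \<subseteq> E \<inter> {e. e \<subseteq> U \<union> R \<and> e \<inter> U \<noteq> {}})"
    if "T \<subseteq> U" for T
    using that by (intro ball_cong bex_cong refl) auto
  then show ?thesis unfolding linkable_def by auto
qed

text \<open>
  Vertices of a rooted configuration: roots are kept in place by giving them singleton classes, so
  that the unrooted second moment bound applies.
\<close>
datatype idx = Rt nat | Tt nat | Zz "nat set"

text \<open>Second moment for the pattern consisting of T and one separate z for every B. Roots have
  weight one, so a subpattern is given by its parts of T and of the z. If it contains all of T, then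
  the weight is smallest with all z present, because u p^d <= 1; this is the bound on
  \<open>\<kappa>\<close>. If it lacks a vertex of T, then every z has lost an edge, and u p^(d - 1)
  >= 1 makes the weight at least 1.\<close>

lemma linkable_prob_ge:
  fixes \<kappa> p :: real
  assumes R: "R \<subseteq> {1..n}" and U: "U \<subseteq> {1..n}" "U \<inter> R = {}"
    and \<B>: "\<And>B. B \<in> \<B> \<Longrightarrow> B \<subseteq> R \<and> card B = l - r"
    and s: "2 \<le> s" "s - 1 \<le> l" and r: "r \<le> l" and d: "d = l choose (s - 1)"
    and u: "u * (r + card \<B>) \<le> card U"
    and p: "0 < p" "p \<le> 1"
    and c1: "1 \<le> real u * p ^ (d - 1)" and c2: "real u * p ^ d \<le> 1"
    and \<kappa>: "0 < \<kappa>" "\<kappa> \<le> 1" "\<kappa> \<le> real u ^ r * (real u * p ^ d) ^ card \<B>"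
  shows "\<kappa> / 2 ^ (card R + r + card \<B>) \<le> hprob s n p (linkable s r U \<B>)"
proof -
  have finR: "finite R" and finU: "finite U" using R U finite_subset by blast+
  have fin\<B>: "finite \<B>" by (rule finite_subset[of _ "Pow R"]) (use \<B> finR in auto)
  have u1: "1 \<le> u" using c1 by (cases u) auto
  let ?Tt = "Tt ` {..<r}" and ?Zz = "Zz ` \<B>"
  let ?W = "\<lambda>B. ?Tt \<union> Rt ` B"
  have "u * card (?Tt \<union> ?Zz) \<le> card U"
    using u fin\<B> by (subst card_Un_disjoint) (auto simp: card_image inj_on_def)
  then obtain V0 where V0: "\<And>j. j \<in> ?Tt \<union> ?Zz \<Longrightarrow> V0 j \<subseteq> U"
      "\<And>j. j \<in> ?Tt \<union> ?Zz \<Longrightarrow> card (V0 j) = u"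
      "disjoint_family_on V0 (?Tt \<union> ?Zz)"
    using disjoint_classes_exist[of "?Tt \<union> ?Zz" U u] fin\<B> finU by auto
  define V where "V = (\<lambda>j. case j of Rt v \<Rightarrow> {v} | _ \<Rightarrow> V0 j)"
  define J where "J = Rt ` R \<union> (?Tt \<union> ?Zz)"
  define H where "H = (\<Union>B\<in>\<B>. star s (Zz B) (?W B))"
  have finJ: "finite J" using finR fin\<B> by (simp add: J_def)
  have finB: "finite B" if "B \<in> \<B>" for B using \<B>[OF that] finR finite_subset by blast
  have cW: "card (?W B) = l" if "B \<in> \<B>" for B
    using \<B>[OF that] finB[OF that] r
    by (subst card_Un_disjoint) (auto simp: card_image inj_on_def)
  have cJ: "card J = card R + r + card \<B>"
    using finR fin\<B> unfolding J_def
    by (subst card_Un_disjoint; (subst card_Un_disjoint)?) (auto simp: card_image inj_on_def)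
  have V_simps: "V (Rt v) = {v}" "V (Tt j) = V0 (Tt j)" "V (Zz B) = V0 (Zz B)" for v j B
    by (simp_all add: V_def)
  have VU: "V j \<subseteq> U" "card (V j) = u" "V j = V0 j" if "j \<in> ?Tt \<union> ?Zz" for j
    using V0(1,2)[OF that] that by (auto simp: V_def)
  have disj: "disjoint_family_on V J"
  proof (unfold disjoint_family_on_def, intro ballI impI)
    fix i j assume ij: "i \<in> J" "j \<in> J" "i \<noteq> j"
    have mix: "V i \<inter> V j = {}" if "i \<in> Rt ` R" "j \<in> ?Tt \<union> ?Zz" for i j
      using that VU(1)[of j] U(2) by (auto simp: V_simps)
    consider "i \<in> Rt ` R" "j \<in> Rt ` R" | "i \<in> Rt ` R" "j \<in> ?Tt \<union> ?Zz"
      | "i \<in> ?Tt \<union> ?Zz" "j \<in> Rt ` R" | "i \<in> ?Tt \<union> ?Zz" "j \<in> ?Tt \<union> ?Zz"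
      using ij by (auto simp: J_def)
    then show "V i \<inter> V j = {}"
    proof cases
      case 1
      then show ?thesis using ij by (auto simp: V_simps)
    next
      case 2
      then show ?thesis by (rule mix)
    next
      case 3
      then show ?thesis using mix[of j i] by auto
    next
      case 4
      then show ?thesis using V0(3) ij VU(3) unfolding disjoint_family_on_def by metis
    qed
  qed
  have Vn: "V j \<subseteq> {1..n}" if "j \<in> J" for j
    using that VU(1)[of j] R U by (auto simp: J_def V_simps)
  have H: "h \<subseteq> J \<and> card h = s" if "h \<in> H" for h
  proof -
    from that obtain B where B: "B \<in> \<B>" "h \<in> star s (Zz B) (?W B)" by (auto simp: H_def)
    have "card h = s"
      by (rule card_mem_star[OF B(2)]) (use finB B s in auto)
    moreover have "?W B \<subseteq> J" "Zz B \<in> J" using B \<B>[of B] by (auto simp: J_def)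
    then have "h \<subseteq> J" using mem_star_subset[OF B(2)] by blast
    ultimately show ?thesis by simp
  qed
  have "(1::real)\<^sup>2 * \<kappa> / 2 ^ card J
      \<le> hprob s n p (\<lambda>E. \<exists>\<phi>\<in>PiE J V. (\<forall>h\<in>H. \<phi> ` h \<in> E) \<and> True)"
  proof (rule partite_second_moment[OF finJ Vn disj H])
    show "1 * p ^ card H \<le> hprob s n p (\<lambda>E. (\<forall>h\<in>H. \<phi> ` h \<in> E) \<and> True)" if \<phi>: "\<phi> \<in> PiE J V" for \<phi>
      using partite_copy_prob[of J V n \<phi> H s p, OF Vn disj \<phi> H] p by simp
    show "\<kappa> \<le> (\<Prod>j\<in>S. real (card (V j))) * p ^ card {h \<in> H. h \<subseteq> S}" if S: "S \<subseteq> J" for S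
    proof -
      define T' where "T' = {j. j < r \<and> Tt j \<in> S}"
      define Z' where "Z' = {B \<in> \<B>. Zz B \<in> S}"
      define R' where "R' = {v \<in> R. Rt v \<in> S}"
      have fin: "finite T'" "finite Z'" "finite R'"
        using fin\<B> finR by (auto simp: T'_def Z'_def R'_def)
      have Seq: "S = Rt ` R' \<union> (Tt ` T' \<union> Zz ` Z')"
        using S by (auto simp: J_def T'_def Z'_def R'_def)
      have "(\<Prod>j\<in>S. real (card (V j)))
          = (\<Prod>j\<in>Rt ` R'. real (card (V j))) * (\<Prod>j\<in>Tt ` T' \<union> Zz ` Z'. real (card (V j)))"
        unfolding Seq by (rule prod.union_disjoint) (use fin in auto)
      also have "(\<Prod>j\<in>Rt ` R'. real (card (V j))) = 1"
        by (rule prod.neutral) (auto simp: V_simps)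
      also have "(\<Prod>j\<in>Tt ` T' \<union> Zz ` Z'. real (card (V j))) = (\<Prod>j\<in>Tt ` T' \<union> Zz ` Z'. real u)"
        by (rule prod.cong) (use VU(2) in \<open>auto simp: T'_def Z'_def\<close>)
      also have "\<dots> = real u ^ (card T' + card Z')"
        using fin by (subst prod_constant, subst card_Un_disjoint)
          (auto simp: card_image inj_on_def)
      finally have prodS: "(\<Prod>j\<in>S. real (card (V j))) = real u ^ (card T' + card Z')" by simp
      have sub: "{h \<in> H. h \<subseteq> S} \<subseteq> (\<Union>B\<in>Z'. star s (Zz B) (?W B \<inter> S))"
        by (auto simp: H_def star_def Z'_def)
      have bound: "card {h \<in> H. h \<subseteq> S} \<le> card Z' * c"
        if c: "\<And>B. B \<in> Z' \<Longrightarrow> card (?W B \<inter> S) choose (s - 1) \<le> c" for c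
      proof -
        have fB: "finite (?W B)" if "B \<in> Z'" for B using that finB by (auto simp: Z'_def)
        have "card {h \<in> H. h \<subseteq> S} \<le> card (\<Union>B\<in>Z'. star s (Zz B) (?W B \<inter> S))"
          by (rule card_mono[OF _ sub]) (use fin fB in \<open>auto intro!: finite_star\<close>)
        also have "\<dots> \<le> (\<Sum>B\<in>Z'. card (star s (Zz B) (?W B \<inter> S)))"
          by (rule card_UN_le) (rule fin)
        also have "\<dots> \<le> (\<Sum>B\<in>Z'. c)"
          by (intro sum_mono order_trans[OF card_star_le] c) (use fB in auto)
        finally show ?thesis by simp
      qed
      show ?thesis
      proof (cases "T' = {..<r}")
        case True
        have "card {h \<in> H. h \<subseteq> S} \<le> card Z' * d"
        proof (rule bound)
          fix B assume "B \<in> Z'"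
          then have "card (?W B \<inter> S) \<le> l"
            using cW[of B] finB[of B] by (metis (no_types, lifting) Z'_def card_mono finite_UnI
              finite_imageI finite_lessThan inf_le1 mem_Collect_eq)
          then show "card (?W B \<inter> S) choose (s - 1) \<le> d"
            unfolding d by (rule binomial_right_mono) 
        qed
        then have "real u ^ (card T' + card Z') * p ^ (card Z' * d)
            \<le> (\<Prod>j\<in>S. real (card (V j))) * p ^ card {h \<in> H. h \<subseteq> S}"
          unfolding prodS using p by (intro mult_left_mono power_decreasing) auto
        moreover have "real u ^ (card T' + card Z') * p ^ (card Z' * d)
            = real u ^ r * (real u * p ^ d) ^ card Z'"
          using True by (simp add: power_add power_mult_distrib power_mult[symmetric] mult.commute)
        moreover have "(real u * p ^ d) ^ card \<B> \<le> (real u * p ^ d) ^ card Z'"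
          using c2 p fin\<B> by (intro power_decreasing card_mono) (auto simp: Z'_def)
        then have "real u ^ r * (real u * p ^ d) ^ card \<B> \<le> real u ^ r * (real u * p ^ d) ^ card Z'"
          by (intro mult_left_mono) auto
        ultimately show ?thesis using \<kappa>(3) by linarith
      next
        case False
        then obtain j0 where j0: "j0 < r" "Tt j0 \<notin> S" by (auto simp: T'_def)
        have "card {h \<in> H. h \<subseteq> S} \<le> card Z' * (d - 1)"
        proof (rule bound)
          fix B assume "B \<in> Z'"
          then have B: "B \<in> \<B>" by (simp add: Z'_def)
          have "card (?W B \<inter> S) \<le> card (?W B - {Tt j0})"
            using finB[OF B] j0 by (intro card_mono) auto
          also have "\<dots> = l - 1" using cW[OF B] j0 by (subst card_Diff_singleton) auto
          finally have "card (?W B \<inter> S) choose (s - 1) \<le> (l - 1) choose (s - 1)"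
            by (rule binomial_right_mono)
          also have "\<dots> \<le> d - 1" unfolding d by (rule binomial_pred_le[OF s])
          finally show "card (?W B \<inter> S) choose (s - 1) \<le> d - 1" .
        qed
        then have "real u ^ (card T' + card Z') * p ^ (card Z' * (d - 1))
            \<le> (\<Prod>j\<in>S. real (card (V j))) * p ^ card {h \<in> H. h \<subseteq> S}"
          unfolding prodS using p by (intro mult_left_mono power_decreasing) auto
        moreover have "real u ^ (card T' + card Z') * p ^ (card Z' * (d - 1))
            = real u ^ card T' * (real u * p ^ (d - 1)) ^ card Z'"
          by (simp add: power_add power_mult_distrib power_mult[symmetric] mult.commute)
        moreover have "1 * 1 \<le> real u ^ card T' * (real u * p ^ (d - 1)) ^ card Z'"
          using u1 c1 by (intro mult_mono one_le_power) auto
        ultimately show ?thesis using \<kappa>(2) by linarith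
      qed
    qed
  qed (use p \<kappa> in auto)
  also have "\<dots> \<le> hprob s n p (linkable s r U \<B>)"
  proof (rule hprob_mono)
    fix E assume "\<exists>\<phi>\<in>PiE J V. (\<forall>h\<in>H. \<phi> ` h \<in> E) \<and> True"
    then obtain \<phi> where \<phi>: "\<phi> \<in> PiE J V" and E: "\<And>h. h \<in> H \<Longrightarrow> \<phi> ` h \<in> E" by auto
    have inj: "inj_on \<phi> J" by (rule partite_inj_on[OF disj \<phi>])
    have \<phi>R: "\<phi> (Rt v) = v" if "v \<in> R" for v
      using \<phi> that PiE_mem[OF \<phi>, of "Rt v"] by (auto simp: J_def V_simps)
    have \<phi>U: "\<phi> j \<in> U" if "j \<in> ?Tt \<union> ?Zz" for j
      using VU(1)[OF that] PiE_mem[OF \<phi>, of j] that by (auto simp: J_def)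
    let ?T = "\<phi> ` ?Tt"
    have "inj_on \<phi> ?Tt" using inj by (rule inj_on_subset) (auto simp: J_def)
    then have "card ?T = r" by (simp add: card_image inj_on_def)
    moreover have "?T \<subseteq> U" using \<phi>U by auto
    moreover have "\<exists>z\<in>U - ?T. star s z (?T \<union> B) \<subseteq> E" if B: "B \<in> \<B>" for B
    proof -
      have sJ: "?Tt \<subseteq> J" "Zz B \<in> J" using B by (auto simp: J_def)
      have zT: "\<phi> (Zz B) \<notin> ?T" using inj_on_image_mem_iff[OF inj sJ(2,1)] by auto
      have BB: "\<phi> ` Rt ` B = B"
      proof -
        have "\<phi> ` Rt ` B = (\<lambda>v. v) ` B"
          unfolding image_image using \<phi>R \<B>[OF B] by (intro image_cong) auto
        then show ?thesis by simp
      qed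
      have "?W B \<subseteq> J" using \<B>[OF B] by (auto simp: J_def)
      then have "inj_on \<phi> (?W B)" by (rule inj_on_subset[OF inj])
      then have "star s (\<phi> (Zz B)) (\<phi> ` ?W B) = (\<lambda>h. \<phi> ` h) ` star s (Zz B) (?W B)"
        by (rule star_image)
      also have "\<dots> \<subseteq> E" using E B by (auto simp: H_def)
      also have "\<phi> ` ?W B = ?T \<union> B" by (simp add: image_Un BB)
      finally show ?thesis using zT \<phi>U[of "Zz B"] B by blast
    qed
    ultimately show "linkable s r U \<B> E" unfolding linkable_def by blast
  qed
  finally show ?thesis by (simp add: cJ)
qed

text \<open>One linked group among \<open>g\<close> disjoint ones suffices. An edge relevant for a
  group meets that group and otherwise lies in the roots, so the groups depend on disjoint sets of
  edges and the failure probabilities multiply.\<close>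

lemma not_linkable_prob_le:
  fixes \<kappa> p :: real
  assumes R: "R \<subseteq> {1..n}"
    and \<B>: "\<And>B. B \<in> \<B> \<Longrightarrow> B \<subseteq> R \<and> card B = l - r"
    and s: "2 \<le> s" "s - 1 \<le> l" and r: "r \<le> l" and d: "d = l choose (s - 1)"
    and u: "u * (r + card \<B>) * g \<le> n - card R"
    and p: "0 < p" "p \<le> 1"
    and c1: "1 \<le> real u * p ^ (d - 1)" and c2: "real u * p ^ d \<le> 1"
    and \<kappa>: "0 < \<kappa>" "\<kappa> \<le> 1" "\<kappa> \<le> real u ^ r * (real u * p ^ d) ^ card \<B>"
  shows "hprob s n p (\<lambda>E. \<not> linkable s r ({1..n} - R) \<B> E)
      \<le> (1 - \<kappa> / 2 ^ (card R + r + card \<B>)) ^ g"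
proof -
  let ?c = "1 - \<kappa> / 2 ^ (card R + r + card \<B>)"
  have finR: "finite R" using R finite_subset by blast
  have "card ({1..n} - R) = n - card R" using R finR by (simp add: card_Diff_subset)
  then obtain U where U: "\<And>j. j < g \<Longrightarrow> U j \<subseteq> {1..n} - R"
      "\<And>j. j < g \<Longrightarrow> card (U j) = u * (r + card \<B>)" "disjoint_family_on U {..<g}"
    using disjoint_classes_exist[of "{..<g}" "{1..n} - R" "u * (r + card \<B>)"] u by auto
  let ?D = "\<lambda>j. {e. e \<subseteq> U j \<union> R \<and> e \<inter> U j \<noteq> {}}"
  have "hprob s n p (\<lambda>E. \<not> linkable s r ({1..n} - R) \<B> E)
      \<le> hprob s n p (\<lambda>E. \<forall>j\<in>{..<g}. \<not> linkable s r (U j) \<B> E)"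
    by (rule hprob_mono) (use linkable_mono U(1) in blast)
  also have "\<dots> \<le> ?c ^ card {..<g}"
  proof (rule hprob_all_indep_le[where D = ?D])
    show "(\<not> linkable s r (U j) \<B> E) \<longleftrightarrow> \<not> linkable s r (U j) \<B> (E \<inter> ?D j)" for j E
      using linkable_local[of \<B> R s r "U j" E] \<B> by auto
    show "disjoint_family_on ?D {..<g}"
    proof (unfold disjoint_family_on_def, intro ballI impI)
      fix i j assume ij: "i \<in> {..<g}" "j \<in> {..<g}" "i \<noteq> j"
      then have "U i \<inter> U j = {}" using U(3) by (auto simp: disjoint_family_on_def)
      moreover have "U i \<inter> R = {}" using U(1) ij by auto
      ultimately show "?D i \<inter> ?D j = {}" by blast
    qed
    fix j assume j: "j \<in> {..<g}"
    have "hprob s n p (\<lambda>E. \<not> linkable s r (U j) \<B> E) = 1 - hprob s n p (linkable s r (U j) \<B>)"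
      by (rule hprob_not)
    moreover have "\<kappa> / 2 ^ (card R + r + card \<B>) \<le> hprob s n p (linkable s r (U j) \<B>)"
      by (rule linkable_prob_ge[OF R _ _ \<B> s r d _ p c1 c2 \<kappa>]) (use U j in auto)
    ultimately show "hprob s n p (\<lambda>E. \<not> linkable s r (U j) \<B> E) \<le> ?c" by linarith
  next
    show "0 \<le> ?c" using \<kappa> by (simp add: divide_le_eq order_trans[OF \<kappa>(2)])
  qed simp
  finally show ?thesis by simp
qed

section \<open>First moment of linked sets, with shared intermediate vertices\<close>

lemma sum_PiE_image_weight_le:
  fixes a b :: real
  assumes "finite B" "finite U" "0 \<le> a" "0 \<le> b" "card B \<le> m"
  shows "(\<Sum>z\<in>PiE B (\<lambda>_. U). a ^ card (z ` B) * b ^ (card B - card (z ` B)))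
      \<le> (real (card U) * a + real m * b) ^ card B"
  using assms(1,5)
proof (induction B rule: finite_induct)
  case empty
  then show ?case by simp
next
  case (insert x B)
  let ?P = "PiE B (\<lambda>_. U)"
  let ?w = "\<lambda>B z. a ^ card (z ` B) * b ^ (card B - card (z ` B))"
  have inj: "inj_on (\<lambda>(y, g). g(x := y)) (U \<times> ?P)"
  proof (rule inj_onI, clarify)
    fix y g y' g' assume g: "g \<in> ?P" "g' \<in> ?P" and eq: "g(x := y) = g'(x := y')"
    have "g = g'"
    proof
      fix i show "g i = g' i"
        using fun_cong[OF eq, of i] g insert.hyps by (cases "i = x") (auto simp: PiE_def extensional_def)
    qed
    then show "y = y' \<and> g = g'" using fun_cong[OF eq, of x] by simp
  qed
  \<comment> \<open>The value at the additional point is either new, with at most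
    \<open>card U\<close> choices and weight \<open>a\<close>, or one of at most \<open>m\<close>
    values already taken, with weight \<open>b\<close>.\<close>
  have step: "(\<Sum>y\<in>U. ?w (insert x B) (g(x := y))) \<le> ?w B g * (real (card U) * a + real m * b)"
    if g: "g \<in> ?P" for g
  proof -
    have gB: "g ` B \<subseteq> U" "finite (g ` B)" using g insert.hyps by auto
    have le: "card (g ` B) \<le> card B" using insert.hyps by (intro card_image_le) auto
    have im: "(g(x := y)) ` insert x B = insert y (g ` B)" for y using insert.hyps by auto
    have "(\<Sum>y\<in>U. ?w (insert x B) (g(x := y)))
        \<le> (\<Sum>y\<in>U. ?w B g * a + (if y \<in> g ` B then ?w B g * b else 0))"
    proof (rule sum_mono)
      fix y assume "y \<in> U"
      show "?w (insert x B) (g(x := y)) \<le> ?w B g * a + (if y \<in> g ` B then ?w B g * b else 0)"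
      proof (cases "y \<in> g ` B")
        case True
        then have "?w (insert x B) (g(x := y)) = ?w B g * b"
          unfolding im using le insert.hyps by (simp add: insert_absorb Suc_diff_le)
        with True assms show ?thesis by simp
      next
        case False
        then have "?w (insert x B) (g(x := y)) = ?w B g * a"
          unfolding im using gB insert.hyps by simp
        with False show ?thesis by simp
      qed
    qed
    also have "\<dots> = real (card U) * (?w B g * a) + real (card (g ` B)) * (?w B g * b)"
      using gB assms(2) by (simp add: sum.distrib sum.If_cases Int_absorb1)
    also have "\<dots> \<le> real (card U) * (?w B g * a) + real m * (?w B g * b)"
      using le insert.prems insert.hyps assms by (intro add_left_mono mult_right_mono) auto
    finally show ?thesis by (simp add: algebra_simps)
  qed
  have "(\<Sum>z\<in>PiE (insert x B) (\<lambda>_. U). ?w (insert x B) z)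
      = (\<Sum>(y, g)\<in>U \<times> ?P. ?w (insert x B) (g(x := y)))"
    unfolding PiE_insert_eq by (subst sum.reindex[OF inj]) (simp only: comp_def split_def)
  also have "\<dots> = (\<Sum>g\<in>?P. \<Sum>y\<in>U. ?w (insert x B) (g(x := y)))"
    by (subst sum.swap) (simp add: sum.cartesian_product)
  also have "\<dots> \<le> (\<Sum>g\<in>?P. ?w B g * (real (card U) * a + real m * b))"
    by (intro sum_mono step)
  also have "\<dots> = (\<Sum>g\<in>?P. ?w B g) * (real (card U) * a + real m * b)"
    by (simp add: sum_distrib_right)
  also have "\<dots> \<le> (real (card U) * a + real m * b) ^ card B * (real (card U) * a + real m * b)"
    by (intro mult_right_mono insert.IH) (use insert.prems insert.hyps assms in auto)
  finally show ?case using insert.hyps by (simp add: mult.commute)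
qed

lemma hprob_Bex_le:
  assumes "finite I"
  shows "hprob s n p (\<lambda>E. \<exists>i\<in>I. X i E) \<le> (\<Sum>i\<in>I. hprob s n p (X i))"
proof -
  have "hprob s n p (\<lambda>E. \<exists>i\<in>I. X i E)
      = measure_pmf.prob (random_hypergraph s n p) (\<Union>i\<in>I. {E. X i E})"
    by (rule arg_cong[where f = "measure_pmf.prob _"]) auto
  also have "\<dots> \<le> (\<Sum>i\<in>I. hprob s n p (X i))"
    by (rule measure_pmf.finite_measure_subadditive_finite) (use assms in auto)
  finally show ?thesis .
qed

text \<open>Union bound over all assignments z of intermediate vertices, injective or not. Stars at
  different vertices have no common edge. A vertex that serves the sets of a family F needs one edge
  for each (s - 1)-set inside some T \<union> B with B in F, and by the hypothesis on
  \<open>\<gamma>\<close> this is at least d plus \<open>\<gamma>\<close> for every set beyond the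
  first. So a fresh vertex contributes p^d and a reuse p^\<open>\<gamma>\<close>.\<close>

lemma all_linked_prob_le:
  fixes p \<gamma> :: real
  assumes R: "R \<subseteq> {1..n}" and T: "T \<subseteq> {1..n} - R"
    and \<B>: "\<And>B. B \<in> \<B> \<Longrightarrow> B \<subseteq> R" and s: "1 \<le> s" and p: "0 < p" "p \<le> 1"
    and \<gamma>: "\<And>F. F \<subseteq> \<B> \<Longrightarrow> F \<noteq> {} \<Longrightarrow>
      real d + \<gamma> * (real (card F) - 1) \<le> real (card (\<Union>B\<in>F. {X. X \<subseteq> T \<union> B \<and> card X = s - 1}))"
  shows "hprob s n p (\<lambda>E. \<forall>B\<in>\<B>. \<exists>z\<in>{1..n} - R - T. star s z (T \<union> B) \<subseteq> E)
      \<le> (real n * p ^ d + real (card \<B>) * p powr \<gamma>) ^ card \<B>"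
proof -
  let ?U = "{1..n} - R - T"
  let ?q = "card \<B>"
  let ?S = "\<lambda>z. \<Union>B\<in>\<B>. star s (z B) (T \<union> B)"
  let ?Sh = "\<lambda>B. {X. X \<subseteq> T \<union> B \<and> card X = s - 1}"
  have finR: "finite R" "finite T" using R T finite_subset by blast+
  have fin\<B>: "finite \<B>" by (rule finite_subset[of _ "Pow R"]) (use \<B> finR in auto)
  have finB: "finite B" if "B \<in> \<B>" for B using \<B>[OF that] finR finite_subset by blast
  have prob_z: "hprob s n p (\<lambda>E. ?S z \<subseteq> E) \<le> (p ^ d) ^ card (z ` \<B>) * (p powr \<gamma>) ^ (?q - card (z ` \<B>))"
    if z: "z \<in> PiE \<B> (\<lambda>_. ?U)" for z
  proof -
    have zU: "z B \<in> ?U" if "B \<in> \<B>" for B using PiE_mem[OF z that] .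
    define fib where "fib v = {B \<in> \<B>. z B = v}" for v
    have S: "?S z = (\<Union>v\<in>z ` \<B>. \<Union>B\<in>fib v. star s v (T \<union> B))"
      by (auto simp: fib_def)
    have fresh: "v \<notin> T \<union> B" if "v \<in> z ` \<B>" "B \<in> \<B>" for v B
      using that zU \<B>[of B] by auto
    have card_v: "card (\<Union>B\<in>fib v. star s v (T \<union> B)) = card (\<Union>B\<in>fib v. ?Sh B)"
      if v: "v \<in> z ` \<B>" for v
    proof -
      have "(\<Union>B\<in>fib v. star s v (T \<union> B)) = insert v ` (\<Union>B\<in>fib v. ?Sh B)"
        by (auto simp: star_def)
      moreover have "inj_on (insert v) (\<Union>B\<in>fib v. ?Sh B)"
        by (rule inj_on_insert_fresh) (use fresh[OF v] in \<open>auto simp: fib_def\<close>)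
      ultimately show ?thesis by (simp add: card_image)
    qed
    have finfib: "finite (\<Union>B\<in>fib v. star s v (T \<union> B))" for v
      using fin\<B> finB finR by (auto simp: fib_def intro!: finite_star)
    have "card (?S z) = (\<Sum>v\<in>z ` \<B>. card (\<Union>B\<in>fib v. star s v (T \<union> B)))"
      unfolding S
    proof (rule card_UN_disjoint)
      show "\<forall>i\<in>z ` \<B>. \<forall>j\<in>z ` \<B>. i \<noteq> j \<longrightarrow>
          (\<Union>B\<in>fib i. star s i (T \<union> B)) \<inter> (\<Union>B\<in>fib j. star s j (T \<union> B)) = {}"
      proof (intro ballI impI equals0I)
        fix i j e assume ij: "i \<in> z ` \<B>" "j \<in> z ` \<B>" "i \<noteq> j"
          and "e \<in> (\<Union>B\<in>fib i. star s i (T \<union> B)) \<inter> (\<Union>B\<in>fib j. star s j (T \<union> B))"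
        then obtain B B' where "B \<in> fib i" "B' \<in> fib j" "e \<in> star s i (T \<union> B)" "e \<in> star s j (T \<union> B')"
          by blast
        then have "B \<in> \<B>" "i \<in> e" "e \<subseteq> insert j (T \<union> B')" "B' \<in> \<B>"
          using mem_star_subset[of e s j "T \<union> B'"] by (auto simp: fib_def star_def)
        then show False using fresh[OF ij(1)] ij by auto
      qed
    qed (use fin\<B> finfib in auto)
    then have "real (card (?S z)) = (\<Sum>v\<in>z ` \<B>. real (card (\<Union>B\<in>fib v. ?Sh B)))"
      using card_v by simp
    also have "\<dots> \<ge> (\<Sum>v\<in>z ` \<B>. real d + \<gamma> * (real (card (fib v)) - 1))"
      by (intro sum_mono \<gamma>) (auto simp: fib_def)
    also have "(\<Sum>v\<in>z ` \<B>. real d + \<gamma> * (real (card (fib v)) - 1))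
        = real d * real (card (z ` \<B>)) + \<gamma> * (real (\<Sum>v\<in>z ` \<B>. card (fib v)) - real (card (z ` \<B>)))"
      by (simp add: sum.distrib sum_distrib_left[symmetric] sum_subtractf)
    also have "(\<Sum>v\<in>z ` \<B>. card (fib v)) = ?q"
    proof -
      have "\<B> = (\<Union>v\<in>z ` \<B>. fib v)" by (auto simp: fib_def)
      then have "?q = card (\<Union>v\<in>z ` \<B>. fib v)" by simp
      also have "\<dots> = (\<Sum>v\<in>z ` \<B>. card (fib v))"
        by (rule card_UN_disjoint) (use fin\<B> in \<open>auto simp: fib_def\<close>)
      finally show ?thesis by simp
    qed
    finally have ge: "real d * real (card (z ` \<B>)) + \<gamma> * (real ?q - real (card (z ` \<B>)))
        \<le> real (card (?S z))" .
    have le: "card (z ` \<B>) \<le> ?q" using fin\<B> by (rule card_image_le)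
    have "?S z \<subseteq> potential_edges s n"
    proof
      fix e assume "e \<in> ?S z"
      then obtain B where B: "B \<in> \<B>" "e \<in> star s (z B) (T \<union> B)" by auto
      have "card e = s" by (rule card_mem_star[OF B(2)]) (use B fresh finB finR s in auto)
      moreover have "e \<subseteq> {1..n}"
        using mem_star_subset[OF B(2)] zU[OF B(1)] \<B>[OF B(1)] R T by blast
      ultimately show "e \<in> potential_edges s n" by (simp add: potential_edges_def)
    qed
    then have "hprob s n p (\<lambda>E. ?S z \<subseteq> E) = p ^ card (?S z)"
      using p by (intro hprob_superset) auto
    also have "\<dots> = p powr real (card (?S z))" using p by (simp add: powr_realpow)
    also have "\<dots> \<le> p powr (real d * real (card (z ` \<B>)) + \<gamma> * (real ?q - real (card (z ` \<B>))))"
      using p ge by (intro powr_mono') auto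
    also have "\<dots> = p powr (real (d * card (z ` \<B>))) * p powr (\<gamma> * real (?q - card (z ` \<B>)))"
      using le by (simp add: powr_add of_nat_diff)
    also have "p powr (real (d * card (z ` \<B>))) = (p ^ d) ^ card (z ` \<B>)"
      using p by (simp add: powr_realpow power_mult del: of_nat_mult)
    also have "p powr (\<gamma> * real (?q - card (z ` \<B>))) = (p powr \<gamma>) ^ (?q - card (z ` \<B>))"
      using p by (simp add: powr_powr[symmetric] powr_realpow del: of_nat_diff)
    finally show ?thesis .
  qed
  have finP: "finite (PiE \<B> (\<lambda>_. ?U))" using fin\<B> by (intro finite_PiE) auto
  have "hprob s n p (\<lambda>E. \<forall>B\<in>\<B>. \<exists>z\<in>?U. star s z (T \<union> B) \<subseteq> E)
      \<le> hprob s n p (\<lambda>E. \<exists>z\<in>PiE \<B> (\<lambda>_. ?U). ?S z \<subseteq> E)"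
  proof (rule hprob_mono)
    fix E assume "\<forall>B\<in>\<B>. \<exists>z\<in>?U. star s z (T \<union> B) \<subseteq> E"
    then obtain z where z: "\<forall>B\<in>\<B>. z B \<in> ?U \<and> star s (z B) (T \<union> B) \<subseteq> E" by metis
    then show "\<exists>z\<in>PiE \<B> (\<lambda>_. ?U). ?S z \<subseteq> E"
      by (intro bexI[of _ "restrict z \<B>"]) (auto simp: PiE_def)
  qed
  also have "\<dots> \<le> (\<Sum>z\<in>PiE \<B> (\<lambda>_. ?U). hprob s n p (\<lambda>E. ?S z \<subseteq> E))"
    by (rule hprob_Bex_le[OF finP])
  also have "\<dots> \<le> (\<Sum>z\<in>PiE \<B> (\<lambda>_. ?U). (p ^ d) ^ card (z ` \<B>) * (p powr \<gamma>) ^ (?q - card (z ` \<B>)))"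
    by (intro sum_mono prob_z)
  also have "\<dots> \<le> (real (card ?U) * p ^ d + real ?q * p powr \<gamma>) ^ ?q"
    by (rule sum_PiE_image_weight_le) (use fin\<B> p in auto)
  also have "\<dots> \<le> (real n * p ^ d + real ?q * p powr \<gamma>) ^ ?q"
  proof -
    have "card ?U \<le> card {1..n}" by (rule card_mono) auto
    then show ?thesis using p by (intro power_mono add_right_mono mult_right_mono) auto
  qed
  finally show ?thesis .
qed

text \<open>
  The expected number of admissible sets \<open>T\<close> tends to \<open>1\<close>, so Markov's inequality alone is not
  enough; the gain comes from \<open>P(X > 0) \<le> E X - P(X \<ge> 2)\<close> and two independent halves.
\<close>
lemma not_linkable_prob_ge:
  fixes \<kappa> p \<gamma> :: real
  assumes R: "R \<subseteq> {1..n}"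
    and \<B>: "\<And>B. B \<in> \<B> \<Longrightarrow> B \<subseteq> R \<and> card B = l - r"
    and s: "2 \<le> s" "s - 1 \<le> l" and r: "1 \<le> r" "r \<le> l" and d: "d = l choose (s - 1)"
    and u: "u * (r + card \<B>) * 2 \<le> n - card R"
    and p: "0 < p" "p \<le> 1"
    and c1: "1 \<le> real u * p ^ (d - 1)" and c2: "real u * p ^ d \<le> 1"
    and \<kappa>: "0 < \<kappa>" "\<kappa> \<le> 1" "\<kappa> \<le> real u ^ r * (real u * p ^ d) ^ card \<B>"
    and \<gamma>: "\<And>T F. T \<subseteq> {1..n} - R \<Longrightarrow> card T = r \<Longrightarrow> F \<subseteq> \<B> \<Longrightarrow> F \<noteq> {} \<Longrightarrow>
      real d + \<gamma> * (real (card F) - 1) \<le> real (card (\<Union>B\<in>F. {X. X \<subseteq> T \<union> B \<and> card X = s - 1}))"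
  shows "1 + (\<kappa> / 2 ^ (card R + r + card \<B>))\<^sup>2
        - real n ^ r * (real n * p ^ d + real (card \<B>) * p powr \<gamma>) ^ card \<B>
      \<le> hprob s n p (\<lambda>E. \<not> linkable s r ({1..n} - R) \<B> E)"
proof -
  let ?c = "\<kappa> / 2 ^ (card R + r + card \<B>)"
  let ?M = "random_hypergraph s n p"
  let ?i = "\<lambda>X E. indicator {E. X E} E :: real"
  define \<T> where "\<T> = {T. T \<subseteq> {1..n} - R \<and> card T = r}"
  define X where "X T E \<longleftrightarrow> (\<forall>B\<in>\<B>. \<exists>z\<in>{1..n} - R - T. star s z (T \<union> B) \<subseteq> E)" for T E
  have finR: "finite R" using R finite_subset by blast
  have finT: "finite \<T>" by (rule finite_subset[of _ "Pow {1..n}"]) (auto simp: \<T>_def)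
  have link: "linkable s r ({1..n} - R) \<B> E \<longleftrightarrow> (\<exists>T\<in>\<T>. X T E)" for E
    by (auto simp: linkable_def \<T>_def X_def)
  have cT: "real (card \<T>) \<le> real n ^ r"
  proof -
    have "card \<T> = card ({1..n} - R) choose r" unfolding \<T>_def by (rule n_subsets) simp
    also have "\<dots> \<le> n choose r"
      using card_mono[of "{1..n}" "{1..n} - R"] by (intro binomial_right_mono) auto
    also have "\<dots> \<le> (n choose r) * fact r" by simp
    also have "\<dots> \<le> n ^ r" by (rule binomial_fact_pow)
    finally show ?thesis by (metis of_nat_le_iff of_nat_power)
  qed
  have EN: "(\<Sum>T\<in>\<T>. hprob s n p (X T))
      \<le> real n ^ r * (real n * p ^ d + real (card \<B>) * p powr \<gamma>) ^ card \<B>"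
  proof -
    have "(\<Sum>T\<in>\<T>. hprob s n p (X T))
        \<le> (\<Sum>T\<in>\<T>. (real n * p ^ d + real (card \<B>) * p powr \<gamma>) ^ card \<B>)"
      unfolding X_def
      by (intro sum_mono all_linked_prob_le[OF R]) (use \<B> \<gamma> p s in \<open>auto simp: \<T>_def\<close>)
    also have "\<dots> = real (card \<T>) * (real n * p ^ d + real (card \<B>) * p powr \<gamma>) ^ card \<B>" by simp
    also have "\<dots> \<le> real n ^ r * (real n * p ^ d + real (card \<B>) * p powr \<gamma>) ^ card \<B>"
      using p by (intro mult_right_mono cT) auto
    finally show ?thesis .
  qed
  have "card ({1..n} - R) = n - card R" using R finR by (simp add: card_Diff_subset)
  then obtain U where U: "\<And>j. j < 2 \<Longrightarrow> U j \<subseteq> {1..n} - R"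
      "\<And>j. j < 2 \<Longrightarrow> card (U j) = u * (r + card \<B>)" "disjoint_family_on U {..<2::nat}"
    using disjoint_classes_exist[of "{..<2::nat}" "{1..n} - R" "u * (r + card \<B>)"] u by auto
  let ?L = "\<lambda>j. linkable s r (U j) \<B>"
  let ?D = "\<lambda>j. {e. e \<subseteq> U j \<union> R \<and> e \<inter> U j \<noteq> {}}"
  have U01: "U 0 \<inter> U 1 = {}" using U(3) by (auto simp: disjoint_family_on_def)
  have L: "?c \<le> hprob s n p (?L j)" if "j < 2" for j
    by (rule linkable_prob_ge[OF R _ _ \<B> s r(2) d _ p c1 c2 \<kappa>]) (use U that in auto)
  have "?c\<^sup>2 \<le> hprob s n p (?L 0) * hprob s n p (?L 1)"
    unfolding power2_eq_square using L \<kappa> by (intro mult_mono) auto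
  also have "\<dots> = hprob s n p (\<lambda>E. ?L 0 E \<and> ?L 1 E)"
  proof (rule hprob_indep[symmetric])
    show "?L 0 E \<longleftrightarrow> ?L 0 (E \<inter> ?D 0)" "?L 1 E \<longleftrightarrow> ?L 1 (E \<inter> ?D 1)" for E
      using linkable_local[of \<B> R s r _ E] \<B> by auto
    have "U 0 \<inter> R = {}" using U(1)[of 0] by auto
    then show "?D 0 \<inter> ?D 1 = {}" using U01 by blast
  qed
  finally have two: "?c\<^sup>2 \<le> hprob s n p (\<lambda>E. ?L 0 E \<and> ?L 1 E)" .
  have pt: "?i (\<lambda>E. \<exists>T\<in>\<T>. X T E) E + ?i (\<lambda>E. ?L 0 E \<and> ?L 1 E) E \<le> (\<Sum>T\<in>\<T>. ?i (X T) E)" for E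
  proof (cases "?L 0 E \<and> ?L 1 E")
    case True
    have "\<exists>T\<in>\<T>. T \<subseteq> U j \<and> X T E" if "j < 2" "?L j E" for j
    proof -
      from that(2) obtain T where T: "T \<subseteq> U j" "card T = r"
        and z: "\<And>B. B \<in> \<B> \<Longrightarrow> \<exists>z\<in>U j - T. star s z (T \<union> B) \<subseteq> E"
        unfolding linkable_def by blast
      have "\<exists>z\<in>{1..n} - R - T. star s z (T \<union> B) \<subseteq> E" if "B \<in> \<B>" for B
        using z[OF that] U(1)[OF \<open>j < 2\<close>] by blast
      then have "X T E" by (simp add: X_def)
      moreover have "T \<in> \<T>" using T U(1)[OF that(1)] by (auto simp: \<T>_def)
      ultimately show ?thesis using T(1) by blast
    qed
    then have "\<exists>T\<in>\<T>. T \<subseteq> U 0 \<and> X T E" "\<exists>T\<in>\<T>. T \<subseteq> U 1 \<and> X T E" using True by simp_all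
    then obtain T0 T1 where T: "T0 \<in> \<T>" "T1 \<in> \<T>" "T0 \<subseteq> U 0" "T1 \<subseteq> U 1"
      "X T0 E" "X T1 E" by blast
    \<comment> \<open>The two sets are disjoint, so they differ as soon as they are nonempty, that
      is, by r >= 1.\<close>
    have "T0 \<noteq> T1"
    proof
      assume "T0 = T1"
      then have "T0 = {}" using T U01 by auto
      then show False using T r by (auto simp: \<T>_def)
    qed
    then have "(2::real) = (\<Sum>T\<in>{T0, T1}. ?i (X T) E)" using T by simp
    also have "\<dots> \<le> (\<Sum>T\<in>\<T>. ?i (X T) E)"
      using T finT by (intro sum_mono2) auto
    finally have "2 \<le> (\<Sum>T\<in>\<T>. ?i (X T) E)" .
    moreover have "?i (\<lambda>E. \<exists>T\<in>\<T>. X T E) E \<le> 1" "?i (\<lambda>E. ?L 0 E \<and> ?L 1 E) E \<le> 1"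
      by (simp_all add: indicator_def)
    ultimately show ?thesis by linarith
  next
    case False
    show ?thesis
    proof (cases "\<exists>T\<in>\<T>. X T E")
      case True
      then obtain T where T: "T \<in> \<T>" "X T E" by auto
      then have "(1::real) = (\<Sum>T\<in>{T}. ?i (X T) E)" by simp
      also have "\<dots> \<le> (\<Sum>T\<in>\<T>. ?i (X T) E)" using T finT by (intro sum_mono2) auto
      finally show ?thesis using False True by auto
    next
      case F: False
      then show ?thesis using False by (auto intro!: sum_nonneg)
    qed
  qed
  have int: "integrable (measure_pmf ?M) f" for f :: "nat set set \<Rightarrow> real"
    by (rule integrable_measure_pmf_finite[OF finite_set_pmf_random_hypergraph])
  have "measure_pmf.expectation ?M (\<lambda>E. ?i (\<lambda>E. \<exists>T\<in>\<T>. X T E) E + ?i (\<lambda>E. ?L 0 E \<and> ?L 1 E) E)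
      \<le> measure_pmf.expectation ?M (\<lambda>E. \<Sum>T\<in>\<T>. ?i (X T) E)"
    by (intro integral_mono int pt)
  then have "hprob s n p (\<lambda>E. \<exists>T\<in>\<T>. X T E) + hprob s n p (\<lambda>E. ?L 0 E \<and> ?L 1 E)
      \<le> (\<Sum>T\<in>\<T>. hprob s n p (X T))"
    by (simp add: int)
  moreover have "hprob s n p (\<lambda>E. \<not> linkable s r ({1..n} - R) \<B> E) = 1 - hprob s n p (\<lambda>E. \<exists>T\<in>\<T>. X T E)"
    unfolding hprob_not link ..
  ultimately show ?thesis using EN two by linarith
qed

text \<open>The excess over d has two sources. Two different members of F already force one
  additional (s - 1)-set, and j members of the form \<open>insert c A\<close> force j - 1, namely
  one through each further c. At most \<open>x\<close> members have another form, so
  \<open>card F - 1\<close> is at most (x + 1) times the excess. What counts is that the resulting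
  constant is positive and does not depend on \<open>q\<close>.\<close>

lemma shadow_Union_ge:
  fixes s l r x :: nat
  assumes F: "F \<subseteq> \<X> \<union> (\<lambda>c. insert c A) ` C" "F \<noteq> {}"
    and fin: "finite \<X>" "finite C" "finite T" and x: "card \<X> \<le> x"
    and B: "\<And>B. B \<in> F \<Longrightarrow> finite B \<and> card B = l - r \<and> B \<inter> T = {}"
    and AC: "A \<inter> C = {}" and T: "card T = r" "r \<le> l" and s: "2 \<le> s" "s - 1 \<le> l"
  shows "real (l choose (s - 1)) + 1 / (real x + 1) * (real (card F) - 1)
      \<le> real (card (\<Union>B\<in>F. {X. X \<subseteq> T \<union> B \<and> card X = s - 1}))"
proof -
  let ?d = "l choose (s - 1)"
  let ?Sh = "\<lambda>B. {X. X \<subseteq> T \<union> B \<and> card X = s - 1}"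
  let ?U = "\<Union>B\<in>F. ?Sh B"
  have finF: "finite F" by (rule finite_subset[OF F(1)]) (use fin in auto)
  have cTB: "finite (T \<union> B)" "card (T \<union> B) = l" if "B \<in> F" for B
    using B[OF that] fin T by (auto simp: card_Un_disjoint Int_commute)
  have finSh: "finite (?Sh B)" if "B \<in> F" for B
    using cTB[OF that] by (intro finite_subset[of "?Sh B" "Pow (T \<union> B)"]) auto
  have finU: "finite ?U" using finF finSh by auto
  have cSh: "card (?Sh B) = ?d" if "B \<in> F" for B
    using cTB[OF that] by (simp add: n_subsets)
  have through: "\<exists>X\<in>?Sh B. b \<in> X" if "B \<in> F" "b \<in> B" for B b
  proof -
    have "card (T \<union> B - {b}) = l - 1" using cTB[OF that(1)] that(2) by simp
    then have "s - 2 \<le> card (T \<union> B - {b})" using s by simp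
    then obtain Y where Y: "Y \<subseteq> T \<union> B - {b}" "card Y = s - 2" "finite Y"
      by (metis obtain_subset_with_card_n)
    then have "card (insert b Y) = s - 1" using s by (subst card_insert_disjoint) auto
    then show ?thesis using Y that by (intro bexI[of _ "insert b Y"]) auto
  qed
  have one: "?d + 1 \<le> card ?U" if two: "2 \<le> card F"
  proof -
    obtain B where B0: "B \<in> F" using F by auto
    obtain B' where B': "B' \<in> F" "B' \<noteq> B"
    proof -
      have "F \<noteq> {B}" using two by auto
      then show thesis using B0 that by blast
    qed
    have "\<not> B' \<subseteq> B" using B[OF B0] B[OF B'(1)] B'(2) card_subset_eq by metis
    then obtain b where b: "b \<in> B'" "b \<notin> B" by auto
    obtain X where X: "X \<in> ?Sh B'" "b \<in> X" using through[OF B'(1) b(1)] by auto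
    have "b \<notin> T" using B[OF B'(1)] b by auto
    then have "X \<notin> ?Sh B" using X b by auto
    then have "card (insert X (?Sh B)) = ?d + 1" using finSh[OF B0] cSh[OF B0] by simp
    moreover have "X \<in> ?U" "?Sh B \<subseteq> ?U" using X(1) B0 B'(1) by blast+
    then have "card (insert X (?Sh B)) \<le> card ?U" by (intro card_mono finU) simp
    ultimately show ?thesis by simp
  qed
  define C' where "C' = {c \<in> C. insert c A \<in> F}"
  have finC': "finite C'" using fin by (simp add: C'_def)
  have many: "?d + (card C' - 1) \<le> card ?U" if ne: "C' \<noteq> {}"
  proof -
    obtain c0 where c0: "c0 \<in> C'" using ne by blast
    have "\<exists>X\<in>?Sh (insert c A). c \<in> X" if "c \<in> C'" for c
      by (rule through) (use that in \<open>auto simp: C'_def\<close>)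
    then obtain X where X: "\<And>c. c \<in> C' \<Longrightarrow> X c \<in> ?Sh (insert c A) \<and> c \<in> X c" by metis
    have notT: "c \<notin> T" if "c \<in> C'" for c using B[of "insert c A"] that by (auto simp: C'_def)
    have sep: "c' \<notin> X c" if "c \<in> C'" "c' \<in> C'" "c \<noteq> c'" for c c'
    proof
      assume "c' \<in> X c"
      then have "c' \<in> T \<union> insert c A" using X[OF that(1)] by auto
      then show False using notT[OF that(2)] that AC by (auto simp: C'_def)
    qed
    have injX: "inj_on X (C' - {c0})"
    proof (rule inj_onI)
      fix c c' assume c: "c \<in> C' - {c0}" "c' \<in> C' - {c0}" "X c = X c'"
      then show "c = c'" using sep[of c c'] X[of c'] by auto
    qed
    have disj: "?Sh (insert c0 A) \<inter> X ` (C' - {c0}) = {}"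
    proof (rule equals0I)
      fix Y assume "Y \<in> ?Sh (insert c0 A) \<inter> X ` (C' - {c0})"
      then obtain c where c: "c \<in> C'" "c \<noteq> c0" "X c \<subseteq> T \<union> insert c0 A" by auto
      then have "c \<in> T \<union> insert c0 A" using X by auto
      then show False using notT[OF c(1)] c AC by (auto simp: C'_def)
    qed
    have c0F: "insert c0 A \<in> F" using c0 by (simp add: C'_def)
    have "card (?Sh (insert c0 A) \<union> X ` (C' - {c0})) = ?d + (card C' - 1)"
      using finSh[OF c0F] cSh[OF c0F] finC' disj injX c0
      by (subst card_Un_disjoint) (auto simp: card_image)
    moreover have "?Sh (insert c0 A) \<union> X ` (C' - {c0}) \<subseteq> ?U"
    proof (intro Un_least image_subsetI)
      show "?Sh (insert c0 A) \<subseteq> ?U" using c0F by blast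
      fix c assume "c \<in> C' - {c0}"
      then have "X c \<in> ?Sh (insert c A)" "insert c A \<in> F" using X by (auto simp: C'_def)
      then show "X c \<in> ?U" by blast
    qed
    ultimately show ?thesis
      using card_mono[OF finU, of "?Sh (insert c0 A) \<union> X ` (C' - {c0})"] by linarith
  qed
  have "F \<subseteq> \<X> \<union> (\<lambda>c. insert c A) ` C'" using F(1) by (auto simp: C'_def)
  then have "card F \<le> card (\<X> \<union> (\<lambda>c. insert c A) ` C')" using fin finC' by (intro card_mono) auto
  also have "\<dots> \<le> card \<X> + card C'"
    using card_Un_le card_image_le[OF finC'] by (metis (no_types, lifting) add_left_mono order_trans)
  finally have cF: "card F \<le> x + card C'" using x by linarith
  have zero: "?d \<le> card ?U"
  proof -
    obtain B where B0: "B \<in> F" using F by auto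
    then have "?Sh B \<subseteq> ?U" by blast
    then have "card (?Sh B) \<le> card ?U" by (rule card_mono[OF finU])
    then show ?thesis using cSh[OF B0] by simp
  qed
  have "real (card F) - 1 \<le> (real x + 1) * (real (card ?U) - real ?d)"
  proof (cases "card F \<le> 1")
    case True
    have "0 \<le> (real x + 1) * (real (card ?U) - real ?d)" using zero by simp
    then show ?thesis using True by linarith
  next
    case F2: False
    show ?thesis
    proof (cases "card C' \<le> 1")
      case True
      have "(real x + 1) * 1 \<le> (real x + 1) * (real (card ?U) - real ?d)"
        using one F2 by (intro mult_left_mono) linarith+
      moreover have "real (card F) \<le> real x + 1" using cF True by linarith
      then have "real (card F) - 1 \<le> (real x + 1) * 1" by simp
      ultimately show ?thesis by (rule order_trans[rotated])
    next
      case False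
      then have "C' \<noteq> {}" by auto
      then have "real (card C') - 1 \<le> real (card ?U) - real ?d" using many False by linarith
      then have "(real x + 1) * (real (card C') - 1) \<le> (real x + 1) * (real (card ?U) - real ?d)"
        by (intro mult_left_mono) auto
      moreover have "real x * 1 \<le> real x * (real (card C') - 1)"
        using False by (intro mult_left_mono) auto
      then have "real (card F) - 1 \<le> (real x + 1) * (real (card C') - 1)"
        using cF by (simp add: algebra_simps)
      ultimately show ?thesis by (rule order_trans[rotated])
    qed
  qed
  then show ?thesis by (simp add: field_simps)
qed

text \<open>
  The exponent is chosen so that \<open>n p\<^sup>d = n\<^bsup>-r/q\<^esup>\<close>: a set of \<open>r\<close> free vertices with \<open>q\<close> vertices
  attached to it by \<open>d\<close> edges each then has expected number of order one.
\<close>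
definition crit :: "nat \<Rightarrow> nat \<Rightarrow> nat \<Rightarrow> real" where
  "crit d r q = (1 + real r / real q) / real d"

section \<open>Asymptotics at the critical exponents\<close>

locale link_params =
  fixes s l r d q :: nat
  assumes s: "2 \<le> s" "s - 1 \<le> l" and r: "1 \<le> r" "r < l"
    and d: "d = l choose (s - 1)" and q: "2 * r * d < q"
begin

abbreviation "p n \<equiv> real n powr (- crit d r q)"

lemma d_pos: "0 < d" using s d by (simp add: zero_less_binomial_iff)

lemma q_pos: "0 < q" using q by linarith

lemma p_pow: "0 < n \<Longrightarrow> p n ^ j = real n powr (- (real j * crit d r q))"
  by (simp add: powr_power)

lemma d_crit: "real d * crit d r q = 1 + real r / real q"
  using d_pos by (simp add: crit_def)

lemma p_bounds: "0 < n \<Longrightarrow> 0 < p n \<and> p n \<le> 1"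
  using powr_mono[of "- crit d r q" 0 "real n"] by (auto simp: crit_def)

end

lemma card_image_image:
  assumes "inj_on f A" "\<And>B. B \<in> \<F> \<Longrightarrow> B \<subseteq> A"
  shows "card ((`) f ` \<F>) = card \<F>"
proof (rule card_image)
  show "inj_on ((`) f) \<F>"
    using inj_on_image_Pow[OF assms(1)] assms(2) by (rule_tac inj_on_subset) auto
qed

context link_params
begin

lemma n_p_pow_d: "0 < n \<Longrightarrow> real n * p n ^ d = real n powr (- (real r / real q))"
proof -
  assume n: "0 < n"
  have "real n * p n ^ d = real n powr 1 * real n powr (- (real d * crit d r q))"
    unfolding p_pow[OF n] using n by simp
  also have "\<dots> = real n powr (- (real r / real q))"
    unfolding d_crit by (subst powr_add[symmetric]) simp
  finally show ?thesis .
qed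

text \<open>In other words, n^(1 - r/q) p^(d - 1) is a positive power of n. As (d - 1) crit = 1 +
  r/q - crit, the claim is 2 r/q < crit; it follows from crit >= 1/d and the lower bound on
  \<open>q\<close>.\<close>

lemma exponent_gap: "(real d - 1) * crit d r q + real r / real q < 1"
proof -
  have "(real d - 1) * crit d r q = 1 + real r / real q - crit d r q"
    using d_crit by (simp add: algebra_simps)
  moreover have "1 / real d \<le> crit d r q" using d_pos by (simp add: crit_def divide_right_mono)
  moreover have "2 * real r / real q < 1 / real d"
  proof -
    have "real (2 * r * d) < real q" using q by (simp only: of_nat_less_iff)
    then show ?thesis using d_pos q_pos by (simp add: field_simps)
  qed
  ultimately show ?thesis by (simp add: field_simps)
qed

lemma d_minus_1: "real (d - 1) = real d - 1" using d_pos by simp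

text \<open>The union bound over about n^\<open>\<rho>\<close> placements of the roots needs a
  failure probability below every power of n. A single second moment bound gives only a constant, so
  the vertices are split into about n^\<open>\<delta>\<close> groups that are still large enough to
  be linked with constant probability.\<close>

lemma linkable_whp:
  fixes \<rho> :: nat
  assumes \<F>: "\<And>B. B \<in> \<F> \<Longrightarrow> B \<subseteq> {..<\<rho>} \<and> card B = l - r" and card\<F>: "card \<F> = q - 1"
  shows "(\<lambda>n. hprob s n (p n) (\<lambda>E. \<exists>f\<in>PiE {..<\<rho>} (\<lambda>_. {1..n}). inj_on f {..<\<rho>} \<and>
            \<not> linkable s r ({1..n} - f ` {..<\<rho>}) ((`) f ` \<F>) E)) \<longlonglongrightarrow> 0"
proof -
  \<comment> \<open>Solves \<open>\<delta>\<close> (r + q) = r/q. With classes of size n^(1 -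
    \<open>\<delta>\<close>) the expected number u^r (u p^d)^(q - 1) is then
    n^\<open>\<delta>\<close> up to rounding, so it does not drop below a constant, and
    \<open>\<kappa>\<close> pays for halving each class size when rounding down.\<close>
  define \<delta> where "\<delta> = real r / (real q * (real r + real q))"
  define \<kappa> :: real where "\<kappa> = (1 / 2) ^ (r + q)"
  define c where "c = \<kappa> / 2 ^ (\<rho> + r + (q - 1))"
  \<comment> \<open>With this factor the groups together occupy at most half of the vertices, which
    leaves room for the roots.\<close>
  define K where "K = 1 / (2 * (real r + real q))"
  define u where "u n = nat \<lfloor>real n powr (1 - \<delta>)\<rfloor>" for n :: nat
  define g where "g n = nat \<lfloor>real n powr \<delta> * K\<rfloor>" for n :: nat
  have rq: "0 < real q" "0 < real r" using q_pos r by auto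
  have \<delta>0: "0 < \<delta>" and \<delta>rq: "\<delta> * (real r + real q) = real r / real q"
    using rq by (auto simp: \<delta>_def)
  have K0: "0 < K" using rq by (simp add: K_def)
  have \<kappa>: "0 < \<kappa>" "\<kappa> \<le> 1" by (auto simp: \<kappa>_def power_le_one)
  have c: "0 < c" "c \<le> 1" using \<kappa> by (auto simp: c_def divide_le_eq intro: order_trans[OF \<kappa>(2)])
  have \<delta>le: "\<delta> \<le> real r / real q"
  proof -
    have "\<delta> * 1 \<le> \<delta> * (real r + real q)" using \<delta>0 q_pos r by (intro mult_left_mono) auto
    then show ?thesis using \<delta>rq by simp
  qed
  define \<theta> where "\<theta> = 1 - \<delta> - (real d - 1) * crit d r q"
  have \<theta>: "0 < \<theta>" using exponent_gap \<delta>le by (simp add: \<theta>_def)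
  have \<delta>1: "\<delta> < 1"
  proof -
    have "0 \<le> (real d - 1) * crit d r q" using d_pos by (simp add: crit_def)
    then show ?thesis using \<theta> by (simp add: \<theta>_def)
  qed
  let ?X = "\<lambda>n E. \<exists>f\<in>PiE {..<\<rho>} (\<lambda>_. {1..n}). inj_on f {..<\<rho>} \<and>
            \<not> linkable s r ({1..n} - f ` {..<\<rho>}) ((`) f ` \<F>) E"
  have "eventually (\<lambda>n::nat. 2 \<le> real n powr (1 - \<delta>)) sequentially"
    using \<delta>1 by real_asymp
  moreover have "eventually (\<lambda>n::nat. 2 \<le> real n powr \<theta>) sequentially"
    using \<theta> by real_asymp
  moreover have "eventually (\<lambda>n::nat. max 1 (2 * \<rho>) \<le> n) sequentially"
    by (rule eventually_ge_at_top)
  ultimately have "eventually (\<lambda>n. hprob s n (p n) (?X n)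
      \<le> real n ^ \<rho> * exp (- c * (real n powr \<delta> * K - 1))) sequentially"
  proof eventually_elim
    case (elim n)
    then have n: "0 < n" "2 * \<rho> \<le> n" by auto
    let ?v = "real n powr (1 - \<delta>)"
    have u: "?v / 2 \<le> real (u n)" "real (u n) \<le> ?v"
      using elim(1) unfolding u_def by linarith+
    have g: "real n powr \<delta> * K - 1 \<le> real (g n)" "real (g n) \<le> real n powr \<delta> * K"
    proof -
      have "0 \<le> real n powr \<delta> * K" using K0 by simp
      then show "real n powr \<delta> * K - 1 \<le> real (g n)" "real (g n) \<le> real n powr \<delta> * K"
        unfolding g_def by linarith+
    qed
    have p: "0 < p n" "p n \<le> 1" using p_bounds[OF n(1)] by auto
    have ug: "u n * (r + (q - 1)) * g n \<le> n - \<rho>"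
    proof -
      have "real (u n * (r + (q - 1)) * g n) \<le> ?v * (real r + real q) * (real n powr \<delta> * K)"
        unfolding of_nat_mult using u g by (intro mult_mono) auto
      also have "\<dots> = (?v * real n powr \<delta>) * ((real r + real q) * K)" by simp
      also have "?v * real n powr \<delta> = real n" using n by (simp add: powr_add[symmetric])
      also have "(real r + real q) * K = 1 / 2" using rq by (simp add: K_def)
      finally have "2 * real (u n * (r + (q - 1)) * g n) \<le> real n" by simp
      then have "2 * (u n * (r + (q - 1)) * g n) \<le> n"
        by (metis (mono_tags, lifting) of_nat_le_iff of_nat_mult of_nat_numeral)
      then show ?thesis using n by linarith
    qed
    have c1: "1 \<le> real (u n) * p n ^ (d - 1)"
    proof -
      have "?v / 2 * p n ^ (d - 1) = real n powr \<theta> / 2"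
        unfolding p_pow[OF n(1)] d_minus_1 \<theta>_def using n by (simp add: powr_add[symmetric])
      moreover have "?v / 2 * p n ^ (d - 1) \<le> real (u n) * p n ^ (d - 1)"
        using u by (intro mult_right_mono) auto
      ultimately show ?thesis using elim(2) by linarith
    qed
    have vp: "?v * p n ^ d = real n powr (- \<delta> - real r / real q)"
      unfolding p_pow[OF n(1)] d_crit using n by (simp add: powr_add[symmetric])
    have c2: "real (u n) * p n ^ d \<le> 1"
    proof -
      have "real (u n) * p n ^ d \<le> ?v * p n ^ d" using u by (intro mult_right_mono) auto
      also have "\<dots> \<le> real n powr 0" unfolding vp using n \<delta>0 \<delta>le by (intro powr_mono) auto
      also have "\<dots> = 1" using n by simp
      finally show ?thesis .
    qed
    have c3: "\<kappa> \<le> real (u n) ^ r * (real (u n) * p n ^ d) ^ (q - 1)"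
    proof -
      have half: "\<kappa> \<le> (1 / 2) ^ (r + (q - 1))" unfolding \<kappa>_def by (simp add: power_decreasing)
      have "1 \<le> real n powr (real r * (1 - \<delta>) + (real q - 1) * (- \<delta> - real r / real q))"
      proof (rule ge_one_powr_ge_zero)
        have "real r * (1 - \<delta>) + (real q - 1) * (- \<delta> - real r / real q)
            = real r / real q - \<delta> * (real r + real q) + \<delta>"
          using rq by (simp add: field_simps)
        then show "0 \<le> real r * (1 - \<delta>) + (real q - 1) * (- \<delta> - real r / real q)"
          using \<delta>rq \<delta>0 by simp
      qed (use n in simp)
      also have "\<dots> = ?v ^ r * (?v * p n ^ d) ^ (q - 1)"
        unfolding vp using n q_pos by (simp add: powr_power powr_add of_nat_diff mult.commute)
      finally have "\<kappa> * 1 \<le> (1 / 2) ^ (r + (q - 1)) * (?v ^ r * (?v * p n ^ d) ^ (q - 1))"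
        using half \<kappa> by (intro mult_mono) auto
      also have "\<dots> = (?v / 2) ^ r * (?v / 2 * p n ^ d) ^ (q - 1)"
        by (simp add: power_add power_divide power_mult_distrib)
      also have "\<dots> \<le> real (u n) ^ r * (real (u n) * p n ^ d) ^ (q - 1)"
        using u p by (intro mult_mono power_mono mult_right_mono) auto
      finally show ?thesis by simp
    qed
    define P where "P = {f \<in> PiE {..<\<rho>} (\<lambda>_. {1..n}). inj_on f {..<\<rho>}}"
    have finPi: "finite (PiE {..<\<rho>} (\<lambda>_. {1..n}))" by (intro finite_PiE) auto
    then have finP: "finite P" by (simp add: P_def)
    have "card P \<le> card (PiE {..<\<rho>} (\<lambda>_. {1..n}))"
      by (rule card_mono[OF finPi]) (auto simp: P_def)
    then have cP: "card P \<le> n ^ \<rho>" by (simp add: card_PiE)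
    have one: "hprob s n (p n) (\<lambda>E. \<not> linkable s r ({1..n} - f ` {..<\<rho>}) ((`) f ` \<F>) E) \<le> (1 - c) ^ g n"
      if f: "f \<in> P" for f
    proof -
      have inj: "inj_on f {..<\<rho>}" and fn: "f ` {..<\<rho>} \<subseteq> {1..n}" using f by (auto simp: P_def)
      have cR: "card (f ` {..<\<rho>}) = \<rho>" using inj by (simp add: card_image)
      have cF: "card ((`) f ` \<F>) = q - 1"
        using card_image_image[OF inj, of \<F>] \<F> card\<F> by auto
      have B: "B \<subseteq> f ` {..<\<rho>} \<and> card B = l - r" if "B \<in> (`) f ` \<F>" for B
      proof -
        from that obtain B' where B': "B' \<in> \<F>" "B = f ` B'" by auto
        then show ?thesis using \<F>[OF B'(1)] inj by (auto simp: card_image inj_on_subset)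
      qed
      show ?thesis
        using not_linkable_prob_le[where g = "g n" and \<B> = "(`) f ` \<F>", OF fn B s less_imp_le[OF r(2)] d _ p c1 c2 \<kappa>]
        unfolding cF cR c_def using ug c3 by simp
    qed
    have "hprob s n (p n) (?X n)
        = hprob s n (p n) (\<lambda>E. \<exists>f\<in>P. \<not> linkable s r ({1..n} - f ` {..<\<rho>}) ((`) f ` \<F>) E)"
      by (intro arg_cong[where f = "measure_pmf.prob _"]) (auto simp: P_def)
    also have "\<dots> \<le> (\<Sum>f\<in>P. hprob s n (p n) (\<lambda>E. \<not> linkable s r ({1..n} - f ` {..<\<rho>}) ((`) f ` \<F>) E))"
      by (rule hprob_Bex_le[OF finP])
    also have "\<dots> \<le> (\<Sum>f\<in>P. (1 - c) ^ g n)" by (intro sum_mono one)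
    also have "\<dots> = real (card P) * (1 - c) ^ g n" by simp
    also have "\<dots> \<le> real n ^ \<rho> * exp (- c * (real n powr \<delta> * K - 1))"
    proof (intro mult_mono)
      show "real (card P) \<le> real n ^ \<rho>" using cP by (metis of_nat_le_iff of_nat_power)
      have "(1 - c) ^ g n \<le> exp (- c) ^ g n"
        using c exp_ge_add_one_self[of "- c"] by (intro power_mono) auto
      also have "\<dots> = exp (- c * real (g n))" by (simp add: exp_of_nat_mult[symmetric] mult.commute)
      also have "\<dots> \<le> exp (- c * (real n powr \<delta> * K - 1))" using g c by simp
      finally show "(1 - c) ^ g n \<le> exp (- c * (real n powr \<delta> * K - 1))" .
    qed (use c in auto)
    finally show ?case .
  qed
  moreover have "(\<lambda>n::nat. real n ^ \<rho> * exp (- c * (real n powr \<delta> * K - 1))) \<longlonglongrightarrow> 0"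
    using \<open>0 < \<delta>\<close> \<open>0 < K\<close> \<open>0 < c\<close> by real_asymp
  ultimately show ?thesis
    by (rule tendsto_sandwich[rotated 1, OF _ tendsto_const[of 0]]) (simp add: always_eventually)
qed

text \<open>At exactly q sets the expected number of admissible T is at most (1 + q
  n^(-\<open>\<epsilon>\<close>))^q, which tends to 1. The gain c^2 from two independent halves
  therefore leaves c^2/2. The bound is uniform in \<open>f\<close>, as is needed to combine it with
  a second moment over copies.\<close>

lemma not_linkable_prob_bounded_below:
  fixes \<rho> x :: nat
  assumes \<X>: "finite \<X>" "card \<X> \<le> x" and \<F>: "\<F> = \<X> \<union> (\<lambda>c. insert c A) ` C"
    and AC: "A \<inter> C = {}" "A \<subseteq> {..<\<rho>}" "C \<subseteq> {..<\<rho>}"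
    and B: "\<And>B. B \<in> \<F> \<Longrightarrow> B \<subseteq> {..<\<rho>} \<and> card B = l - r" and card\<F>: "card \<F> = q"
    and qx: "r * d * (x + 1) < q"
  obtains \<eta> where "0 < \<eta>"
    "eventually (\<lambda>n. \<forall>f. f ` {..<\<rho>} \<subseteq> {1..n} \<longrightarrow> inj_on f {..<\<rho>} \<longrightarrow>
       \<eta> \<le> hprob s n (p n) (\<lambda>E. \<not> linkable s r ({1..n} - f ` {..<\<rho>}) ((`) f ` \<F>) E)) sequentially"
proof -
  define m where "m = r + q"
  \<comment> \<open>Lower bound for u/n below, where u = n div (4 m): two groups of u m vertices
    each fit into half of the vertices.\<close>
  define K where "K = 1 / (8 * real m)"
  define \<kappa> where "\<kappa> = K ^ m"
  define \<gamma> where "\<gamma> = 1 / (real x + 1)"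
  define c where "c = \<kappa> / 2 ^ (\<rho> + r + q)"
  define \<theta> where "\<theta> = 1 - (real d - 1) * crit d r q"
  \<comment> \<open>A reused vertex has weight p^\<open>\<gamma>\<close> = (n p^d)
    n^(-\<open>\<epsilon>\<close>), against n p^d for a fresh one. The assumption r d (x + 1) < q
    makes this exponent positive.\<close>
  define \<epsilon> where "\<epsilon> = crit d r q * \<gamma> - real r / real q"
  have rq: "0 < real q" "0 < real r" using q_pos r by auto
  have m: "0 < m" "1 \<le> real m" using q_pos by (auto simp: m_def)
  have K: "0 < K" "K \<le> 1" using m by (auto simp: K_def)
  have \<kappa>: "0 < \<kappa>" "\<kappa> \<le> 1" using K by (auto simp: \<kappa>_def power_le_one)
  have c0: "0 < c" using \<kappa> by (simp add: c_def)
  have "0 < real r / real q" using rq by simp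
  then have \<theta>: "0 < \<theta>" using exponent_gap unfolding \<theta>_def by linarith
  have \<epsilon>: "0 < \<epsilon>"
  proof -
    have "real (r * d * (x + 1)) < real q" using qx by (simp only: of_nat_less_iff)
    define D where "D = real d * (real x + 1)"
    have "0 < D" using d_pos by (simp add: D_def)
    moreover have "real r * D < real q" using \<open>real (r * d * (x + 1)) < real q\<close>
      by (simp add: D_def algebra_simps)
    ultimately have "real r / real q < 1 / D" using rq by (simp add: pos_divide_less_eq pos_less_divide_eq)
    also have "1 / D = 1 / real d * \<gamma>" by (simp add: D_def \<gamma>_def)
    also have "\<dots> \<le> crit d r q * \<gamma>"
      using d_pos by (intro mult_right_mono) (auto simp: crit_def divide_right_mono \<gamma>_def)
    finally show ?thesis by (simp add: \<epsilon>_def)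
  qed
  have lim: "((\<lambda>n::nat. (1 + real q * real n powr (- \<epsilon>)) ^ q) \<longlongrightarrow> (1 + real q * 0) ^ q) sequentially"
    by (intro tendsto_intros) (use \<epsilon> in real_asymp)
  have "eventually (\<lambda>n::nat. (1 + real q * real n powr (- \<epsilon>)) ^ q < 1 + c\<^sup>2 / 2) sequentially"
    by (rule order_tendstoD(2)[OF lim]) (use c0 in simp)
  moreover have "eventually (\<lambda>n::nat. 1 / K \<le> real n powr \<theta>) sequentially"
    using \<theta> by real_asymp
  moreover have "eventually (\<lambda>n::nat. max (8 * m) (2 * \<rho>) \<le> n) sequentially"
    by (rule eventually_ge_at_top)
  ultimately have "eventually (\<lambda>n. \<forall>f. f ` {..<\<rho>} \<subseteq> {1..n} \<longrightarrow> inj_on f {..<\<rho>} \<longrightarrow>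
       c\<^sup>2 / 2 \<le> hprob s n (p n) (\<lambda>E. \<not> linkable s r ({1..n} - f ` {..<\<rho>}) ((`) f ` \<F>) E)) sequentially"
  proof eventually_elim
    case (elim n)
    then have n: "0 < n" "2 * \<rho> \<le> n" "8 * m \<le> n" using m by auto
    define u where "u = n div (4 * m)"
    have p: "0 < p n" "p n \<le> 1" using p_bounds[OF n(1)] by auto
    have u1: "u * m * 2 \<le> n - \<rho>"
    proof -
      have "u * (4 * m) \<le> n" unfolding u_def by (rule div_times_less_eq_dividend)
      then show ?thesis using n by linarith
    qed
    have u2: "real n * K \<le> real u"
    proof -
      have "n < u * (4 * m) + 4 * m"
        using m div_mult_mod_eq[of n "4 * m"] mod_less_divisor[of "4 * m" n] unfolding u_def by linarith
      then have 1: "n < 4 * (m * u) + 4 * m" by (simp add: mult_ac)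
      then have "1 \<le> u" using n(3) m by (cases u) auto
      then have "m * 1 \<le> m * u" by (intro mult_le_mono2)
      with 1 have "n \<le> 8 * (m * u)" by linarith
      then have "real n \<le> real (8 * (m * u))" by (simp only: of_nat_le_iff)
      then show ?thesis using m by (simp add: K_def field_simps)
    qed
    have u3: "real u \<le> real n" by (simp add: u_def)
    have np: "real n * p n ^ d = real n powr (- (real r / real q))" by (rule n_p_pow_d[OF n(1)])
    have c1: "1 \<le> real u * p n ^ (d - 1)"
    proof -
      have "real n * p n ^ (d - 1) = real n powr 1 * real n powr (- ((real d - 1) * crit d r q))"
        unfolding p_pow[OF n(1)] d_minus_1 using n by simp
      also have "\<dots> = real n powr \<theta>" unfolding \<theta>_def by (subst powr_add[symmetric]) simp
      finally have "1 \<le> K * (real n * p n ^ (d - 1))" using elim(2) K by (simp add: field_simps)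
      also have "\<dots> \<le> real u * p n ^ (d - 1)"
        using mult_right_mono[OF u2, of "p n ^ (d - 1)"] by (simp add: mult_ac)
      finally show ?thesis .
    qed
    have c2: "real u * p n ^ d \<le> 1"
    proof -
      have "real u * p n ^ d \<le> real n * p n ^ d" using u3 by (intro mult_right_mono) auto
      also have "\<dots> \<le> real n powr 0" unfolding np using n by (intro powr_mono) auto
      finally show ?thesis using n by simp
    qed
    have nr: "real n ^ r * (real n * p n ^ d) ^ q = 1"
    proof -
      have "real n ^ r * (real n * p n ^ d) ^ q = real n powr real r * real n powr (- real r)"
        unfolding np using n rq by (simp add: powr_power powr_realpow)
      also have "\<dots> = 1" using n by (simp add: powr_add[symmetric])
      finally show ?thesis .
    qed
    have c3: "\<kappa> \<le> real u ^ r * (real u * p n ^ d) ^ q"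
    proof -
      have "\<kappa> = \<kappa> * (real n ^ r * (real n * p n ^ d) ^ q)" using nr by simp
      also have "\<dots> = (real n * K) ^ r * (real n * K * p n ^ d) ^ q"
        by (simp add: \<kappa>_def m_def power_add power_mult_distrib)
      also have "\<dots> \<le> real u ^ r * (real u * p n ^ d) ^ q"
        using u2 p K by (intro mult_mono power_mono mult_right_mono) auto
      finally show ?thesis .
    qed
    have EN: "real n ^ r * (real n * p n ^ d + real q * p n powr \<gamma>) ^ q
        = (1 + real q * real n powr (- \<epsilon>)) ^ q"
    proof -
      have np0: "0 < real n * p n ^ d" using n p by simp
      have "p n powr \<gamma> = real n powr (- (crit d r q * \<gamma>))" by (simp add: powr_powr)
      also have "\<dots> = (real n * p n ^ d) * real n powr (- \<epsilon>)"
        unfolding np by (subst powr_add[symmetric]) (simp add: \<epsilon>_def)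
      finally have "real n * p n ^ d + real q * p n powr \<gamma>
          = (real n * p n ^ d) * (1 + real q * real n powr (- \<epsilon>))"
        by (simp add: algebra_simps)
      then have "real n ^ r * (real n * p n ^ d + real q * p n powr \<gamma>) ^ q
         = (real n ^ r * (real n * p n ^ d) ^ q) * (1 + real q * real n powr (- \<epsilon>)) ^ q"
        by (simp only: power_mult_distrib mult.assoc)
      then show ?thesis using nr by simp
    qed
    show ?case
    proof (intro allI impI)
      fix f assume fn: "f ` {..<\<rho>} \<subseteq> {1..n}" and inj: "inj_on f {..<\<rho>}"
      let ?R = "f ` {..<\<rho>}" and ?\<B> = "(`) f ` \<F>"
      have cR: "card ?R = \<rho>" using inj by (simp add: card_image)
      have cF: "card ?\<B> = q" using card_image_image[OF inj, of \<F>] B card\<F> by auto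
      have B': "B \<subseteq> ?R \<and> card B = l - r" if "B \<in> ?\<B>" for B
      proof -
        from that obtain B0 where B0: "B0 \<in> \<F>" "B = f ` B0" by auto
        then show ?thesis using B[OF B0(1)] inj by (auto simp: card_image inj_on_subset)
      qed
      have shadow: "real d + \<gamma> * (real (card F) - 1)
          \<le> real (card (\<Union>B\<in>F. {X. X \<subseteq> T \<union> B \<and> card X = s - 1}))"
        if T: "T \<subseteq> {1..n} - ?R" "card T = r" and F: "F \<subseteq> ?\<B>" "F \<noteq> {}" for T F
        unfolding d \<gamma>_def
      proof (rule shadow_Union_ge)
        show "F \<subseteq> (`) f ` \<X> \<union> (\<lambda>c. insert c (f ` A)) ` (f ` C)"
          using F(1) unfolding \<F> by (simp add: image_Un image_image)
        show "finite ((`) f ` \<X>)" using \<X> by simp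
        show "card ((`) f ` \<X>) \<le> x" using card_image_le[OF \<X>(1), of "(`) f"] \<X>(2) by linarith
        show "finite (f ` C)" using AC(3) finite_subset by blast
        show "finite T" using T(1) finite_subset by blast
        show "finite B \<and> card B = l - r \<and> B \<inter> T = {}" if "B \<in> F" for B
        proof -
          have B0: "B \<subseteq> ?R" "card B = l - r" using B'[of B] F(1) that by blast+
          then have "finite B" using finite_subset by blast
          moreover have "B \<inter> T = {}" using B0 T(1) by blast
          ultimately show ?thesis using B0 by simp
        qed
        show "f ` A \<inter> f ` C = {}" using inj_on_image_Int[OF inj AC(2,3)] AC(1) by simp
      qed (fact F(2) T(2) less_imp_le[OF r(2)] s)+
      have "1 + (\<kappa> / 2 ^ (card ?R + r + card ?\<B>))\<^sup>2
          - real n ^ r * (real n * p n ^ d + real (card ?\<B>) * p n powr \<gamma>) ^ card ?\<B>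
        \<le> hprob s n (p n) (\<lambda>E. \<not> linkable s r ({1..n} - ?R) ?\<B> E)"
      proof (rule not_linkable_prob_ge[OF fn B' s r(1) less_imp_le[OF r(2)] d _ p c1 c2 \<kappa> _ shadow])
        show "u * (r + card ?\<B>) * 2 \<le> n - card ?R" using u1 unfolding cF cR m_def .
        show "\<kappa> \<le> real u ^ r * (real u * p n ^ d) ^ card ?\<B>" using c3 unfolding cF .
      qed
      then show "c\<^sup>2 / 2 \<le> hprob s n (p n) (\<lambda>E. \<not> linkable s r ({1..n} - ?R) ?\<B> E)"
        unfolding cR cF EN c_def[symmetric] using elim(1) by linarith
    qed
  qed
  moreover have "0 < c\<^sup>2 / 2" using c0 by simp
  ultimately show thesis by (rule that[rotated])
qed

end

section \<open>The core configuration\<close>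

definition nbrs :: "nat \<Rightarrow> nat \<Rightarrow> nat set set \<Rightarrow> nat set \<Rightarrow> nat set" where
  "nbrs s n E W = {c \<in> {1..n}. star s c W \<subseteq> E}"

text \<open>For c in W some (s - 1)-subset X of W contains c. Then \<open>insert c X\<close> is X
  itself, too small for an edge.\<close>

lemma nbrs_fresh:
  assumes E: "E \<subseteq> potential_edges s n" and W: "finite W" "s - 1 \<le> card W" and s: "2 \<le> s"
  shows "nbrs s n E W \<inter> W = {}"
proof (rule equals0I)
  fix c assume c: "c \<in> nbrs s n E W \<inter> W"
  then have "s - 2 \<le> card (W - {c})" using W by simp
  then obtain Y where Y: "Y \<subseteq> W - {c}" "card Y = s - 2" "finite Y"
    by (metis obtain_subset_with_card_n)
  then have card: "card (insert c Y) = s - 1" using s by (subst card_insert_disjoint) auto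
  then have "insert c (insert c Y) \<in> star s c W" using Y c unfolding star_def by blast
  then have "insert c Y \<in> potential_edges s n" using c E by (auto simp: nbrs_def)
  then have "s - 1 = s" using card by (simp add: potential_edges_def)
  then show False using s by linarith
qed

text \<open>The indices below \<open>l\<close> stand for A, those from \<open>l\<close> to
  \<open>k - 1\<close> for r + 2 of its neighbours. Of the remaining edges of \<open>K\<close> only
  the number matters. \<open>m\<close> is the critical neighbourhood size, and m >= r + 4 leaves at
  least two neighbours outside \<open>K\<close>, which bounds the first moment by 1/2!. The two
  bounds on \<open>q\<close> serve the balance of the core and the shared intermediate
  vertices.\<close>

locale core_params = link_params +
  fixes k m :: nat and K :: "nat set set" and \<X> :: "nat set set"
  assumes k: "k = l + r + 2" and K: "\<And>h. h \<in> K \<Longrightarrow> h \<subseteq> {..<k} \<and> card h = s"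
    and cardK: "card K = d * (l + 2)" and starK: "\<And>y. l \<le> y \<Longrightarrow> y < k \<Longrightarrow> star s y {..<l} \<subseteq> K"
    and \<X>: "\<And>B. B \<in> \<X> \<Longrightarrow> B \<subseteq> {..<l} \<and> card B = l - r" and card\<X>: "card \<X> = l - r"
    and qm: "q = m + (l - r)" and m: "r + 4 \<le> m"
    and q_large: "r * d * k \<le> q" "r * d * (l + 1) < q"
begin

abbreviation A0 :: "nat set" where "A0 \<equiv> {..<l - r - 1}"

text \<open>All members have \<open>l - r\<close> elements, so a star over T and one of them has d
  edges. Since \<open>A0\<close> is common to them, a single quantified vertex c runs through all
  members outside \<open>\<X>\<close>.\<close>

definition links :: "nat \<Rightarrow> nat set set" where
  "links M = \<X> \<union> (\<lambda>c. insert c A0) ` {l..<l + M}"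

definition core :: "nat set set" where
  "core = K \<union> (\<Union>c\<in>{k..<l + m}. star s c {..<l})"

text \<open>Formulated with the whole neighbourhood of A, whatever its size, because
  \<open>m\<close> cannot occur in the sentence. T and the intermediate vertices avoid A and all of
  its neighbours.\<close>

definition unlinked_core :: "nat \<Rightarrow> nat set set \<Rightarrow> bool" where
  "unlinked_core n E \<longleftrightarrow> (\<exists>f. f ` {..<k} \<subseteq> {1..n} \<and> inj_on f {..<k} \<and> (\<forall>h\<in>K. f ` h \<in> E) \<and>
     \<not> linkable s r ({1..n} - f ` {..<l} - nbrs s n E (f ` {..<l}))
        ((`) f ` \<X> \<union> (\<lambda>c. insert c (f ` A0)) ` nbrs s n E (f ` {..<l})) E)"

lemma finite_\<X>: "finite \<X>"
  by (rule finite_subset[of _ "Pow {..<l}"]) (use \<X> in auto)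

lemma finite_K: "finite K"
  by (rule finite_subset[of _ "Pow {..<k}"]) (use K in auto)

lemma links_mem: "B \<in> links M \<Longrightarrow> B \<subseteq> {..<l + M} \<and> card B = l - r"
proof -
  assume "B \<in> links M"
  then consider "B \<in> \<X>" | c where "c \<in> {l..<l + M}" "B = insert c A0" by (auto simp: links_def)
  then show ?thesis
  proof cases
    case 1
    then show ?thesis using \<X>[of B] by auto
  next
    case 2
    then show ?thesis using r by auto
  qed
qed

lemma card_links: "card (links M) = M + (l - r)"
proof -
  have inj: "inj_on (\<lambda>c. insert c A0) {l..<l + M}"
  proof (rule inj_onI)
    fix c c' assume "c \<in> {l..<l + M}" "c' \<in> {l..<l + M}" "insert c A0 = insert c' A0"
    moreover from this have "c \<in> insert c' A0" by blast
    ultimately show "c = c'" by auto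
  qed
  have "\<X> \<inter> (\<lambda>c. insert c A0) ` {l..<l + M} = {}"
  proof (rule equals0I)
    fix B assume "B \<in> \<X> \<inter> (\<lambda>c. insert c A0) ` {l..<l + M}"
    then obtain c where "insert c A0 \<in> \<X>" "l \<le> c" by auto
    then show False using \<X>[of "insert c A0"] by auto
  qed
  then show ?thesis unfolding links_def
    using finite_\<X> card\<X> card_image[OF inj] by (subst card_Un_disjoint) auto
qed

lemma k_le: "k \<le> l + m" using k m by simp

lemma core_mem: "h \<in> core \<Longrightarrow> h \<subseteq> {..<l + m} \<and> card h = s"
proof -
  assume "h \<in> core"
  then consider "h \<in> K" | c where "c \<in> {k..<l + m}" "h \<in> star s c {..<l}" by (auto simp: core_def)
  then show ?thesis
  proof cases
    case 1
    then show ?thesis using K[of h] k_le by auto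
  next
    case 2
    then have "card h = s" using s k by (intro card_mem_star[OF 2(2)]) auto
    moreover have "h \<subseteq> {..<l + m}" using mem_star_subset[OF 2(2)] 2(1) k by auto
    ultimately show ?thesis by simp
  qed
qed

lemma finite_core: "finite core"
  using finite_K by (auto simp: core_def intro!: finite_star)

lemma card_stars:
  fixes W :: "nat set"
  assumes "finite C" "finite W" "C \<inter> W = {}"
  shows "card (\<Union>c\<in>C. star s c W) = card C * (card W choose (s - 1))"
proof -
  have "card (\<Union>c\<in>C. star s c W) = (\<Sum>c\<in>C. card (star s c W))"
  proof (rule card_UN_disjoint)
    show "\<forall>c\<in>C. \<forall>c'\<in>C. c \<noteq> c' \<longrightarrow> star s c W \<inter> star s c' W = {}"
    proof (intro ballI impI equals0I)
      fix c c' e assume c: "c \<in> C" "c' \<in> C" "c \<noteq> c'" "e \<in> star s c W \<inter> star s c' W"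
      then have "c \<in> e" "e \<subseteq> insert c' W" using mem_star_subset[of e s c' W] by (auto simp: star_def)
      then show False using c assms by auto
    qed
  qed (use assms in \<open>auto intro!: finite_star\<close>)
  also have "\<dots> = (\<Sum>c\<in>C. card W choose (s - 1))"
    using assms by (intro sum.cong card_star) auto
  finally show ?thesis by simp
qed

lemma card_core: "card core = d * q"
proof -
  have "K \<inter> (\<Union>c\<in>{k..<l + m}. star s c {..<l}) = {}"
  proof (rule equals0I)
    fix h assume "h \<in> K \<inter> (\<Union>c\<in>{k..<l + m}. star s c {..<l})"
    then obtain c where "h \<in> K" "k \<le> c" "c \<in> h" by (auto simp: star_def)
    then show False using K[of h] by auto
  qed
  then have "card core = card K + card (\<Union>c\<in>{k..<l + m}. star s c {..<l})"
    unfolding core_def using finite_K by (intro card_Un_disjoint) (auto intro!: finite_star)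
  also have "card (\<Union>c\<in>{k..<l + m}. star s c {..<l}) = (l + m - k) * d"
    using k by (subst card_stars) (auto simp: d)
  also have "card K + (l + m - k) * d = d * ((l + 2) + (l + m - k))"
    by (simp add: cardK algebra_simps)
  also have "(l + 2) + (l + m - k) = q" using qm k m r by simp
  finally show ?thesis .
qed

text \<open>This says n^|S| p^e(S) >= 1, the condition of the second moment bound. If S contains A,
  every neighbour missing from S removes d of the d q edges. If S misses a vertex of A, each
  neighbour outside \<open>K\<close> has at most d - 1 edges left, and (d - 1) crit <= 1. For the
  part S0 within \<open>K\<close> one has e + 1 <= d |S0|; the spare edge is worth crit >= 1/d and
  pays for the loss |S0| r/q.\<close>

lemma core_balanced:
  assumes S: "S \<subseteq> {..<l + m}"
  shows "real (card {h \<in> core. h \<subseteq> S}) * crit d r q \<le> real (card S)"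
proof (cases "{..<l} \<subseteq> S")
  case True
  define C where "C = {l..<l + m} - S"
  have finS: "finite S" using S finite_subset by blast
  have star_core: "star s c {..<l} \<subseteq> core" if "c \<in> {l..<l + m}" for c
    using that starK[of c] by (cases "c < k") (auto simp: core_def)
  have "(\<Union>c\<in>C. star s c {..<l}) \<subseteq> core" using star_core unfolding C_def by blast
  moreover have "{h \<in> core. h \<subseteq> S} \<inter> (\<Union>c\<in>C. star s c {..<l}) = {}"
    by (auto simp: C_def star_def)
  ultimately have "card {h \<in> core. h \<subseteq> S} + card (\<Union>c\<in>C. star s c {..<l}) \<le> card core"
    using finite_core by (subst card_Un_disjoint[symmetric])
      (auto intro: finite_subset intro!: card_mono)
  moreover have "card (\<Union>c\<in>C. star s c {..<l}) = card C * d"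
    by (subst card_stars) (auto simp: C_def d)
  ultimately have "card {h \<in> core. h \<subseteq> S} + card C * d \<le> d * q" by (simp add: card_core)
  then have e: "real (card {h \<in> core. h \<subseteq> S}) \<le> real d * (real q - real (card C))"
    using of_nat_mono[of "card {h \<in> core. h \<subseteq> S} + card C * d" "d * q", where ?'a = real]
    by (simp add: algebra_simps)
  have "{..<l + m} = S \<union> C" "S \<inter> C = {}" using S True by (auto simp: C_def)
  then have "l + m = card S + card C"
    using finS card_Un_disjoint[of S C] by (metis C_def card_lessThan finite_Diff finite_atLeastLessThan)
  moreover have "l + m = q + r" using qm r by simp
  ultimately have cS: "real (card S) = real q + real r - real (card C)" by linarith
  have "real (card {h \<in> core. h \<subseteq> S}) * crit d r q
      \<le> real d * (real q - real (card C)) * crit d r q"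
    using e by (intro mult_right_mono) (simp_all add: crit_def)
  also have "\<dots> = (real q - real (card C)) * (1 + real r / real q)"
    using d_crit by (simp add: mult_ac)
  also have "\<dots> = real q + real r - real (card C) - real (card C) * real r / real q"
    using q_pos by (simp add: field_simps)
  also have "\<dots> \<le> real (card S)" unfolding cS by simp
  finally show ?thesis .
next
  case False
  then obtain a where a: "a < l" "a \<notin> S" by auto
  define S0 where "S0 = S \<inter> {..<k}"
  define S1 where "S1 = S \<inter> {k..<l + m}"
  let ?eK = "card {h \<in> K. h \<subseteq> S}"
  have finS: "finite S0" "finite S1" by (auto simp: S0_def S1_def)
  have "S = S0 \<union> S1" using S by (auto simp: S0_def S1_def)
  moreover have "S0 \<inter> S1 = {}" by (auto simp: S0_def S1_def)
  ultimately have cS: "card S = card S0 + card S1" using finS by (metis card_Un_disjoint)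
  have "{h \<in> core. h \<subseteq> S} \<subseteq> {h \<in> K. h \<subseteq> S} \<union> (\<Union>c\<in>S1. star s c ({..<l} \<inter> S))"
    by (auto simp: core_def S1_def star_def)
  then have "card {h \<in> core. h \<subseteq> S} \<le> card ({h \<in> K. h \<subseteq> S} \<union> (\<Union>c\<in>S1. star s c ({..<l} \<inter> S)))"
    using finite_K finS by (intro card_mono) (auto intro!: finite_star)
  also have "\<dots> \<le> ?eK + card (\<Union>c\<in>S1. star s c ({..<l} \<inter> S))" by (rule card_Un_le)
  also have "card (\<Union>c\<in>S1. star s c ({..<l} \<inter> S)) \<le> (\<Sum>c\<in>S1. d - 1)"
  proof (rule order_trans[OF card_UN_le[OF finS(2)]], rule sum_mono)
    fix c assume "c \<in> S1"
    have "card ({..<l} \<inter> S) \<le> card ({..<l} - {a})" using a by (intro card_mono) auto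
    also have "\<dots> = l - 1" using a by (subst card_Diff_singleton) auto
    finally have "card ({..<l} \<inter> S) choose (s - 1) \<le> (l - 1) choose (s - 1)"
      by (rule binomial_right_mono)
    moreover have "card (star s c ({..<l} \<inter> S)) \<le> card ({..<l} \<inter> S) choose (s - 1)"
      by (rule card_star_le) simp
    moreover have "(l - 1) choose (s - 1) \<le> d - 1" unfolding d by (rule binomial_pred_le[OF s])
    ultimately show "card (star s c ({..<l} \<inter> S)) \<le> d - 1" by linarith
  qed
  finally have e: "card {h \<in> core. h \<subseteq> S} \<le> ?eK + card S1 * (d - 1)" by simp
  have crit0: "0 \<le> crit d r q" by (simp add: crit_def)
  have eK: "real ?eK * crit d r q \<le> real (card S0)"
  proof (cases "S0 = {}")
    case True
    have "{h \<in> K. h \<subseteq> S} = {}"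
    proof (rule equals0I)
      fix h assume h: "h \<in> {h \<in> K. h \<subseteq> S}"
      then have "h = {}" using True K[of h] by (auto simp: S0_def)
      then show False using h K[of h] s by auto
    qed
    then have "?eK = 0" by (simp only: card.empty)
    then show ?thesis by simp
  next
    case ne: False
    then have v: "1 \<le> card S0" using finS by (simp add: Suc_leI card_gt_0_iff)
    \<comment> \<open>On at most l + 1 vertices even the complete hypergraph is sparse enough: s e
      <= |S0| d by absorption, and s >= 2. From l + 2 vertices on, d |S0| is at least
      \<open>card K\<close>, and \<open>K\<close> has an edge through the missing vertex
      \<open>a\<close>.\<close>
    have "?eK + 1 \<le> d * card S0"
    proof (cases "card S0 \<le> l + 1")
      case True
      have "{h \<in> K. h \<subseteq> S} \<subseteq> {h. h \<subseteq> S0 \<and> card h = s}" using K by (auto simp: S0_def)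
      then have "?eK \<le> card {h. h \<subseteq> S0 \<and> card h = s}" using finS by (intro card_mono) auto
      also have "\<dots> = card S0 choose s" by (rule n_subsets[OF finS(1)])
      finally have "2 * ?eK \<le> s * (card S0 choose s)" using s by (intro mult_mono) auto
      also have "\<dots> = card S0 * ((card S0 - 1) choose (s - 1))"
        using s by (intro times_binomial_minus1_eq) auto
      also have "\<dots> \<le> card S0 * d"
        unfolding d using True by (intro mult_le_mono2 binomial_right_mono) simp
      finally have "2 * ?eK \<le> d * card S0" by (simp add: mult.commute)
      moreover have "1 * 1 \<le> d * card S0" using v d_pos by (intro mult_mono) auto
      ultimately show ?thesis by linarith
    next
      case big: False
      have "s - 2 \<le> card ({..<l} - {a})" using a s by simp
      then obtain Y where Y: "Y \<subseteq> {..<l} - {a}" "card Y = s - 2" "finite Y"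
        by (metis obtain_subset_with_card_n)
      then have "card (insert a Y) = s - 1" using s by (subst card_insert_disjoint) auto
      then have "insert l (insert a Y) \<in> star s l {..<l}" using Y a unfolding star_def by blast
      moreover have "star s l {..<l} \<subseteq> K" using k by (intro starK) auto
      ultimately have "insert l (insert a Y) \<in> K" by (rule rev_subsetD)
      moreover have "insert l (insert a Y) \<notin> {h \<in> K. h \<subseteq> S}" using a(2) by simp
      ultimately have "{h \<in> K. h \<subseteq> S} \<noteq> K" by metis
      then have "{h \<in> K. h \<subseteq> S} \<subset> K" by (intro psubsetI) auto
      then have "?eK < card K" by (rule psubset_card_mono[OF finite_K])
      moreover have "d * (l + 2) \<le> d * card S0" using big by (intro mult_le_mono2) simp
      ultimately show ?thesis using cardK by linarith
    qed
    then have "real ?eK + 1 \<le> real d * real (card S0)"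
      using of_nat_mono[of "?eK + 1" "d * card S0", where ?'a = real] by simp
    then have "real ?eK * crit d r q \<le> (real d * real (card S0) - 1) * crit d r q"
      using crit0 by (intro mult_right_mono) auto
    also have "\<dots> = real (card S0) * (real d * crit d r q) - crit d r q"
      by (simp add: algebra_simps)
    also have "\<dots> = real (card S0) * (1 + real r / real q) - crit d r q"
      by (simp only: d_crit)
    also have "\<dots> \<le> real (card S0)"
    proof -
      have "card S0 \<le> k" using card_mono[of "{..<k}" S0] by (auto simp: S0_def)
      then have "r * d * card S0 \<le> q" using q_large(1) by (meson le_trans mult_le_mono2)
      then have "real r * real d * real (card S0) \<le> real q"
        using of_nat_mono[of "r * d * card S0" q, where ?'a = real] by simp
      then have "real (card S0) * real r / real q \<le> 1 / real d"
        using q_pos d_pos by (simp add: field_simps)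
      also have "\<dots> \<le> crit d r q" by (simp add: crit_def divide_right_mono)
      finally show ?thesis by (simp add: algebra_simps)
    qed
    finally show ?thesis .
  qed
  have "real (card {h \<in> core. h \<subseteq> S}) \<le> real ?eK + real (card S1) * (real d - 1)"
    using of_nat_mono[OF e, where ?'a = real] unfolding of_nat_add of_nat_mult d_minus_1 .
  then have "real (card {h \<in> core. h \<subseteq> S}) * crit d r q
      \<le> (real ?eK + real (card S1) * (real d - 1)) * crit d r q"
    using crit0 by (rule mult_right_mono)
  also have "\<dots> = real ?eK * crit d r q + real (card S1) * ((real d - 1) * crit d r q)"
    by (simp add: algebra_simps)
  also have "\<dots> \<le> real (card S0) + real (card S1) * 1"
  proof (intro add_mono mult_left_mono eK)
    have "0 \<le> real r / real q" by simp
    then show "(real d - 1) * crit d r q \<le> 1" using exponent_gap by linarith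
  qed simp
  finally show ?thesis by (simp add: cS)
qed

section \<open>Lower bound for the probability of an unlinked core\<close>

lemma image_links:
  "(`) f ` links M = (`) f ` \<X> \<union> (\<lambda>c. insert c (f ` A0)) ` f ` {l..<l + M}"
  by (simp add: links_def image_Un image_image)

text \<open>The true neighbourhood of A contains the m prescribed vertices but may be larger. More
  neighbours mean more sets to link and fewer vertices to link them with, so unlinkability
  persists.\<close>

lemma unlinked_coreI:
  assumes f: "f ` {..<l + m} \<subseteq> {1..n}" "inj_on f {..<l + m}" and E: "\<forall>h\<in>core. f ` h \<in> E"
    and nl: "\<not> linkable s r ({1..n} - f ` {..<l + m}) ((`) f ` links m) E"
  shows "unlinked_core n E"
  unfolding unlinked_core_def
proof (intro exI[of _ f] conjI)
  let ?N = "nbrs s n E (f ` {..<l})"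
  have sub: "{..<k} \<subseteq> {..<l + m}" using k_le by auto
  show "f ` {..<k} \<subseteq> {1..n}" by (rule subset_trans[OF image_mono[OF sub] f(1)])
  show "inj_on f {..<k}" using f(2) sub by (rule inj_on_subset)
  show "\<forall>h\<in>K. f ` h \<in> E" using E by (auto simp: core_def)
  have injl: "inj_on f {..<l}" by (rule inj_on_subset[OF f(2)]) auto
  have C: "f ` {l..<l + m} \<subseteq> ?N"
  proof (rule image_subsetI)
    fix c assume c: "c \<in> {l..<l + m}"
    then have "star s c {..<l} \<subseteq> core" using starK[of c] by (cases "c < k") (auto simp: core_def)
    then have "star s (f c) (f ` {..<l}) \<subseteq> E" unfolding star_image[OF injl] using E by blast
    moreover have "f c \<in> {1..n}" using c f(1) by auto
    ultimately show "f c \<in> ?N" by (simp add: nbrs_def)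
  qed
  have "{..<l + m} = {..<l} \<union> {l..<l + m}" by auto
  then have "f ` {..<l + m} = f ` {..<l} \<union> f ` {l..<l + m}" by (metis image_Un)
  then have U: "{1..n} - f ` {..<l} - ?N \<subseteq> {1..n} - f ` {..<l + m}" using C by auto
  have L: "(`) f ` links m \<subseteq> (`) f ` \<X> \<union> (\<lambda>c. insert c (f ` A0)) ` ?N"
    unfolding image_links by (intro Un_mono order_refl image_mono C)
  show "\<not> linkable s r ({1..n} - f ` {..<l} - ?N)
      ((`) f ` \<X> \<union> (\<lambda>c. insert c (f ` A0)) ` ?N) E"
    using nl linkable_mono[OF _ U L] by metis
qed

text \<open>Second moment over copies of the core, with unlinkability as the additional event. The
  copy concerns edges inside its vertex set, linkability only edges that leave it; by independence
  the conditional probability is still at least \<open>\<eta>\<close>.\<close>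

lemma unlinked_core_prob_bounded_below:
  obtains \<eta> where "0 < \<eta>" "eventually (\<lambda>n. \<eta> \<le> hprob s n (p n) (unlinked_core n)) sequentially"
proof -
  define \<rho> where "\<rho> = l + m"
  have \<rho>: "0 < \<rho>" using r by (simp add: \<rho>_def)
  obtain \<eta> where \<eta>: "0 < \<eta>"
    and ev: "eventually (\<lambda>n. \<forall>f. f ` {..<\<rho>} \<subseteq> {1..n} \<longrightarrow> inj_on f {..<\<rho>} \<longrightarrow>
       \<eta> \<le> hprob s n (p n) (\<lambda>E. \<not> linkable s r ({1..n} - f ` {..<\<rho>}) ((`) f ` links m) E)) sequentially"
  proof (rule not_linkable_prob_bounded_below)
    show "finite \<X>" by (rule finite_\<X>)
    show "card \<X> \<le> l" using card\<X> by simp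
    show "links m = \<X> \<union> (\<lambda>c. insert c A0) ` {l..<l + m}" by (simp add: links_def)
    show "card (links m) = q" using card_links qm by simp
    show "r * d * (l + 1) < q" by (rule q_large(2))
    show "B \<subseteq> {..<\<rho>} \<and> card B = l - r" if "B \<in> links m" for B
      using links_mem[OF that] by (simp add: \<rho>_def)
  qed (auto simp: \<rho>_def)
  define c where "c = 1 / (2 * real \<rho>)"
  define \<kappa> where "\<kappa> = c ^ \<rho>"
  have c: "0 < c" "c \<le> 1" using \<rho> by (auto simp: c_def)
  have \<kappa>: "0 < \<kappa>" using c by (simp add: \<kappa>_def)
  have "eventually (\<lambda>n. \<eta>\<^sup>2 * \<kappa> / 2 ^ \<rho> \<le> hprob s n (p n) (unlinked_core n)) sequentially"
    using ev eventually_ge_at_top[of "2 * \<rho>"]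
  proof eventually_elim
    case (elim n)
    then have n: "0 < n" "2 * \<rho> \<le> n" using \<rho> by auto
    have p: "0 < p n" "p n \<le> 1" using p_bounds[OF n(1)] by auto
    define u where "u = n div \<rho>"
    have "u * card {..<\<rho>} \<le> card {1..n}" by (simp add: u_def)
    then obtain V where V: "\<And>j. j \<in> {..<\<rho>} \<Longrightarrow> V j \<subseteq> {1..n}" "\<And>j. j \<in> {..<\<rho>} \<Longrightarrow> card (V j) = u"
      and disj: "disjoint_family_on V {..<\<rho>}"
      using disjoint_classes_exist[of "{..<\<rho>}" "{1..n}" u] by auto
    have u: "real n * c \<le> real u"
    proof -
      have "n < u * \<rho> + \<rho>"
        using \<rho> div_mult_mod_eq[of n \<rho>] mod_less_divisor[of \<rho> n] unfolding u_def by linarith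
      moreover from this have "1 \<le> u" using n \<rho> by (cases u) auto
      then have "1 * \<rho> \<le> u * \<rho>" by (intro mult_le_mono1)
      ultimately have "n \<le> 2 * (u * \<rho>)" by linarith
      then have "real n \<le> real (2 * (u * \<rho>))" by (simp only: of_nat_le_iff)
      then show ?thesis using \<rho> by (simp add: c_def field_simps)
    qed
    have core: "h \<subseteq> {..<\<rho>} \<and> card h = s" if "h \<in> core" for h
      using core_mem[OF that] by (simp add: \<rho>_def)
    let ?G = "\<lambda>\<phi> E. \<not> linkable s r ({1..n} - \<phi> ` {..<\<rho>}) ((`) \<phi> ` links m) E"
    have "\<eta>\<^sup>2 * \<kappa> / 2 ^ card {..<\<rho>}
        \<le> hprob s n (p n) (\<lambda>E. \<exists>\<phi>\<in>PiE {..<\<rho>} V. (\<forall>h\<in>core. \<phi> ` h \<in> E) \<and> ?G \<phi> E)"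
    proof (rule partite_second_moment[OF finite_lessThan V(1) disj core p \<kappa> less_imp_le[OF \<eta>]])
      fix S assume S: "S \<subseteq> {..<\<rho>}"
      let ?e = "card {h \<in> core. h \<subseteq> S}"
      have cS: "card S \<le> \<rho>" using card_mono[OF finite_lessThan S] by simp
      have bal: "real ?e * crit d r q \<le> real (card S)"
        by (rule core_balanced) (use S in \<open>simp add: \<rho>_def\<close>)
      have "1 \<le> real n powr (real (card S) - real ?e * crit d r q)"
        by (rule ge_one_powr_ge_zero) (use n bal in auto)
      also have "\<dots> = real n ^ card S * p n ^ ?e"
        unfolding p_pow[OF n(1)] using n by (simp add: powr_diff powr_minus powr_realpow divide_inverse)
      finally have "\<kappa> * 1 \<le> c ^ card S * (real n ^ card S * p n ^ ?e)"
        unfolding \<kappa>_def using c cS by (intro mult_mono power_decreasing) auto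
      also have "\<dots> = (real n * c) ^ card S * p n ^ ?e" by (simp add: power_mult_distrib)
      also have "\<dots> \<le> real u ^ card S * p n ^ ?e"
        using u c by (intro mult_right_mono power_mono) auto
      also have "real u ^ card S = (\<Prod>j\<in>S. real (card (V j)))"
        using V(2) S by (subst prod_constant[symmetric], intro prod.cong) auto
      finally show "\<kappa> \<le> (\<Prod>j\<in>S. real (card (V j))) * p n ^ ?e" by simp
    next
      fix \<phi> assume \<phi>: "\<phi> \<in> PiE {..<\<rho>} V"
      let ?R = "\<phi> ` {..<\<rho>}"
      have R: "?R \<subseteq> {1..n}" using \<phi> V(1) by (auto dest!: PiE_mem)
      have inj: "inj_on \<phi> {..<\<rho>}" by (rule partite_inj_on[OF disj \<phi>])
      have F: "hprob s n (p n) (\<lambda>E. \<forall>h\<in>core. \<phi> ` h \<in> E) = p n ^ card core"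
        by (rule partite_copy_prob[OF V(1) disj \<phi> core]) (use p in auto)
      have "\<eta> * p n ^ card core \<le> hprob s n (p n) (?G \<phi>) * hprob s n (p n) (\<lambda>E. \<forall>h\<in>core. \<phi> ` h \<in> E)"
        unfolding F using elim(1) R inj p by (intro mult_right_mono) auto
      also have "\<dots> = hprob s n (p n) (\<lambda>E. ?G \<phi> E \<and> (\<forall>h\<in>core. \<phi> ` h \<in> E))"
      proof (rule hprob_indep[symmetric])
        let ?D = "{e. e \<subseteq> ({1..n} - ?R) \<union> ?R \<and> e \<inter> ({1..n} - ?R) \<noteq> {}}"
        have "B \<subseteq> ?R" if "B \<in> (`) \<phi> ` links m" for B
          using that links_mem[of _ m] by (auto simp: \<rho>_def)
        then show "?G \<phi> E \<longleftrightarrow> ?G \<phi> (E \<inter> ?D)" for E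
          using linkable_local[of "(`) \<phi> ` links m" ?R s r "{1..n} - ?R" E] by blast
        have "\<phi> ` h \<subseteq> ?R" if "h \<in> core" for h using core[OF that] by blast
        then show "(\<forall>h\<in>core. \<phi> ` h \<in> E) \<longleftrightarrow> (\<forall>h\<in>core. \<phi> ` h \<in> E \<inter> {e. e \<subseteq> ?R})" for E
          by blast
        show "?D \<inter> {e. e \<subseteq> ?R} = {}" by blast
      qed
      also have "\<dots> = hprob s n (p n) (\<lambda>E. (\<forall>h\<in>core. \<phi> ` h \<in> E) \<and> ?G \<phi> E)"
        by (simp only: conj_commute)
      finally show "\<eta> * p n ^ card core \<le> hprob s n (p n) (\<lambda>E. (\<forall>h\<in>core. \<phi> ` h \<in> E) \<and> ?G \<phi> E)" .
    qed
    also have "\<dots> \<le> hprob s n (p n) (unlinked_core n)"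
    proof (rule hprob_mono)
      fix E assume "\<exists>\<phi>\<in>PiE {..<\<rho>} V. (\<forall>h\<in>core. \<phi> ` h \<in> E) \<and> ?G \<phi> E"
      then obtain \<phi> where \<phi>: "\<phi> \<in> PiE {..<\<rho>} V" "\<forall>h\<in>core. \<phi> ` h \<in> E" "?G \<phi> E" by blast
      have "\<phi> ` {..<\<rho>} \<subseteq> {1..n}" using \<phi>(1) V(1) by (auto dest!: PiE_mem)
      then show "unlinked_core n E"
        using unlinked_coreI[of \<phi> n E] \<phi> partite_inj_on[OF disj \<phi>(1)] unfolding \<rho>_def by blast
    qed
    finally show ?case by simp
  qed
  moreover have "0 < \<eta>\<^sup>2 * \<kappa> / 2 ^ \<rho>" using \<eta> \<kappa> by simp
  ultimately show thesis by (rule that[rotated])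
qed

section \<open>Upper bound for the probability of an unlinked core\<close>

definition unlinkable_somewhere :: "nat \<Rightarrow> nat set set \<Rightarrow> bool" where
  "unlinkable_somewhere n E \<longleftrightarrow> (\<exists>f\<in>PiE {..<l + (m - 1)} (\<lambda>_. {1..n}). inj_on f {..<l + (m - 1)} \<and>
     \<not> linkable s r ({1..n} - f ` {..<l + (m - 1)}) ((`) f ` links (m - 1)) E)"

lemma unlinkable_somewhere_prob: "(\<lambda>n. hprob s n (p n) (unlinkable_somewhere n)) \<longlonglongrightarrow> 0"
  unfolding unlinkable_somewhere_def
proof (rule linkable_whp)
  show "card (links (m - 1)) = q - 1" using card_links qm m by simp
  show "B \<subseteq> {..<l + (m - 1)} \<and> card B = l - r" if "B \<in> links (m - 1)" for B
    by (rule links_mem[OF that])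
qed

text \<open>The neighbours outside \<open>K\<close> form an unordered set. Counting them in order
  would make the first moment bound 1, so the factorial gained here is what makes it useful.\<close>

definition large_core :: "nat \<Rightarrow> nat set set \<Rightarrow> bool" where
  "large_core n E \<longleftrightarrow> (\<exists>f\<in>PiE {..<k} (\<lambda>_. {1..n}). inj_on f {..<k} \<and> (\<forall>h\<in>K. f ` h \<in> E) \<and>
     (\<exists>C\<subseteq>{1..n} - f ` {..<k}. card C = m - (r + 2) \<and> (\<forall>c\<in>C. star s c (f ` {..<l}) \<subseteq> E)))"

text \<open>If A has at least \<open>m\<close> neighbours, those outside the copy of
  \<open>K\<close> supply the set C of \<open>large_core\<close>. Otherwise the neighbourhood is
  padded to exactly m - 1 vertices; this adds sets to link and removes candidates, so A stays
  unlinkable, now over q - 1 sets.\<close>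

lemma unlinked_core_cases:
  assumes E: "E \<subseteq> potential_edges s n" and n: "l + m \<le> n" and u: "unlinked_core n E"
  shows "large_core n E \<or> unlinkable_somewhere n E"
proof -
  from u obtain f where f: "f ` {..<k} \<subseteq> {1..n}" "inj_on f {..<k}" "\<forall>h\<in>K. f ` h \<in> E"
    and nl: "\<not> linkable s r ({1..n} - f ` {..<l} - nbrs s n E (f ` {..<l}))
        ((`) f ` \<X> \<union> (\<lambda>c. insert c (f ` A0)) ` nbrs s n E (f ` {..<l})) E"
    unfolding unlinked_core_def by blast
  define N where "N = nbrs s n E (f ` {..<l})"
  have finN: "finite N" by (simp add: N_def nbrs_def)
  have N: "N \<subseteq> {1..n}" by (auto simp: N_def nbrs_def)
  have lk: "{..<l} \<subseteq> {..<k}" using k by auto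
  have injl: "inj_on f {..<l}" using f(2) lk by (rule inj_on_subset)
  have cl: "card (f ` {..<l}) = l" using injl by (simp add: card_image)
  have Nl: "N \<inter> f ` {..<l} = {}" unfolding N_def
    by (rule nbrs_fresh[OF E]) (use cl s in auto)
  show ?thesis
  proof (cases "m \<le> card N")
    case True
    have Y: "f ` {l..<k} \<subseteq> N"
    proof (rule image_subsetI)
      fix c assume c: "c \<in> {l..<k}"
      then have "star s c {..<l} \<subseteq> K" using starK[of c] by auto
      then have "star s (f c) (f ` {..<l}) \<subseteq> E" unfolding star_image[OF injl] using f(3) by blast
      moreover have "f c \<in> {1..n}" using c f(1) by auto
      ultimately show "f c \<in> N" by (simp add: nbrs_def N_def)
    qed
    have "{l..<k} \<subseteq> {..<k}" by auto
    then have "inj_on f {l..<k}" using f(2) inj_on_subset by blast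
    then have "card (f ` {l..<k}) = r + 2" using k by (simp add: card_image)
    then have "m - (r + 2) \<le> card (N - f ` {l..<k})"
      using True Y finN by (simp add: card_Diff_subset)
    then obtain C where C: "C \<subseteq> N - f ` {l..<k}" "card C = m - (r + 2)" "finite C"
      by (metis obtain_subset_with_card_n)
    have "{..<k} = {..<l} \<union> {l..<k}" using k by auto
    then have fk: "f ` {..<k} = f ` {..<l} \<union> f ` {l..<k}" by (metis image_Un)
    let ?f = "restrict f {..<k}"
    have im: "?f ` S = f ` S" if "S \<subseteq> {..<k}" for S using that by (intro image_cong) auto
    have "?f \<in> PiE {..<k} (\<lambda>_. {1..n})" using f(1) by auto
    moreover have "inj_on ?f {..<k}" using f(2) by (simp add: inj_on_restrict_eq)
    moreover have "\<forall>h\<in>K. ?f ` h \<in> E" using f(3) im K by metis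
    moreover have "C \<subseteq> {1..n} - ?f ` {..<k}" using C N Nl fk im[of "{..<k}"] by auto
    moreover have "\<forall>c\<in>C. star s c (?f ` {..<l}) \<subseteq> E"
      using C(1) unfolding im[OF lk] by (auto simp: N_def nbrs_def)
    ultimately show ?thesis using C(2) unfolding large_core_def by blast
  next
    case False
    have "card N \<le> m - 1" using False by simp
    moreover have "m - 1 \<le> card ({1..n} - f ` {..<l})"
    proof -
      have "f ` {..<l} \<subseteq> {1..n}" by (rule subset_trans[OF image_mono[OF lk] f(1)])
      then have "card ({1..n} - f ` {..<l}) = n - l" using cl by (simp add: card_Diff_subset)
      then show ?thesis using n by simp
    qed
    ultimately obtain C where C: "N \<subseteq> C" "C \<subseteq> {1..n} - f ` {..<l}" "card C = m - 1"
      using exists_subset_between[of N "m - 1" "{1..n} - f ` {..<l}"] N Nl by auto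
    have finC: "finite C" using C(2) finite_subset by blast
    obtain g where g: "bij_betw g {l..<l + (m - 1)} C"
      using finite_same_card_bij[of "{l..<l + (m - 1)}" C] finC C(3) by auto
    define f' where "f' = restrict (\<lambda>i. if i < l then f i else g i) {..<l + (m - 1)}"
    have f'l: "f' ` S = f ` S" if "S \<subseteq> {..<l}" for S
      using that by (intro image_cong) (auto simp: f'_def)
    have f'C: "f' ` {l..<l + (m - 1)} = C"
      using g by (auto simp: f'_def bij_betw_def)
    have split: "{..<l + (m - 1)} = {..<l} \<union> {l..<l + (m - 1)}" by auto
    have im: "f' ` {..<l + (m - 1)} = f ` {..<l} \<union> C"
      unfolding split image_Un f'C using f'l by simp
    have "card (f' ` {..<l + (m - 1)}) = l + (m - 1)"
      unfolding im using C cl finC by (subst card_Un_disjoint) auto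
    then have inj': "inj_on f' {..<l + (m - 1)}" by (intro eq_card_imp_inj_on) auto
    have "f ` {..<l} \<subseteq> {1..n}" by (rule subset_trans[OF image_mono[OF lk] f(1)])
    then have "f' ` {..<l + (m - 1)} \<subseteq> {1..n}" using C(2) unfolding im by blast
    then have f'n: "f' i \<in> {1..n}" if "i \<in> {..<l + (m - 1)}" for i using that by blast
    have f'Pi: "f' \<in> PiE {..<l + (m - 1)} (\<lambda>_. {1..n})"
      by (rule PiE_I[OF f'n]) (simp_all add: f'_def)
    have X: "(`) f' ` \<X> = (`) f ` \<X>" by (rule image_cong[OF refl f'l]) (use \<X> in blast)
    have links: "(`) f' ` links (m - 1) = (`) f ` \<X> \<union> (\<lambda>c. insert c (f ` A0)) ` C"
      unfolding image_links X f'C using f'l[of A0] by auto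
    have "\<not> linkable s r ({1..n} - f' ` {..<l + (m - 1)}) ((`) f' ` links (m - 1)) E"
    proof
      assume "linkable s r ({1..n} - f' ` {..<l + (m - 1)}) ((`) f' ` links (m - 1)) E"
      then have "linkable s r ({1..n} - f ` {..<l} - N) ((`) f ` \<X> \<union> (\<lambda>c. insert c (f ` A0)) ` N) E"
        unfolding im links by (rule linkable_mono) (use C(1) in auto)
      then show False using nl by (simp add: N_def)
    qed
    then show ?thesis using f'Pi inj' unfolding unlinkable_somewhere_def by blast
  qed
qed

text \<open>There are at most n^k n^w / w! pairs (f, C), where w = m - (r + 2). Each requires d q
  edges, and n^(k + w) p^(d q) = 1 because k + w = q + r.\<close>

lemma large_core_prob:
  assumes n: "0 < n"
  shows "hprob s n (p n) (large_core n) \<le> 1 / fact (m - (r + 2))"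
proof -
  define w where "w = m - (r + 2)"
  define P where "P = {f \<in> PiE {..<k} (\<lambda>_. {1..n}). inj_on f {..<k}}"
  define Q where "Q = (SIGMA f:P. {C. C \<subseteq> {1..n} - f ` {..<k} \<and> card C = w})"
  define F :: "(nat \<Rightarrow> nat) \<times> nat set \<Rightarrow> nat set set" where "F = (\<lambda>(f, C). (`) f ` K \<union> (\<Union>c\<in>C. star s c (f ` {..<l})))"
  have p: "0 < p n" "p n \<le> 1" using p_bounds[OF n] by auto
  have finPi: "finite (PiE {..<k} (\<lambda>_. {1..n}))" by (intro finite_PiE) auto
  then have finP: "finite P" by (simp add: P_def)
  have "card P \<le> card (PiE {..<k} (\<lambda>_. {1..n}))"
    by (rule card_mono[OF finPi]) (auto simp: P_def)
  then have cP: "card P \<le> n ^ k" by (simp add: card_PiE)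
  have finCs: "finite {C. C \<subseteq> {1..n} - f ` {..<k} \<and> card C = w}" for f :: "nat \<Rightarrow> nat"
    by (rule finite_subset[of _ "Pow {1..n}"]) auto
  have finQ: "finite Q" unfolding Q_def using finP finCs by blast
  have "card Q = (\<Sum>f\<in>P. card {C. C \<subseteq> {1..n} - f ` {..<k} \<and> card C = w})"
    unfolding Q_def using finP finCs by (intro card_SigmaI) auto
  also have "\<dots> \<le> (\<Sum>f\<in>P. n choose w)"
  proof (rule sum_mono)
    fix f assume "f \<in> P"
    have "card {C. C \<subseteq> {1..n} - f ` {..<k} \<and> card C = w} = card ({1..n} - f ` {..<k}) choose w"
      by (rule n_subsets) simp
    also have "\<dots> \<le> n choose w"
      using card_mono[of "{1..n}" "{1..n} - f ` {..<k}"] by (intro binomial_right_mono) auto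
    finally show "card {C. C \<subseteq> {1..n} - f ` {..<k} \<and> card C = w} \<le> n choose w" .
  qed
  also have "\<dots> \<le> n ^ k * (n choose w)" using cP by simp
  finally have "card Q * fact w \<le> n ^ k * ((n choose w) * fact w)" by simp
  also have "\<dots> \<le> n ^ k * n ^ w" by (intro mult_le_mono2 binomial_fact_pow)
  finally have "card Q * fact w \<le> n ^ (k + w)" by (simp add: power_add)
  then have "real (card Q * fact w) \<le> real (n ^ (k + w))" by (simp only: of_nat_le_iff)
  then have cQ: "real (card Q) \<le> real n ^ (k + w) / fact w" by (simp add: field_simps)
  have prob: "hprob s n (p n) (\<lambda>E. F fC \<subseteq> E) = p n ^ (d * q)" if "fC \<in> Q" for fC
  proof -
    obtain f C where fC: "fC = (f, C)" by (cases fC)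
    have f: "f ` {..<k} \<subseteq> {1..n}" "inj_on f {..<k}" and C: "C \<subseteq> {1..n} - f ` {..<k}" "card C = w"
      using that by (auto simp: fC Q_def P_def)
    have finC: "finite C" using C(1) finite_subset by blast
    have lk: "f ` {..<l} \<subseteq> f ` {..<k}" using k by (intro image_mono) auto
    have "card (f ` {..<l}) = l"
      using f(2) k by (subst card_image) (auto intro: inj_on_subset)
    moreover have "C \<inter> f ` {..<l} = {}" using C(1) lk by fast
    ultimately have cst: "card (\<Union>c\<in>C. star s c (f ` {..<l})) = w * d"
      using C(2) finC by (subst card_stars) (auto simp: d)
    have cK: "card ((`) f ` K) = d * (l + 2)"
      using card_image_image[OF f(2), of K] K cardK by auto
    have "(`) f ` K \<inter> (\<Union>c\<in>C. star s c (f ` {..<l})) = {}"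
    proof (rule equals0I)
      fix e assume "e \<in> (`) f ` K \<inter> (\<Union>c\<in>C. star s c (f ` {..<l}))"
      then obtain h c where h: "h \<in> K" "e = f ` h" "c \<in> C" "c \<in> e" by (auto simp: star_def)
      then have "c \<in> f ` {..<k}" using K[of h] by auto
      then show False using h C by auto
    qed
    then have "card (F fC) = d * (l + 2) + w * d"
      unfolding F_def fC using finite_K finC cK cst
      by (simp add: card_Un_disjoint finite_star)
    also have "\<dots> = d * (l + 2 + w)" by (simp add: algebra_simps)
    also have "l + 2 + w = q" using qm m r by (simp add: w_def)
    finally have card: "card (F fC) = d * q" .
    have "F fC \<subseteq> potential_edges s n"
    proof
      fix e assume "e \<in> F fC"
      then consider h where "h \<in> K" "e = f ` h" | c where "c \<in> C" "e \<in> star s c (f ` {..<l})"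
        by (auto simp: F_def fC)
      then show "e \<in> potential_edges s n"
      proof cases
        case 1
        then show ?thesis using K[of h] f
          by (auto simp: potential_edges_def card_image inj_on_subset)
      next
        case 2
        have "card e = s" by (rule card_mem_star[OF 2(2)]) (use 2(1) C(1) lk s in blast, use s in auto)
        moreover have "e \<subseteq> {1..n}" using mem_star_subset[OF 2(2)] 2(1) C lk f by blast
        ultimately show ?thesis by (simp add: potential_edges_def)
      qed
    qed
    then show ?thesis using hprob_superset[of "p n" "F fC" s n] p card by simp
  qed
  have "hprob s n (p n) (large_core n) \<le> hprob s n (p n) (\<lambda>E. \<exists>fC\<in>Q. F fC \<subseteq> E)"
  proof (rule hprob_mono)
    fix E assume "large_core n E"
    then obtain f C where f: "f \<in> PiE {..<k} (\<lambda>_. {1..n})" "inj_on f {..<k}" "\<forall>h\<in>K. f ` h \<in> E"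
      and C: "C \<subseteq> {1..n} - f ` {..<k}" "card C = m - (r + 2)" "\<forall>c\<in>C. star s c (f ` {..<l}) \<subseteq> E"
      unfolding large_core_def by blast
    have "(f, C) \<in> Q" using f C by (simp add: Q_def P_def w_def)
    moreover have "F (f, C) \<subseteq> E" using f C unfolding F_def by auto
    ultimately show "\<exists>fC\<in>Q. F fC \<subseteq> E" by blast
  qed
  also have "\<dots> \<le> (\<Sum>fC\<in>Q. hprob s n (p n) (\<lambda>E. F fC \<subseteq> E))" by (rule hprob_Bex_le[OF finQ])
  also have "\<dots> = real (card Q) * p n ^ (d * q)" using prob by simp
  also have "\<dots> \<le> real n ^ (k + w) / fact w * p n ^ (d * q)"
    using cQ by (intro mult_right_mono) auto
  also have "\<dots> = (real n ^ (k + w) * p n ^ (d * q)) / fact w" by simp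
  also have "real n ^ (k + w) * p n ^ (d * q) = 1"
  proof -
    have "real (d * q) * crit d r q = real (k + w)"
    proof -
      have "real (d * q) * crit d r q = real q * (real d * crit d r q)" by simp
      also have "\<dots> = real q + real r" unfolding d_crit using q_pos by (simp add: field_simps)
      also have "\<dots> = real (k + w)"
      proof -
        have "q + r = k + w" using qm k m r by (simp add: w_def)
        then show ?thesis by (metis of_nat_add)
      qed
      finally show ?thesis .
    qed
    then have "p n ^ (d * q) = real n powr (- real (k + w))" unfolding p_pow[OF n] by (simp only:)
    then show ?thesis using n by (simp add: powr_minus powr_realpow del: of_nat_add)
  qed
  finally show ?thesis by (simp add: w_def)
qed

lemma unlinked_core_prob_le:
  "eventually (\<lambda>n. hprob s n (p n) (unlinked_core n) \<le> 3 / 4) sequentially"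
proof -
  have "eventually (\<lambda>n. hprob s n (p n) (unlinkable_somewhere n) < 1 / 4) sequentially"
    by (rule order_tendstoD(2)[OF unlinkable_somewhere_prob]) simp
  then show ?thesis using eventually_ge_at_top[of "l + m"]
  proof eventually_elim
    case (elim n)
    have n: "0 < n" using elim r by linarith
    let ?M = "random_hypergraph s n (p n)"
    have "hprob s n (p n) (unlinked_core n)
        \<le> hprob s n (p n) (\<lambda>E. large_core n E \<or> unlinkable_somewhere n E)"
      by (rule hprob_mono) (use unlinked_core_cases elim in blast)
    also have "\<dots> = measure_pmf.prob ?M ({E. large_core n E} \<union> {E. unlinkable_somewhere n E})"
      by (rule arg_cong[where f = "measure_pmf.prob _"]) auto
    also have "\<dots> \<le> hprob s n (p n) (large_core n) + hprob s n (p n) (unlinkable_somewhere n)"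
      by (rule measure_Un_le) auto
    also have "hprob s n (p n) (large_core n) \<le> 1 / 2"
    proof -
      have "(fact 2 :: real) \<le> fact (m - (r + 2))" using m by (intro fact_mono) simp
      then have "1 / fact (m - (r + 2)) \<le> (1 / 2 :: real)" by (simp add: frac_le)
      then show ?thesis using large_core_prob[OF n] by linarith
    qed
    finally show ?case using elim by linarith
  qed
qed

lemma crit_in_spectrum:
  assumes "crit d r q < real s - 1"
  shows "crit d r q \<in> spectrum s unlinked_core"
proof -
  let ?P = "\<lambda>n. prob_property s n (p n) unlinked_core"
  obtain \<eta> where \<eta>: "0 < \<eta>" "eventually (\<lambda>n. \<eta> \<le> ?P n) sequentially"
    using unlinked_core_prob_bounded_below unfolding prob_property_def by blast
  have "\<not> ?P \<longlonglongrightarrow> 0"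
  proof
    assume "?P \<longlonglongrightarrow> 0"
    then have "\<eta> \<le> 0" using \<eta>(2) by (intro tendsto_lowerbound) auto
    then show False using \<eta> by simp
  qed
  moreover have "\<not> ?P \<longlonglongrightarrow> 1"
  proof
    assume "?P \<longlonglongrightarrow> 1"
    then have "1 \<le> (3 / 4 :: real)"
      using unlinked_core_prob_le unfolding prob_property_def by (intro tendsto_upperbound) auto
    then show False by simp
  qed
  moreover have "0 < crit d r q" using d_pos q_pos by (simp add: crit_def add_pos_nonneg)
  ultimately show ?thesis using assms by (simp add: spectrum_def)
qed

end

section \<open>First-order definability\<close>

text \<open>Semantic form of expressibility, so that formulas need not be written out.
  \<open>X\<close> bounds the free variables and \<open>b\<close> the depth; since variables are
  named, independent blocks of quantifiers can reuse the same indices.\<close>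

definition definable ::
  "nat \<Rightarrow> nat \<Rightarrow> nat set \<Rightarrow> (nat \<Rightarrow> nat set set \<Rightarrow> (nat \<Rightarrow> nat) \<Rightarrow> bool) \<Rightarrow> bool" where
  "definable s b X P \<longleftrightarrow> (\<exists>\<phi>. well_formed s \<phi> \<and> free_vars \<phi> \<subseteq> X \<and> quantifier_depth \<phi> \<le> b \<and>
     (\<forall>n E v. sat {1..n} E v \<phi> \<longleftrightarrow> P n E v))"

lemma definableI:
  assumes "well_formed s \<phi>" "free_vars \<phi> \<subseteq> X" "quantifier_depth \<phi> \<le> b"
    "\<And>n E v. sat {1..n} E v \<phi> \<longleftrightarrow> P n E v"
  shows "definable s b X P"
  using assms unfolding definable_def by blast

lemma definable_eq: "x \<in> X \<Longrightarrow> y \<in> X \<Longrightarrow> definable s b X (\<lambda>n E v. v x = v y)"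
  by (rule definableI[of s "Equal x y"]) auto

lemma definable_edge:
  assumes "W \<subseteq> X" "finite W" "card W = s"
  shows "definable s b X (\<lambda>n E v. v ` W \<in> E)"
  by (rule definableI[of s "N (sorted_list_of_set W)"]) (use assms in auto)

lemma definable_not: "definable s b X P \<Longrightarrow> definable s b X (\<lambda>n E v. \<not> P n E v)"
  unfolding definable_def by (elim exE, rule_tac x = "Neg \<phi>" in exI) auto

lemma definable_conj:
  assumes "definable s b X P" "definable s b X Q"
  shows "definable s b X (\<lambda>n E v. P n E v \<and> Q n E v)"
proof -
  from assms obtain \<phi> \<psi> where "well_formed s \<phi>" "free_vars \<phi> \<subseteq> X" "quantifier_depth \<phi> \<le> b"
    "\<And>n E v. sat {1..n} E v \<phi> \<longleftrightarrow> P n E v" "well_formed s \<psi>" "free_vars \<psi> \<subseteq> X" "quantifier_depth \<psi> \<le> b"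
    "\<And>n E v. sat {1..n} E v \<psi> \<longleftrightarrow> Q n E v"
    unfolding definable_def by blast
  then show ?thesis by (intro definableI[of s "Conj \<phi> \<psi>"]) auto
qed

lemma definable_mono: "definable s b X P \<Longrightarrow> X \<subseteq> Y \<Longrightarrow> b \<le> b' \<Longrightarrow> definable s b' Y P"
  unfolding definable_def by (meson order_trans)

text \<open>There is no constant for truth, so an empty conjunction needs a variable in scope.\<close>
lemma definable_ball:
  assumes "finite I" "X \<noteq> {}" "\<And>i. i \<in> I \<Longrightarrow> definable s b X (P i)"
  shows "definable s b X (\<lambda>n E v. \<forall>i\<in>I. P i n E v)"
  using assms(1,3)
proof (induction I rule: finite_induct)
  case empty
  obtain x where "x \<in> X" using assms(2) by blast
  then show ?case using definable_eq[of x X x s b] by simp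
next
  case (insert i I)
  then have "definable s b X (\<lambda>n E v. P i n E v \<and> (\<forall>i\<in>I. P i n E v))"
    by (intro definable_conj) auto
  then show ?case by simp
qed

lemma definable_ex:
  assumes "definable s b (insert x X) P"
  shows "definable s (Suc b) X (\<lambda>n E v. \<exists>a\<in>{1..n}. P n E (v(x := a)))"
proof -
  from assms obtain \<phi> where "well_formed s \<phi>" "free_vars \<phi> \<subseteq> insert x X" "quantifier_depth \<phi> \<le> b"
    "\<And>n E v. sat {1..n} E v \<phi> \<longleftrightarrow> P n E v"
    unfolding definable_def by blast
  then show ?thesis by (intro definableI[of s "Exists x \<phi>"]) auto
qed

text \<open>Gathers j nested quantifiers in one function \<open>w\<close> on the block of indices,
  so that injectivity and images can be discussed as for a placement of vertices. Values of
  \<open>w\<close> off the block are immaterial.\<close>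

lemma definable_ex_block:
  assumes "definable s b (X \<union> {a..<a + j}) P"
  shows "definable s (b + j) X (\<lambda>n E v. \<exists>w. w ` {a..<a + j} \<subseteq> {1..n} \<and>
    P n E (\<lambda>i. if i \<in> {a..<a + j} then w i else v i))"
  using assms
proof (induction j arbitrary: b P)
  case 0
  then show ?case by simp
next
  case (Suc j)
  let ?m = "\<lambda>j w v i. if i \<in> {a..<a + j} then w i else (v i :: nat)"
  have eq: "insert (a + j) (X \<union> {a..<a + j}) = X \<union> {a..<a + Suc j}" by auto
  have upd: "(?m j w v)(a + j := w (a + j)) = ?m (Suc j) w v" for w v
    by (auto simp: fun_eq_iff)
  have "(\<exists>w. w ` {a..<a + j} \<subseteq> {1..n} \<and> (\<exists>c\<in>{1..n}. P n E ((?m j w v)(a + j := c)))) \<longleftrightarrow>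
      (\<exists>w. w ` {a..<a + Suc j} \<subseteq> {1..n} \<and> P n E (?m (Suc j) w v))" (is "?L \<longleftrightarrow> ?R") for n E v
  proof
    assume ?L
    then obtain w c where w: "w ` {a..<a + j} \<subseteq> {1..n}" "c \<in> {1..n}" "P n E ((?m j w v)(a + j := c))"
      by blast
    let ?w = "w(a + j := c)"
    have "?m j ?w v = ?m j w v" by (auto simp: fun_eq_iff)
    then have "P n E (?m (Suc j) ?w v)" using w(3) upd[of ?w v] by simp
    moreover have "?w ` {a..<a + Suc j} \<subseteq> {1..n}"
    proof (rule image_subsetI)
      fix i assume i: "i \<in> {a..<a + Suc j}"
      show "?w i \<in> {1..n}"
      proof (cases "i = a + j")
        case False
        then have "w i \<in> w ` {a..<a + j}" using i by auto
        then show ?thesis using False w(1) by auto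
      qed (use w(2) in simp)
    qed
    ultimately show ?R by blast
  next
    assume ?R
    then obtain w where w: "w ` {a..<a + Suc j} \<subseteq> {1..n}" "P n E (?m (Suc j) w v)" by blast
    have "w ` {a..<a + j} \<subseteq> {1..n}" "w (a + j) \<in> {1..n}" using w(1) by (auto simp: image_subset_iff)
    then show ?L using w(2) upd[of w v] by metis
  qed
  moreover have "definable s (Suc b + j) X (\<lambda>n E v. \<exists>w. w ` {a..<a + j} \<subseteq> {1..n} \<and>
      (\<exists>c\<in>{1..n}. P n E ((?m j w v)(a + j := c))))"
    by (rule Suc.IH[OF definable_ex]) (use Suc.prems eq in simp)
  ultimately show ?case by simp
qed

lemma definable_inj_on:
  assumes "X \<noteq> {}" "finite I" "I \<subseteq> X"
  shows "definable s b X (\<lambda>n E v. inj_on v I)"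
proof -
  have "definable s b X (\<lambda>n E v. \<forall>(i, j)\<in>{(i, j) \<in> I \<times> I. i \<noteq> j}. \<not> v i = v j)"
    unfolding split_def
    by (intro definable_ball definable_not definable_eq) (use assms in auto)
  also have "(\<lambda>n E v. \<forall>(i, j)\<in>{(i, j) \<in> I \<times> I. i \<noteq> j}. \<not> v i = v j)
      = (\<lambda>(n::nat) (E::nat set set) (v :: nat \<Rightarrow> nat). inj_on v I)"
    by (intro ext) (auto simp: inj_on_def)
  finally show ?thesis .
qed

text \<open>The star is formed on variables and then evaluated. It becomes the star over the image
  only for valuations injective on W; otherwise image edges would collapse.\<close>

definition joined :: "nat \<Rightarrow> nat \<Rightarrow> nat set \<Rightarrow> nat set set \<Rightarrow> (nat \<Rightarrow> nat) \<Rightarrow> bool" where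
  "joined s y W E v \<longleftrightarrow> (\<forall>h\<in>star s y W. v ` h \<in> E)"

lemma definable_joined:
  assumes "insert y W \<subseteq> X" "finite W" "y \<notin> W" "1 \<le> s"
  shows "definable s b X (\<lambda>n E v. joined s y W E v)"
  unfolding joined_def
proof (rule definable_ball)
  fix h assume h: "h \<in> star s y W"
  have sub: "h \<subseteq> insert y W" by (rule mem_star_subset[OF h])
  show "definable s b X (\<lambda>n E v. v ` h \<in> E)"
  proof (rule definable_edge)
    show "h \<subseteq> X" using sub assms(1) by blast
    show "finite h" using sub assms(2) finite_subset by blast
    show "card h = s" by (rule card_mem_star[OF h]) (use assms in auto)
  qed
qed (use assms finite_star in auto)

lemma joined_iff: "inj_on v W \<Longrightarrow> joined s y W E v \<longleftrightarrow> star s (v y) (v ` W) \<subseteq> E"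
  unfolding joined_def by (simp add: star_image image_subset_iff)

lemma joined_upd_iff:
  assumes "inj_on v W" "y \<notin> W"
  shows "joined s y W E (v(y := z)) \<longleftrightarrow> star s z (v ` W) \<subseteq> E"
proof -
  have "inj_on (v(y := z)) W" using assms by (auto simp: inj_on_def)
  moreover have "(v(y := z)) ` W = v ` W" using assms(2) by (intro image_cong) auto
  ultimately show ?thesis by (simp add: joined_iff)
qed

section \<open>The sentence and its depth\<close>

context core_params
begin

text \<open>T occupies the variables from \<open>l\<close> to \<open>l + r - 1\<close>. Excluding
  neighbours of A also separates z from a neighbour c that belongs to W, so the distinctness clause
  can stop at \<open>l + r\<close>.\<close>

definition fresh_link :: "nat \<Rightarrow> nat set \<Rightarrow> nat set set \<Rightarrow> (nat \<Rightarrow> nat) \<Rightarrow> bool" where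
  "fresh_link z W E v \<longleftrightarrow>
     (\<forall>i\<in>{..<l + r}. \<not> v z = v i) \<and> \<not> joined s z {..<l} E v \<and> joined s z W E v"

text \<open>The quantifier over c is written as a negated existential to fit the closure rules for
  \<open>definable\<close>. The branch for \<open>\<X>\<close> reuses variable \<open>l + r\<close>
  for its z, so beyond T only two quantifiers are nested.\<close>

definition link_formula :: "nat \<Rightarrow> nat set set \<Rightarrow> (nat \<Rightarrow> nat) \<Rightarrow> bool" where
  "link_formula n E v \<longleftrightarrow> inj_on v {..<l + r} \<and> (\<forall>j\<in>{l..<l + r}. \<not> joined s j {..<l} E v) \<and>
     (\<forall>B\<in>\<X>. \<exists>z\<in>{1..n}. fresh_link (l + r) ({l..<l + r} \<union> B) E (v(l + r := z))) \<and>
     \<not> (\<exists>c\<in>{1..n}. joined s (l + r) {..<l} E (v(l + r := c)) \<and>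
         \<not> (\<exists>z\<in>{1..n}. fresh_link (l + r + 1) (insert (l + r) ({l..<l + r} \<union> A0)) E
              (v(l + r := c, l + r + 1 := z))))"

lemma definable_fresh_link:
  assumes "insert z W \<subseteq> X" "{..<l + r} \<subseteq> X" "finite W" "z \<notin> W" "l + r \<le> z"
  shows "definable s b X (\<lambda>n E v. fresh_link z W E v)"
  unfolding fresh_link_def
  by (intro definable_conj definable_ball definable_not definable_eq definable_joined)
    (use assms s r in auto)

lemma definable_link_formula: "definable s 2 {..<l + r} link_formula"
proof -
  let ?a = "l + r"
  have ne: "{..<?a} \<noteq> {}" using r by auto
  have X: "definable s (Suc 1) {..<?a}
      (\<lambda>n E v. \<forall>B\<in>\<X>. \<exists>z\<in>{1..n}. fresh_link ?a ({l..<?a} \<union> B) E (v(?a := z)))"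
  proof (rule definable_ball[OF finite_\<X> ne], rule definable_ex, rule definable_fresh_link)
    fix B assume "B \<in> \<X>"
    then have "B \<subseteq> {..<l}" using \<X> by blast
    then show "insert ?a ({l..<?a} \<union> B) \<subseteq> insert ?a {..<?a}" "finite ({l..<?a} \<union> B)" "?a \<notin> {l..<?a} \<union> B"
      by (auto intro: finite_subset)
  qed auto
  have C: "definable s (Suc 1) {..<?a} (\<lambda>n E v. \<exists>c\<in>{1..n}. joined s ?a {..<l} E (v(?a := c)) \<and>
         \<not> (\<exists>z\<in>{1..n}. fresh_link (?a + 1) (insert ?a ({l..<?a} \<union> A0)) E (v(?a := c, ?a + 1 := z))))"
    by (intro definable_ex definable_conj definable_not definable_joined
        definable_ex[where b = 0, unfolded One_nat_def[symmetric]] definable_fresh_link)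
      (use s in auto)
  show ?thesis
    unfolding link_formula_def numeral_2_eq_2 One_nat_def[symmetric]
    by (intro definable_conj definable_not X C definable_inj_on[OF ne] definable_ball definable_joined)
      (use s r in auto)
qed

definition core_formula :: "nat \<Rightarrow> nat set set \<Rightarrow> (nat \<Rightarrow> nat) \<Rightarrow> bool" where
  "core_formula n E v \<longleftrightarrow> inj_on v {..<k} \<and> (\<forall>h\<in>K. v ` h \<in> E)"

lemma definable_core_formula: "definable s 0 {..<k} core_formula"
  unfolding core_formula_def
proof (intro definable_conj definable_inj_on definable_ball definable_edge)
  fix h assume "h \<in> K"
  then show "h \<subseteq> {..<k}" "finite h" "card h = s" using K[of h] finite_subset by auto
qed (use k finite_K in auto)

text \<open>After the \<open>l\<close> quantifiers for A two blocks stand side by side: r + 2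
  variables for the rest of \<open>K\<close>, and r variables for T followed by c and z. Each has
  depth r + 2, which exhausts \<open>k\<close>.\<close>

definition sentence_body :: "nat \<Rightarrow> nat set set \<Rightarrow> (nat \<Rightarrow> nat) \<Rightarrow> bool" where
  "sentence_body n E v \<longleftrightarrow>
    (\<exists>y. y ` {l..<l + (r + 2)} \<subseteq> {1..n} \<and>
       core_formula n E (\<lambda>i. if i \<in> {l..<l + (r + 2)} then y i else v i)) \<and>
    \<not> (\<exists>t. t ` {l..<l + r} \<subseteq> {1..n} \<and>
       link_formula n E (\<lambda>i. if i \<in> {l..<l + r} then t i else v i))"

lemma definable_sentence:
  "definable s k {} (\<lambda>n E v. \<exists>a. a ` {0..<0 + l} \<subseteq> {1..n} \<and>
     sentence_body n E (\<lambda>i. if i \<in> {0..<0 + l} then a i else v i))"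
proof -
  have u1: "{0..<l} \<union> {l..<l + (r + 2)} = {..<k}" using k by auto
  have u2: "{0..<l} \<union> {l..<l + r} = {..<l + r}" by auto
  have 1: "definable s (0 + (r + 2)) {0..<l} (\<lambda>n E v. \<exists>y. y ` {l..<l + (r + 2)} \<subseteq> {1..n} \<and>
       core_formula n E (\<lambda>i. if i \<in> {l..<l + (r + 2)} then y i else v i))"
    by (rule definable_ex_block) (simp only: u1 definable_core_formula)
  have 2: "definable s (2 + r) {0..<l} (\<lambda>n E v. \<exists>t. t ` {l..<l + r} \<subseteq> {1..n} \<and>
       link_formula n E (\<lambda>i. if i \<in> {l..<l + r} then t i else v i))"
    by (rule definable_ex_block) (simp only: u2 definable_link_formula)
  have "definable s (r + 2) {0..<l} sentence_body"
    unfolding sentence_body_def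
    by (intro definable_conj definable_not definable_mono[OF 1] definable_mono[OF 2]) auto
  then have "definable s (r + 2) ({} \<union> {0..<0 + l}) sentence_body" by simp
  from definable_ex_block[OF this] show ?thesis
    using k by (simp add: add.commute)
qed

text \<open>Injectivity of the valuation translates \<open>joined\<close> into stars. For the sets
  containing a neighbour c it must remain injective after c is added, which holds because neighbours
  lie outside A and T is already known to avoid them.\<close>

lemma link_formula_iff:
  fixes u :: "nat \<Rightarrow> nat" and n :: nat and E :: "nat set set"
  defines "T \<equiv> u ` {l..<l + r}" and "W \<equiv> u ` {..<l}" and "Nb \<equiv> nbrs s n E (u ` {..<l})"
  assumes E: "E \<subseteq> potential_edges s n" and u: "u ` {..<l + r} \<subseteq> {1..n}" and inj: "inj_on u {..<l + r}"
  shows "link_formula n E u \<longleftrightarrow> T \<inter> Nb = {} \<and>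
    (\<forall>B\<in>(`) u ` \<X> \<union> (\<lambda>c. insert c (u ` A0)) ` Nb. \<exists>z\<in>{1..n} - W - Nb - T. star s z (T \<union> B) \<subseteq> E)"
proof -
  define a where "a = l + r"
  have injl: "inj_on u {..<l}" by (rule inj_on_subset[OF inj]) auto
  have WT: "u ` {..<a} = W \<union> T"
  proof -
    have "{..<a} = {..<l} \<union> {l..<l + r}" by (auto simp: a_def)
    then show ?thesis by (simp only: image_Un W_def T_def)
  qed
  have un: "u j \<in> {1..n}" if "j < a" for j using u that by (auto simp: a_def)
  have NW: "Nb \<inter> W = {}" unfolding Nb_def W_def
    by (rule nbrs_fresh[OF E]) (use injl s in \<open>auto simp: card_image\<close>)
  have joinedT: "joined s j {..<l} E u \<longleftrightarrow> u j \<in> Nb" if "j \<in> {l..<l + r}" for j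
    using un[of j] that joined_iff[OF injl] by (simp add: Nb_def nbrs_def a_def)
  then have TN: "(\<forall>j\<in>{l..<l + r}. \<not> joined s j {..<l} E u) \<longleftrightarrow> T \<inter> Nb = {}"
    by (auto simp: T_def)
  have joineda: "joined s a {..<l} E (u(a := c)) \<longleftrightarrow> c \<in> Nb" if "c \<in> {1..n}" for c
    using joined_upd_iff[OF injl] that by (simp add: Nb_def nbrs_def a_def)
  have linkX: "fresh_link a ({l..<l + r} \<union> B) E (u(a := z)) \<longleftrightarrow>
      z \<notin> W \<union> T \<and> z \<notin> Nb \<and> star s z (T \<union> u ` B) \<subseteq> E"
    if B: "B \<in> \<X>" and z: "z \<in> {1..n}" for B z
  proof -
    have sub: "{l..<l + r} \<union> B \<subseteq> {..<l + r}" using \<X>[OF B] by auto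
    have "inj_on u ({l..<l + r} \<union> B)" by (rule inj_on_subset[OF inj sub])
    moreover have "a \<notin> {l..<l + r} \<union> B" using sub by (auto simp: a_def)
    ultimately have "joined s a ({l..<l + r} \<union> B) E (u(a := z)) \<longleftrightarrow> star s z (T \<union> u ` B) \<subseteq> E"
      by (simp add: joined_upd_iff image_Un T_def)
    moreover have "(\<forall>i\<in>{..<l + r}. \<not> (u(a := z)) a = (u(a := z)) i) \<longleftrightarrow> z \<notin> W \<union> T"
      unfolding WT[symmetric] by (auto simp: a_def)
    ultimately show ?thesis unfolding fresh_link_def using joineda[OF z] by simp
  qed
  have linkC: "fresh_link (a + 1) (insert a ({l..<l + r} \<union> A0)) E (u(a := c, a + 1 := z)) \<longleftrightarrow>
      z \<notin> W \<union> T \<and> z \<notin> Nb \<and> star s z (T \<union> insert c (u ` A0)) \<subseteq> E"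
    if c: "c \<in> Nb" and z: "z \<in> {1..n}" and tn: "T \<inter> Nb = {}" for c z
  proof -
    let ?v = "u(a := c)"
    have vu: "?v ` S = u ` S" if "S \<subseteq> {..<a}" for S using that by (intro image_cong) auto
    have sub: "{l..<l + r} \<union> A0 \<subseteq> {..<a}" "{..<l} \<subseteq> {..<a}" by (auto simp: a_def)
    have "c \<notin> u ` {..<a}" unfolding WT using c NW tn by blast
    then have cS: "c \<notin> u ` ({l..<l + r} \<union> A0)" using sub(1) by blast
    have aS: "a \<notin> {l..<l + r} \<union> A0" using sub(1) by blast
    have injS: "inj_on ?v S" if "S \<subseteq> {..<a}" for S
    proof -
      have "inj_on u S" using inj that unfolding a_def by (rule inj_on_subset)
      then show ?thesis using that by (auto simp: inj_on_def)
    qed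
    have inj1: "inj_on ?v (insert a ({l..<l + r} \<union> A0))"
      using injS[OF sub(1)] aS cS vu[OF sub(1)] by (simp add: inj_on_insert)
    have im1: "?v ` insert a ({l..<l + r} \<union> A0) = T \<union> insert c (u ` A0)"
      unfolding image_insert vu[OF sub(1)] fun_upd_same by (simp add: image_Un T_def)
    have "joined s (a + 1) (insert a ({l..<l + r} \<union> A0)) E (?v(a + 1 := z)) \<longleftrightarrow>
        star s z (T \<union> insert c (u ` A0)) \<subseteq> E"
    proof -
      have "a + 1 \<notin> insert a ({l..<l + r} \<union> A0)" by (auto simp: a_def)
      from joined_upd_iff[OF inj1 this, of s E z] show ?thesis unfolding im1 .
    qed
    moreover have "joined s (a + 1) {..<l} E (?v(a + 1 := z)) \<longleftrightarrow> z \<in> Nb"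
      using joined_upd_iff[OF injS[OF sub(2)], of "a + 1"] vu[OF sub(2)] z
      by (simp add: Nb_def nbrs_def a_def)
    moreover have "(\<forall>i\<in>{..<l + r}. \<not> (?v(a + 1 := z)) (a + 1) = (?v(a + 1 := z)) i) \<longleftrightarrow> z \<notin> W \<union> T"
      unfolding WT[symmetric] by (auto simp: a_def)
    ultimately show ?thesis unfolding fresh_link_def by simp
  qed
  have "link_formula n E u \<longleftrightarrow> T \<inter> Nb = {} \<and>
      (\<forall>B\<in>\<X>. \<exists>z\<in>{1..n}. fresh_link a ({l..<l + r} \<union> B) E (u(a := z))) \<and>
      (\<forall>c\<in>{1..n}. joined s a {..<l} E (u(a := c)) \<longrightarrow>
         (\<exists>z\<in>{1..n}. fresh_link (a + 1) (insert a ({l..<l + r} \<union> A0)) E (u(a := c, a + 1 := z))))"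
    unfolding link_formula_def TN[symmetric] a_def using inj by blast
  also have "\<dots> \<longleftrightarrow> T \<inter> Nb = {} \<and>
      (\<forall>B\<in>\<X>. \<exists>z\<in>{1..n}. z \<notin> W \<union> T \<and> z \<notin> Nb \<and> star s z (T \<union> u ` B) \<subseteq> E) \<and>
      (\<forall>c\<in>{1..n}. c \<in> Nb \<longrightarrow>
         (\<exists>z\<in>{1..n}. z \<notin> W \<union> T \<and> z \<notin> Nb \<and> star s z (T \<union> insert c (u ` A0)) \<subseteq> E))"
    \<comment> \<open>\<open>conj_cong\<close> hands T \<inter> Nb = {} from the first conjunct to
      \<open>linkC\<close>.\<close>
    by (intro conj_cong refl ball_cong bex_cong imp_cong linkX joineda linkC)
  also have "\<dots> \<longleftrightarrow> T \<inter> Nb = {} \<and>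
      (\<forall>B\<in>\<X>. \<exists>z\<in>{1..n} - W - Nb - T. star s z (T \<union> u ` B) \<subseteq> E) \<and>
      (\<forall>c\<in>Nb. \<exists>z\<in>{1..n} - W - Nb - T. star s z (T \<union> insert c (u ` A0)) \<subseteq> E)"
  proof -
    have bex: "(\<exists>z\<in>{1..n}. z \<notin> W \<union> T \<and> z \<notin> Nb \<and> Q z) \<longleftrightarrow> (\<exists>z\<in>{1..n} - W - Nb - T. Q z)" for Q
      by blast
    have "Nb \<subseteq> {1..n}" by (auto simp: Nb_def nbrs_def)
    then have ball: "(\<forall>c\<in>{1..n}. c \<in> Nb \<longrightarrow> Q c) \<longleftrightarrow> (\<forall>c\<in>Nb. Q c)" for Q by blast
    show ?thesis unfolding bex ball ..
  qed
  also have "\<dots> \<longleftrightarrow> T \<inter> Nb = {} \<and>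
    (\<forall>B\<in>(`) u ` \<X> \<union> (\<lambda>c. insert c (u ` A0)) ` Nb. \<exists>z\<in>{1..n} - W - Nb - T. star s z (T \<union> B) \<subseteq> E)"
    by (simp only: ball_Un ball_simps)
  finally show ?thesis .
qed

lemma link_formula_ex_iff:
  fixes v :: "nat \<Rightarrow> nat" and n :: nat and E :: "nat set set"
  defines "Nb \<equiv> nbrs s n E (v ` {..<l})"
  assumes E: "E \<subseteq> potential_edges s n" and v: "v ` {..<l} \<subseteq> {1..n}" and inj: "inj_on v {..<l}"
  shows "(\<exists>t. t ` {l..<l + r} \<subseteq> {1..n} \<and> link_formula n E (\<lambda>i. if i \<in> {l..<l + r} then t i else v i))
    \<longleftrightarrow> linkable s r ({1..n} - v ` {..<l} - Nb) ((`) v ` \<X> \<union> (\<lambda>c. insert c (v ` A0)) ` Nb) E"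
    (is "(\<exists>t. ?Q t) \<longleftrightarrow> ?R")
proof -
  let ?u = "\<lambda>t i. if i \<in> {l..<l + r} then t i else v i"
  let ?U = "{1..n} - v ` {..<l} - Nb"
  let ?\<B> = "(`) v ` \<X> \<union> (\<lambda>c. insert c (v ` A0)) ` Nb"
  have ul: "?u t ` S = v ` S" if "S \<subseteq> {..<l}" for t S using that by (intro image_cong) auto
  have ut: "?u t ` {l..<l + r} = t ` {l..<l + r}" for t by (intro image_cong) auto
  have split: "{..<l + r} = {..<l} \<union> {l..<l + r}" by auto
  have uim: "?u t ` {..<l + r} = v ` {..<l} \<union> t ` {l..<l + r}" for t
    unfolding split image_Un ut using ul[of "{..<l}"] by simp
  have uX: "(`) (?u t) ` \<X> = (`) v ` \<X>" for t
    by (rule image_cong[OF refl ul]) (use \<X> in blast)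
  have uA: "?u t ` A0 = v ` A0" for t by (rule ul) auto
  have key: "link_formula n E (?u t) \<longleftrightarrow> t ` {l..<l + r} \<inter> Nb = {} \<and>
      (\<forall>B\<in>?\<B>. \<exists>z\<in>?U - t ` {l..<l + r}. star s z (t ` {l..<l + r} \<union> B) \<subseteq> E)"
    if "t ` {l..<l + r} \<subseteq> {1..n}" "inj_on (?u t) {..<l + r}" for t
  proof -
    have "?u t ` {..<l + r} \<subseteq> {1..n}" unfolding uim using that(1) v by (rule Un_least[rotated])
    from link_formula_iff[OF E this that(2)] show ?thesis
      unfolding ut uX uA ul[OF order_refl] Nb_def .
  qed
  show ?thesis
  proof
    assume "\<exists>t. ?Q t"
    then obtain t where t: "t ` {l..<l + r} \<subseteq> {1..n}" and lf: "link_formula n E (?u t)" by blast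
    let ?T = "t ` {l..<l + r}"
    have inju: "inj_on (?u t) {..<l + r}" using lf by (simp add: link_formula_def)
    have "inj_on (?u t) {l..<l + r}" using inju by (rule inj_on_subset) auto
    then have "card ?T = r" using card_image[of "?u t" "{l..<l + r}"] unfolding ut by simp
    moreover have "?T \<inter> v ` {..<l} = {}"
    proof -
      have "?u t ` ({l..<l + r} \<inter> {..<l}) = ?u t ` {l..<l + r} \<inter> ?u t ` {..<l}"
        by (rule inj_on_image_Int[OF inju]) auto
      moreover have "{l..<l + r} \<inter> {..<l} = {}" by auto
      ultimately show ?thesis unfolding ut ul[OF order_refl] by (simp only: image_empty)
    qed
    moreover note key[OF t inju] lf
    ultimately have T: "?T \<subseteq> ?U" "card ?T = r"
      and z: "\<forall>B\<in>?\<B>. \<exists>z\<in>?U - ?T. star s z (?T \<union> B) \<subseteq> E" using t by blast+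
    show ?R unfolding linkable_def by (rule exI[of _ ?T]) (use T z in simp)
  next
    assume ?R
    then obtain T where T: "T \<subseteq> ?U" "card T = r"
      and z: "\<forall>B\<in>?\<B>. \<exists>z\<in>?U - T. star s z (T \<union> B) \<subseteq> E" unfolding linkable_def by blast
    have finT: "finite T" using T(1) finite_subset by blast
    obtain t where t: "bij_betw t {l..<l + r} T"
      using finite_same_card_bij[of "{l..<l + r}" T] finT T(2) by auto
    have tT: "t ` {l..<l + r} = T" using t by (simp add: bij_betw_def)
    have "card (?u t ` {..<l + r}) = l + r"
      unfolding uim tT using inj T finT by (subst card_Un_disjoint) (auto simp: card_image)
    then have inju: "inj_on (?u t) {..<l + r}" by (intro eq_card_imp_inj_on) auto
    have tn: "t ` {l..<l + r} \<subseteq> {1..n}" unfolding tT using T(1) by blast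
    have "link_formula n E (?u t)" unfolding key[OF tn inju] tT using z T(1) by blast
    then show "\<exists>t. ?Q t" using tn by blast
  qed
qed

lemma unlinked_core_iff:
  assumes E: "E \<subseteq> potential_edges s n"
  shows "unlinked_core n E \<longleftrightarrow> (\<exists>a. a ` {0..<0 + l} \<subseteq> {1..n} \<and>
     sentence_body n E (\<lambda>i. if i \<in> {0..<0 + l} then a i else v i))"
    (is "_ \<longleftrightarrow> (\<exists>a. ?Q a)")
proof -
  let ?L = "\<lambda>f. linkable s r ({1..n} - f ` {..<l} - nbrs s n E (f ` {..<l}))
        ((`) f ` \<X> \<union> (\<lambda>c. insert c (f ` A0)) ` nbrs s n E (f ` {..<l})) E"
  have L_cong: "?L f \<longleftrightarrow> ?L g" if "\<And>i. i < l \<Longrightarrow> f i = g i" for f g :: "nat \<Rightarrow> nat"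
  proof -
    have im: "f ` S = g ` S" if "S \<subseteq> {..<l}" for S
      using that \<open>\<And>i. i < l \<Longrightarrow> f i = g i\<close> by (intro image_cong) auto
    have "(`) f ` \<X> = (`) g ` \<X>" by (rule image_cong[OF refl im]) (use \<X> in blast)
    moreover have "f ` A0 = g ` A0" by (rule im) auto
    ultimately show ?thesis using im[OF order_refl] by simp
  qed
  have kl: "l + (r + 2) = k" using k by simp
  have lk: "{..<l} \<subseteq> {..<k}" using k by auto
  show ?thesis
  proof
    assume "unlinked_core n E"
    then obtain f where f: "f ` {..<k} \<subseteq> {1..n}" "inj_on f {..<k}" "\<forall>h\<in>K. f ` h \<in> E" "\<not> ?L f"
      unfolding unlinked_core_def by blast
    let ?v = "\<lambda>i. if i \<in> {0..<0 + l} then f i else v i"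
    have v: "?v ` {..<l} = f ` {..<l}" by (intro image_cong) auto
    have fl: "f ` {..<l} \<subseteq> {1..n}" by (rule subset_trans[OF image_mono[OF lk] f(1)])
    have "inj_on f {..<l}" using f(2) lk by (rule inj_on_subset)
    then have vinj: "inj_on ?v {..<l}" by (auto simp: inj_on_def)
    let ?w = "\<lambda>i. if i \<in> {l..<l + (r + 2)} then f i else ?v i"
    have wf: "?w i = f i" if "i < k" for i using that kl by auto
    have "inj_on ?w {..<k}" using f(2) wf by (auto simp: inj_on_def)
    moreover have "?w ` h = f ` h" if "h \<in> K" for h
    proof (rule image_cong[OF refl wf])
      show "i < k" if "i \<in> h" for i using K[OF \<open>h \<in> K\<close>] that by auto
    qed
    ultimately have "core_formula n E ?w" using f(3) by (simp add: core_formula_def)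
    moreover have "f ` {l..<l + (r + 2)} \<subseteq> {1..n}"
      by (rule subset_trans[OF image_mono f(1)]) (auto simp: k)
    moreover have "\<not> ?L ?v" using f(4) L_cong[of f ?v] by simp
    then have "\<not> (\<exists>t. t ` {l..<l + r} \<subseteq> {1..n} \<and>
        link_formula n E (\<lambda>i. if i \<in> {l..<l + r} then t i else ?v i))"
      using link_formula_ex_iff[OF E _ vinj] fl v by simp
    ultimately have "sentence_body n E ?v" unfolding sentence_body_def by blast
    moreover have "f ` {0..<0 + l} \<subseteq> {1..n}" using fl by (simp add: atLeast0LessThan)
    ultimately show "\<exists>a. ?Q a" by blast
  next
    assume "\<exists>a. ?Q a"
    then obtain a where a: "a ` {0..<0 + l} \<subseteq> {1..n}"
      and body: "sentence_body n E (\<lambda>i. if i \<in> {0..<0 + l} then a i else v i)" by blast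
    let ?v = "\<lambda>i. if i \<in> {0..<0 + l} then a i else v i"
    obtain y where y: "y ` {l..<l + (r + 2)} \<subseteq> {1..n}"
      and core: "core_formula n E (\<lambda>i. if i \<in> {l..<l + (r + 2)} then y i else ?v i)"
      using body unfolding sentence_body_def by blast
    let ?w = "\<lambda>i. if i \<in> {l..<l + (r + 2)} then y i else ?v i"
    have wv: "?w i = ?v i" if "i < l" for i using that by simp
    have vl: "?v ` {..<l} \<subseteq> {1..n}" using a by (auto simp: image_subset_iff)
    have winj: "inj_on ?w {..<k}" and wK: "\<forall>h\<in>K. ?w ` h \<in> E" using core by (auto simp: core_formula_def)
    have "inj_on ?w {..<l}" using winj lk by (rule inj_on_subset)
    then have vinj: "inj_on ?v {..<l}" by (auto simp: inj_on_def)
    have "?w ` {..<k} \<subseteq> {1..n}"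
    proof (rule image_subsetI)
      fix i assume "i \<in> {..<k}"
      then consider "i < l" | "i \<in> {l..<l + (r + 2)}" using kl by fastforce
      then show "?w i \<in> {1..n}"
      proof cases
        case 1
        then show ?thesis using vl wv[OF 1] by (auto simp: image_subset_iff)
      next
        case 2
        then show ?thesis using y by (auto simp: image_subset_iff)
      qed
    qed
    moreover have "\<not> ?L ?v"
      using body link_formula_ex_iff[OF E vl vinj] unfolding sentence_body_def by blast
    then have "\<not> ?L ?w" using L_cong[of ?w ?v, OF wv] by blast
    ultimately show "unlinked_core n E" using winj wK unfolding unlinked_core_def by blast
  qed
qed

lemma expressible_unlinked_core: "expressible s k unlinked_core"
proof -
  from definable_sentence obtain \<phi> where \<phi>: "well_formed s \<phi>" "free_vars \<phi> = {}" "quantifier_depth \<phi> \<le> k"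
    "\<And>n E v. sat {1..n} E v \<phi> \<longleftrightarrow> (\<exists>a. a ` {0..<0 + l} \<subseteq> {1..n} \<and>
     sentence_body n E (\<lambda>i. if i \<in> {0..<0 + l} then a i else v i))"
    unfolding definable_def by blast
  have "unlinked_core n E = property_of \<phi> n E" if "E \<subseteq> potential_edges s n" for n E
    unfolding property_of_def \<phi>(4) by (rule unlinked_core_iff[OF that])
  then show ?thesis unfolding expressible_def using \<phi>(1-3) by blast
qed

end

section \<open>The limit point\<close>

lemma binomial_succ_mult: "(n - k) * (n choose k) = Suc k * (n choose Suc k)" if "k \<le> n"
proof -
  have "Suc n * (n choose k) = Suc k * ((n choose k) + (n choose Suc k))"
    using Suc_times_binomial_eq[of n k] by (simp add: mult.commute)
  moreover have "Suc n = (n - k) + Suc k" using that by simp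
  ultimately have "((n - k) + Suc k) * (n choose k) = Suc k * (n choose k) + Suc k * (n choose Suc k)"
    by (simp only: distrib_left)
  then show ?thesis by (simp only: distrib_right)
qed

text \<open>The last two bounds say 1 <= r < l for r = k - l - 2: T is nonempty, and the sets to be
  linked contain at least one vertex.\<close>

lemma l_max_bounds:
  fixes s k :: nat
  assumes sk: "(s = 2 \<and> k \<ge> 5) \<or> (s \<ge> 3 \<and> k \<ge> s + 2)"
  defines "l \<equiv> l_max s k"
  shows "s - 1 \<le> l" "2 \<le> l" "(l choose (s - 1)) * (l + 2) \<le> k choose s" "l + 3 \<le> k" "k \<le> 2 * l + 1"
proof -
  define S where "S = {l. 1 \<le> l \<and> (l choose (s - 1)) * (l + 2) \<le> k choose s}"
  have l: "l = Max S" by (simp add: l_def l_max_def S_def)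
  have "S \<subseteq> {..max s (k choose s)}"
  proof
    fix i assume i: "i \<in> S"
    show "i \<in> {..max s (k choose s)}"
    proof (cases "i \<le> s")
      case False
      then have "1 \<le> i choose (s - 1)" by (simp add: Suc_leI zero_less_binomial_iff)
      then have "1 * (i + 2) \<le> (i choose (s - 1)) * (i + 2)" by (rule mult_le_mono1)
      also have "\<dots> \<le> k choose s" using i by (simp add: S_def)
      finally show ?thesis by simp
    qed simp
  qed
  then have fin: "finite S" using finite_subset by blast
  \<comment> \<open>For s = 2 the value 2 qualifies since 2 * 4 <= 10 = 5 choose 2; for s >= 3 the
    value s - 1 does since 1 * (s + 1) = (s + 1) choose s.\<close>
  have l0: "(if s = 2 then 2 else s - 1) \<in> S"
  proof (cases "s = 2")
    case True
    then have "5 choose 2 \<le> k choose 2" using sk by (intro binomial_right_mono) auto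
    then show ?thesis using True by (simp add: S_def choose_two)
  next
    case False
    then have "s + 1 choose s \<le> k choose s" using sk by (intro binomial_right_mono) auto
    moreover have "s + 1 choose s = s + 1" by simp
    moreover have "1 \<le> s - 1" "s - 1 + 2 = s + 1" using False sk by linarith+
    ultimately show ?thesis using False by (simp add: S_def)
  qed
  have lS: "l \<in> S" unfolding l using fin l0 by (intro Max_in) auto
  have ge: "(if s = 2 then 2 else s - 1) \<le> l" unfolding l using fin l0 by (rule Max_ge)
  show sl: "s - 1 \<le> l" and l2: "2 \<le> l" using ge sk by (auto split: if_splits)
  show dl: "(l choose (s - 1)) * (l + 2) \<le> k choose s" using lS by (simp add: S_def)
  have "l + 1 \<notin> S" using Max_ge[OF fin, of "l + 1"] l by auto
  then have "\<not> (l + 1 choose (s - 1)) * (l + 1 + 2) \<le> k choose s"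
    unfolding S_def mem_Collect_eq by linarith
  moreover have "l + 1 + 2 = l + 3" by simp
  ultimately have up: "k choose s < (l + 1 choose (s - 1)) * (l + 3)" by (simp only: not_le)
  show "l + 3 \<le> k"
  proof (rule ccontr)
    assume "\<not> l + 3 \<le> k"
    then have kl: "k \<le> l + 2" by simp
    then have sl': "s \<le> l" using sk ge by (auto split: if_splits)
    have s2: "2 \<le> s" using sk by auto
    \<comment> \<open>With k <= l + 2, absorption and \<open>dl\<close> would give s (l choose (s -
      1)) <= (l + 1) choose (s - 1), hence (s - 1) (l choose (s - 1)) <= l choose (s - 2) by Pascal.
      But the left side equals (l - s + 2) (l choose (s - 2)), at least twice the right.\<close>
    have "(l - (s - 2)) * (l choose (s - 2)) = (s - 1) * (l choose (s - 1))"
    proof -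
      have "Suc (s - 2) = s - 1" using s2 by simp
      moreover have "s - 2 \<le> l" using sl' by simp
      ultimately show ?thesis using binomial_succ_mult[of "s - 2" l] by simp
    qed
    moreover have "2 * (l choose (s - 2)) \<le> (l - (s - 2)) * (l choose (s - 2))"
      using sl' s2 by (intro mult_le_mono1) simp
    moreover have "0 < l choose (s - 2)" using sl' by (simp add: zero_less_binomial_iff)
    ultimately have "l choose (s - 2) < (s - 1) * (l choose (s - 1))" by linarith
    moreover have "l + 1 choose (s - 1) = (l choose (s - 2)) + (l choose (s - 1))"
    proof -
      have "s - 1 = Suc (s - 2)" using s2 by simp
      then show ?thesis by simp
    qed
    moreover have "s * (l choose (s - 1)) = (s - 1) * (l choose (s - 1)) + (l choose (s - 1))"
    proof -
      have "s = s - 1 + 1" using s2 by simp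
      then show ?thesis by (metis add_mult_distrib mult_1)
    qed
    ultimately have "l + 1 choose (s - 1) < s * (l choose (s - 1))" by linarith
    then have "(l + 2) * (l + 1 choose (s - 1)) < (l + 2) * (s * (l choose (s - 1)))"
      by (intro mult_strict_left_mono) auto
    moreover have "s * (l + 2 choose s) = (l + 2) * (l + 1 choose (s - 1))"
      using times_binomial_minus1_eq[of s "l + 2"] s2 by simp
    moreover have "s * (k choose s) \<le> s * (l + 2 choose s)"
      using kl by (intro mult_le_mono2 binomial_right_mono)
    moreover have "(l + 2) * (s * (l choose (s - 1))) \<le> s * (k choose s)"
      using mult_le_mono2[OF dl, of s] by (simp add: mult_ac)
    ultimately show False by linarith
  qed
  show "k \<le> 2 * l + 1"
  proof (rule ccontr)
    assume "\<not> k \<le> 2 * l + 1"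
    then have "(l + 1) + (l + 1) choose s \<le> k choose s" by (intro binomial_right_mono) simp
    \<comment> \<open>Contradicts the maximality of \<open>l\<close> in \<open>up\<close>.
      Vandermonde's terms for i = 1 and i = s - 1 already give 2 (l + 1) ((l + 1) choose (s - 1));
      they coincide for s = 2, which is computed directly.\<close>
    moreover have "(l + 1 choose (s - 1)) * (l + 3) \<le> (l + 1) + (l + 1) choose s"
    proof (cases "s = 2")
      case True
      have "2 * ((l + 1) + (l + 1) choose 2) = ((l + 1) + (l + 1)) * ((l + 1) + (l + 1) - 1)"
        using times_binomial_minus1_eq[of 2 "(l + 1) + (l + 1)"] by simp
      also have "\<dots> = 2 * ((l + 1) * (2 * l + 1))" by (simp add: algebra_simps)
      finally have "(l + 1) + (l + 1) choose 2 = (l + 1) * (2 * l + 1)" by linarith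
      moreover have "(l + 1) * (l + 3) \<le> (l + 1) * (2 * l + 1)" using l2 by (intro mult_le_mono2) simp
      ultimately show ?thesis using True by simp
    next
      case False
      then have s3: "3 \<le> s" using sk by auto
      let ?f = "\<lambda>i. (l + 1 choose i) * (l + 1 choose (s - i))"
      have "(l + 1 choose (s - 1)) * (l + 3) \<le> (l + 1 choose (s - 1)) * ((l + 1) + (l + 1))"
        using l2 by (intro mult_le_mono2) simp
      also have "\<dots> = sum ?f {1, s - 1}" using s3 by (simp add: algebra_simps)
      also have "\<dots> \<le> sum ?f {..s}" using s3 by (intro sum_mono2) auto
      also have "\<dots> = (l + 1) + (l + 1) choose s" by (rule vandermonde)
      finally show ?thesis .
    qed
    ultimately show False using up by linarith
  qed
qed

lemma crit_in_spectrum_depth: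
  fixes s l r k :: nat
  assumes s: "2 \<le> s" "s - 1 \<le> l" and r: "1 \<le> r" "r < l" and k: "k = l + r + 2"
    and choose: "(l choose (s - 1)) * (l + 2) \<le> k choose s"
  shows "eventually (\<lambda>q. crit (l choose (s - 1)) r q \<in> spectrum_depth s k) sequentially"
proof -
  define d where "d = l choose (s - 1)"
  have d0: "0 < d" using s by (simp add: d_def zero_less_binomial_iff)
  define A where "A = (\<Union>y\<in>{l..<k}. star s y {..<l})"
  define C where "C = {h. h \<subseteq> {..<k} \<and> card h = s}"
  have finC: "finite C" by (simp add: C_def)
  have "A \<subseteq> C"
  proof
    fix h assume "h \<in> A"
    then obtain y where y: "y \<in> {l..<k}" "h \<in> star s y {..<l}" by (auto simp: A_def)
    have "card h = s" by (rule card_mem_star[OF y(2)]) (use y s in auto)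
    moreover have "h \<subseteq> {..<k}" using mem_star_subset[OF y(2)] y(1) by auto
    ultimately show "h \<in> C" by (simp add: C_def)
  qed
  moreover have "card A \<le> d * (l + 2)"
  proof -
    have "card A \<le> (\<Sum>y\<in>{l..<k}. card (star s y {..<l}))"
      unfolding A_def by (rule card_UN_le) simp
    also have "\<dots> \<le> (\<Sum>y\<in>{l..<k}. d)"
      using card_star_le[of "{..<l}"] by (intro sum_mono) (simp add: d_def)
    also have "\<dots> \<le> d * (l + 2)" using k r by (simp add: mult.commute)
    finally show ?thesis .
  qed
  moreover have "d * (l + 2) \<le> card C"
    using choose n_subsets[of "{..<k}" s] by (simp add: C_def d_def)
  \<comment> \<open>Any edge set of the right size between the r + 2 stars and the complete
    hypergraph on \<open>k\<close> vertices will do; the defining inequality of l(k) leaves room for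
    it.\<close>
  ultimately obtain K where K: "A \<subseteq> K" "K \<subseteq> C" "card K = d * (l + 2)"
    using exists_subset_between[of A "d * (l + 2)" C] finC by blast
  \<comment> \<open>A ground set of l - r + 1 elements has l - r + 1 subsets of size l - r, one more
    than required, and r >= 1 places it inside A.\<close>
  have "card {B. B \<subseteq> {..<Suc (l - r)} \<and> card B = l - r} = Suc (l - r)"
    using n_subsets[of "{..<Suc (l - r)}" "l - r"] by simp
  then have "l - r \<le> card {B. B \<subseteq> {..<Suc (l - r)} \<and> card B = l - r}" by linarith
  then obtain \<X> where \<X>: "\<X> \<subseteq> {B. B \<subseteq> {..<Suc (l - r)} \<and> card B = l - r}" "card \<X> = l - r"
    by (rule obtain_subset_with_card_n)
  have sub: "{..<Suc (l - r)} \<subseteq> {..<l}" using r by auto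
  have \<X>l: "B \<subseteq> {..<l} \<and> card B = l - r" if "B \<in> \<X>" for B
  proof -
    have "B \<subseteq> {..<Suc (l - r)}" "card B = l - r" using subsetD[OF \<X>(1) that] by simp_all
    then show ?thesis using subset_trans[OF _ sub] by simp
  qed
  have "crit d r q \<in> spectrum_depth s k"
    if q: "2 * r * d + r * d * k + r * d * (l + 1) + l + 5 \<le> q" for q
  proof -
    interpret C: core_params s l r d q k "q - (l - r)" K \<X>
    proof unfold_locales
      show "star s y {..<l} \<subseteq> K" if "l \<le> y" "y < k" for y
      proof -
        have "star s y {..<l} \<subseteq> A" unfolding A_def by (rule UN_upper) (use that in simp)
        then show ?thesis using K(1) by (rule subset_trans)
      qed
      show "h \<subseteq> {..<k} \<and> card h = s" if "h \<in> K" for h using K(2) that by (auto simp: C_def)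
      show "q = q - (l - r) + (l - r)" "r + 4 \<le> q - (l - r)" using q r by linarith+
      show "2 * r * d < q" "r * d * k \<le> q" "r * d * (l + 1) < q" using q by linarith+
    qed (use s r d_def k K(3) \<X>(2) \<X>l in auto)
    \<comment> \<open>The numerator is below 2 as r < q. This suffices for s >= 3; for s = 2 the
      denominator is d = l >= 2.\<close>
    have "crit d r q < real s - 1"
    proof -
      have "r * 1 \<le> r * d" using d0 by (intro mult_le_mono2) simp
      then have "r < q" using q by linarith
      define y where "y = 1 + real r / real q"
      have y: "0 \<le> y" "y < 2" "crit d r q = y / real d"
        using \<open>r < q\<close> by (simp_all add: y_def crit_def)
      show ?thesis
      proof (cases "s = 2")
        case True
        then have "2 \<le> d" using r by (simp add: d_def)
        then have "y / real d \<le> y / 2" using y by (intro divide_left_mono) auto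
        moreover have "real s - 1 = 1" using True by simp
        ultimately show ?thesis using y by linarith
      next
        case False
        have "y / real d \<le> y / 1" using d0 y by (intro divide_left_mono) auto
        moreover have "3 \<le> s" using False s by linarith
        then have "2 \<le> real s - 1" by linarith
        ultimately show ?thesis using y by linarith
      qed
    qed
    then show ?thesis
      using C.crit_in_spectrum C.expressible_unlinked_core by (auto simp: spectrum_depth_def)
  qed
  then show ?thesis unfolding d_def[symmetric] by (rule eventually_sequentiallyI)
qed

theorem theorem11:
  fixes s k :: nat
  assumes "(s = 2 \<and> k \<ge> 5) \<or> (s \<ge> 3 \<and> k \<ge> s + 2)"
  shows "(1 / real (l_max s k choose (s - 1))) islimpt spectrum_depth s k"
proof -
  define l where "l = l_max s k"
  define r where "r = k - l - 2"
  define d where "d = l choose (s - 1)"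
  note b = l_max_bounds[OF assms, folded l_def]
  have s: "2 \<le> s" using assms by auto
  have d0: "0 < d" using b(1) by (simp add: d_def zero_less_binomial_iff)
  have r: "1 \<le> r" "r < l" "k = l + r + 2" using b by (auto simp: r_def)
  have mem: "eventually (\<lambda>q. crit d r q \<in> spectrum_depth s k) sequentially"
    unfolding d_def by (rule crit_in_spectrum_depth[OF s b(1) r b(3)])
  have ne: "eventually (\<lambda>q. crit d r q \<noteq> 1 / real d) sequentially"
    using eventually_gt_at_top[of 0]
  proof eventually_elim
    case (elim q)
    then show ?case using d0 r(1) by (simp add: crit_def)
  qed
  have "(\<lambda>q. crit d r q) \<longlonglongrightarrow> (1 + 0) / real d"
    unfolding crit_def using d0 by (intro tendsto_intros lim_const_over_n) auto
  then have lim: "(\<lambda>q. crit d r q) \<longlonglongrightarrow> 1 / real d" by simp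
  have "1 / real d islimpt spectrum_depth s k"
    unfolding islimpt_approachable
  proof (intro allI impI)
    fix e :: real assume "0 < e"
    then have "eventually (\<lambda>q. dist (crit d r q) (1 / real d) < e) sequentially"
      by (rule tendstoD[OF lim])
    with mem ne have "eventually (\<lambda>q. crit d r q \<in> spectrum_depth s k \<and> crit d r q \<noteq> 1 / real d \<and>
        dist (crit d r q) (1 / real d) < e) sequentially"
      by eventually_elim blast
    then obtain q where "crit d r q \<in> spectrum_depth s k" "crit d r q \<noteq> 1 / real d"
      "dist (crit d r q) (1 / real d) < e"
      using eventually_happens'[OF sequentially_bot] by blast
    then show "\<exists>x'\<in>spectrum_depth s k. x' \<noteq> 1 / real d \<and> dist x' (1 / real d) < e" by blast
  qed
  then show ?thesis by (simp add: d_def l_def)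
qed

end
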